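(* For each of the three kinds of matter (scalar $\phi$, Maxwell $F_{\mu\nu}$, Dirac $\psi$), consider the induced second-order graviton-matter interaction with kinematic propagators chosen for the matter fields (i.e. $L_{2,r,\mathrm{mat}}=0$), $$L_{2,\mathrm{mat}}=\tfrac14\,\mathrm{tr}(hh)\,\mathrm{tr}(\Theta_{\mathrm{mat}})-\mathrm{tr}(hh\Theta_{\mathrm{mat}})+L_{2,0,\mathrm{mat}},$$ as a Wick polynomial in the string-localized quantum field $h^{\mu\nu}(x;c)$ and the free quantum matter field. It coincides, up to total divergences, with the second-order term $L^{\mathrm{cl}}_{2,\mathrm{mat}}$ in the expansion $$L_{g,\mathrm{mat}}=L_{0,\mathrm{mat}}+\kappa L^{\mathrm{cl}}_{1,\mathrm{mat}}+\tfrac{\kappa^2}{2}L^{\mathrm{cl}}_{2,\mathrm{mat}}+O(\kappa^3)$$ of the classical generally covariant scalar, Maxwell, respectively Dirac Lagrangian in powers of $\kappa$, where $\sqrt{-g}\,g^{\mu\nu}=\eta^{\mu\nu}+\kappa h^{\mu\nu}$, when $h_{\mu\nu}(x;c)$ and the free quantum matter field are substituted for the classical metric deviation field $h_{\mu\nu}(x)$ and the classical matter field.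
   Context: **Quantum field $h$.** $h_{\mu\nu}(x;c)$ is the string-localized graviton potential $h_{\mu\nu}(x;c)=I_c^\kappa I_c^\lambda F_{[\mu\kappa][\nu\lambda]}(x)$, where $F_{[\mu\kappa][\nu\lambda]}$ is the free massless helicity-$\pm2$ field strength (linearized curvature) on the physical Fock space, and $I_c^\mu f(x)=\int d^4e\,c(e)e^\mu\int_0^\infty ds\,f(x+se)$ with $c\in C_c^\infty(\{e^2<0\})$, $\int c=1$. It satisfies as operator identities $h_{\mu\nu}=h_{\nu\mu}$, $\eta^{\mu\nu}h_{\mu\nu}=0$, $\partial^\mu h_{\mu\nu}=0$, $\square h_{\mu\nu}=0$. The quantum matter fields are free: $(\square+m^2)\phi=0$; $\partial^\mu F_{\mu\nu}=0$ and $\partial_{[\lambda}F_{\mu\nu]}=0$; $(i\gamma^\mu\partial_\mu-m)\psi=0$. Products at a point are Wick ordered. "Up to total divergences" means up to $\partial_\mu Q^\mu$ with $Q^\mu$ a Wick polynomial, free field equations being used. The metric $\eta$ is mostly negative. **Notation.** $(AB)_{\mu\nu}=A_{\mu\kappa}B^\kappa{}_\nu$, $\mathrm{tr}(AB)=A_{\kappa\lambda}B^{\kappa\lambda}$, $\mathrm{tr}(\Theta)=\Theta^\mu{}_\mu$, $\mathrm{tr}(hh\Theta)=h_{\mu\kappa}h^\kappa{}_\nu\Theta^{\mu\nu}$; $(h\,\partial^\mu h)^{\rho\sigma}=h^{\rho\lambda}\partial^\mu h_\lambda{}^\sigma$. **Stress-energy tensors and kinematic induced terms.** $\Theta^{\mu\nu}_\phi=\partial^\mu\phi\partial^\nu\phi-\tfrac12\eta^{\mu\nu}(\partial_\kappa\phi\partial^\kappa\phi-m^2\phi^2)$;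 $\Theta_F^{\mu\nu}=-F^{\mu\kappa}F^{\nu}{}_{\kappa}+\tfrac14\eta^{\mu\nu}F^{\kappa\lambda}F_{\kappa\lambda}$; $\Theta_\psi^{\mu\nu}=\tfrac i4(\overline\psi\gamma^\mu\partial^\nu\psi-\partial^\nu\overline\psi\gamma^\mu\psi+\overline\psi\gamma^\nu\partial^\mu\psi-\partial^\mu\overline\psi\gamma^\nu\psi)$. With $L_{0,\phi}=\tfrac12(\partial_\mu\phi\partial^\mu\phi-m^2\phi^2)$ and $L_{0,F}=-\tfrac14F_{\mu\nu}F^{\mu\nu}$, $$L_{2,0,\phi}=\mathrm{tr}(hh\Theta_\phi)+\tfrac12\mathrm{tr}(hh)L_{0,\phi},\quad L_{2,0,F}=\mathrm{tr}(hh\Theta_F)+\tfrac12\mathrm{tr}(hh)L_{0,F}-\tfrac12h_{\mu\nu}h_{\rho\sigma}F^{\mu\rho}F^{\nu\sigma},$$ $$L_{2,0,\psi}=\tfrac34\mathrm{tr}(hh\Theta_\psi)-\tfrac18\cdot\tfrac i2(h\,\partial^\mu h)^{\rho\sigma}\,\overline\psi(\gamma_\mu\gamma_\rho\gamma_\sigma-\gamma_\sigma\gamma_\rho\gamma_\mu)\psi.$$ (These arise from the requirement of second-order tree-level string-independence of the $\mathbb S$-matrix with first-order interaction the graviton self-coupling plus $\tfrac12h_{\mu\nu}\Theta^{\mu\nu}_{\mathrm{mat}}$.) **Classical generally covariant Lagrangians.** $-g=-\det g>0$. $$L_{g,\phi}=\tfrac12\sqrt{-g}\,(g^{\mu\nu}\partial_\mu\phi\partial_\nu\phi-m^2\phi^2),\qquad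 L_{g,F}=-\tfrac14\sqrt{-g}\,g^{\mu\nu}g^{\kappa\lambda}F_{\mu\kappa}F_{\nu\lambda},$$ $$L_{g,\psi}=\sqrt{-g}\,\Big[\tfrac i2\big(\overline\psi\gamma_g^\mu D_\mu\psi-(D_\mu\overline\psi)\gamma_g^\mu\psi\big)-m\overline\psi\psi\Big].$$ Here $\gamma_g^\mu=e^\mu_\alpha\gamma^\alpha$ with flat Dirac matrices $\gamma^\alpha\gamma^\beta+\gamma^\beta\gamma^\alpha=2\eta^{\alpha\beta}$. $e^\mu_\alpha$ is the real tetrad with $g^{\mu\nu}=e^\mu_\alpha e^\nu_\beta\eta^{\alpha\beta}$ given by the (symmetric, perturbative around $\delta^\mu_\alpha$) square root of $g^{\mu\nu}$. The spin connection is $\omega_{\mu;\alpha\beta}=g_{\kappa\lambda}e^\kappa_\alpha(\partial_\mu e^\lambda_\beta+\Gamma^\lambda_{\mu\nu}e^\nu_\beta)$ with $\Gamma$ the Christoffel symbols of $g$, and $D_\mu\psi=\partial_\mu\psi+\tfrac18\omega_{\mu;\alpha\beta}[\gamma^\alpha,\gamma^\beta]\psi$, $D_\mu\overline\psi=\partial_\mu\overline\psi-\tfrac18\omega_{\mu;\alpha\beta}\overline\psi[\gamma^\alpha,\gamma^\beta]$. *)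

theory Defs
  imports "HOL-Analysis.Analysis" "HOL-Library.Landau_Symbols"
begin

section \<open>Minkowski space and partial derivatives\<close>

text \<open>Spacetime indices range over the type \<open>4\<close>, with time index \<open>0\<close> (which is also \<open>4\<close> in this
  type) and space indices \<open>1, 2, 3\<close>. The metric is mostly negative.\<close>

type_synonym spacetime = "real^4"

definition eta :: "real^4^4" where
  "eta = (\<chi> \<mu> \<nu>. if \<mu> \<noteq> \<nu> then 0 else if \<mu> = 0 then 1 else -1)"

definition mink :: "real^4 \<Rightarrow> real^4 \<Rightarrow> real" where
  "mink p x = (\<Sum>\<mu>\<in>UNIV. \<Sum>\<nu>\<in>UNIV. eta$\<mu>$\<nu> * p$\<mu> * x$\<nu>)"

definition pd :: "4 \<Rightarrow> (spacetime \<Rightarrow> 'b::real_normed_vector) \<Rightarrow> spacetime \<Rightarrow> 'b" where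
  "pd \<mu> f x = frechet_derivative f (at x) (axis \<mu> 1)"

text \<open>\<open>C\<^sup>\<infinity>\<close>: \<open>D [\<mu>\<^sub>1, \<dots>, \<mu>\<^sub>n]\<close> are the iterated partial derivatives of \<open>f\<close>; each of them is again
  (totally) differentiable.\<close>

definition smooth :: "(spacetime \<Rightarrow> 'b::real_normed_vector) \<Rightarrow> bool" where
  "smooth f \<longleftrightarrow> (\<exists>D :: 4 list \<Rightarrow> spacetime \<Rightarrow> 'b. D [] = f \<and>
     (\<forall>is x. (D is has_derivative (\<lambda>v. \<Sum>\<mu>\<in>UNIV. v$\<mu> *\<^sub>R D (\<mu> # is) x)) (at x)))"


section \<open>Wick products\<close>

text \<open>One-particle modes of the physical Fock space: momentum, together with a helicity
  (\<open>True\<close> for \<open>+\<close>, \<open>False\<close> for \<open>-\<close>) or a spin label.\<close>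

datatype particle =
    Graviton "real^3" bool
  | Scalar "real^3"
  | Photon "real^3" bool
  | Electron "real^3" bool
  | Positron "real^3" bool

datatype ladder = Ann particle | Cre particle

fun fermion :: "particle \<Rightarrow> bool" where
  "fermion (Electron p s) = True"
| "fermion (Positron p s) = True"
| "fermion _ = False"

fun fermionic :: "ladder \<Rightarrow> bool" where
  "fermionic (Ann a) = fermion a"
| "fermionic (Cre a) = fermion a"

fun dagger :: "ladder \<Rightarrow> ladder" where
  "dagger (Ann a) = Cre a"
| "dagger (Cre a) = Ann a"

text \<open>A Wick-ordered field \<open>W(x)\<close> on Fock space is given by its normal ordered expansion
  \<open>W(x) = \<Sum>\<^sub>n (1/n!) \<integral> d\<ell>\<^sub>1 \<dots> d\<ell>\<^sub>n w(x; \<ell>\<^sub>1 \<dots> \<ell>\<^sub>n) :\<ell>\<^sub>1 \<dots> \<ell>\<^sub>n:\<close>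
  in creation and annihilation operators \<open>\<ell>\<^sub>i\<close>, where \<open>d\<ell>\<close> is the Lorentz invariant measure on the
  mass shell together with the sum over particles and spins, and \<open>:\<dots>:\<close> is normal ordering with
  the sign of the permutation of the fermionic operators. We represent it by the coefficient
  functions \<open>w\<close>, indexed by the list of ladder operators.

  The Wick product \<open>:W V:\<close> is obtained by distributing the ladder operators over the two factors.
  In the recursion, the first operator \<open>\<ell>\<close> either belongs to \<open>f\<close>, or to \<open>g\<close>; in the latter
  case, \<open>:\<dots>:\<close> produces a sign when \<open>\<ell>\<close> is moved past the operators belonging to \<open>f\<close>.\<close>

definition swap_sign :: "ladder \<Rightarrow> ladder list \<Rightarrow> complex" where
  "swap_sign l ls = (if fermionic l then (-1) ^ length (filter fermionic ls) else 1)"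

fun kernel_mult ::
    "(ladder list \<Rightarrow> complex) \<Rightarrow> (ladder list \<Rightarrow> complex) \<Rightarrow> ladder list \<Rightarrow> complex" where
  "kernel_mult f g [] = f [] * g []"
| "kernel_mult f g (l # ls) =
     kernel_mult (\<lambda>ks. f (l # ks)) g ls
   + kernel_mult (\<lambda>ks. swap_sign l ks * f ks) (\<lambda>ks. g (l # ks)) ls"

typedef wick = "UNIV :: (spacetime \<Rightarrow> ladder list \<Rightarrow> complex) set"
  morphisms kernel Wick ..

lemmas kernel_Wick [simp] = Wick_inverse [OF UNIV_I]

lemma wick_eqI: "(\<And>x ls. kernel W x ls = kernel V x ls) \<Longrightarrow> W = V"
  by (metis ext kernel_inject)

lemma kernel_mult_add_left:
  "kernel_mult (\<lambda>k. f k + f' k) g ls = kernel_mult f g ls + kernel_mult f' g ls"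
  by (induction ls arbitrary: f f' g) (simp_all add: algebra_simps)

lemma kernel_mult_add_right:
  "kernel_mult f (\<lambda>k. g k + g' k) ls = kernel_mult f g ls + kernel_mult f g' ls"
  by (induction ls arbitrary: f g g') (simp_all add: algebra_simps)

lemma kernel_mult_scale_left: "kernel_mult (\<lambda>k. c * f k) g ls = c * kernel_mult f g ls"
proof (induction ls arbitrary: f g)
  case (Cons l ls)
  have "(\<lambda>k. swap_sign l k * (c * f k)) = (\<lambda>k. c * (swap_sign l k * f k))"
    by (simp add: ac_simps)
  with Cons show ?case by (simp add: algebra_simps)
qed simp

lemma kernel_mult_scale_right: "kernel_mult f (\<lambda>k. c * g k) ls = c * kernel_mult f g ls"
  by (induction ls arbitrary: f g) (simp_all add: algebra_simps)

lemma kernel_mult_zero: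
  "kernel_mult (\<lambda>k. 0) g ls = 0" "kernel_mult f (\<lambda>k. 0) ls = 0"
  using kernel_mult_scale_left[of 0 "\<lambda>_. 0" g ls] kernel_mult_scale_right[of f 0 "\<lambda>_. 0" ls]
  by simp_all

lemma kernel_mult_one_left: "kernel_mult (\<lambda>k. if k = [] then 1 else 0) g ls = g ls"
proof (induction ls arbitrary: g)
  case (Cons l ls)
  have "(\<lambda>k. swap_sign l k * (if k = [] then 1 else 0)) = (\<lambda>k. if k = [] then 1 else 0)"
    by (auto simp: swap_sign_def)
  with Cons show ?case by (simp add: kernel_mult_zero)
qed simp

lemma kernel_mult_one_right: "kernel_mult f (\<lambda>k. if k = [] then 1 else 0) ls = f ls"
  by (induction ls arbitrary: f) (simp_all add: kernel_mult_zero)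

lemma kernel_mult_swap_sign:
  "swap_sign l ls * kernel_mult f g ls =
     kernel_mult (\<lambda>k. swap_sign l k * f k) (\<lambda>k. swap_sign l k * g k) ls"
proof (induction ls arbitrary: f g)
  case (Cons m ls)
  have step: "swap_sign l (m # k) = swap_sign l [m] * swap_sign l k" for k
    by (simp add: swap_sign_def)
  have *: "(\<lambda>k. swap_sign l (m # k) * u k) = (\<lambda>k. swap_sign l [m] * (swap_sign l k * u k))"
    for u :: "ladder list \<Rightarrow> complex"
    by (subst step) (simp add: ac_simps)
  have **: "(\<lambda>k. swap_sign m k * (swap_sign l k * f k)) =
      (\<lambda>k. swap_sign l k * (swap_sign m k * f k))"
    by (simp add: ac_simps)
  show ?case
    unfolding kernel_mult.simps * ** kernel_mult_scale_left kernel_mult_scale_right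
      Cons.IH[symmetric] by (subst step) (simp add: algebra_simps)
qed (simp add: swap_sign_def)

lemma kernel_mult_assoc:
  "kernel_mult (kernel_mult f g) h ls = kernel_mult f (kernel_mult g h) ls"
proof (induction ls arbitrary: f g h)
  case (Cons l ls)
  show ?case
    by (simp add: kernel_mult_add_left kernel_mult_add_right kernel_mult_swap_sign Cons.IH)
qed simp

instantiation wick :: ring_1
begin

definition "0 = Wick (\<lambda>x ls. 0)"
definition "1 = Wick (\<lambda>x ls. if ls = [] then 1 else 0)"
definition "W + V = Wick (\<lambda>x ls. kernel W x ls + kernel V x ls)"
definition "W - V = Wick (\<lambda>x ls. kernel W x ls - kernel V x ls)"
definition "- W = Wick (\<lambda>x ls. - kernel W x ls)"
definition "W * V = Wick (\<lambda>x. kernel_mult (kernel W x) (kernel V x))"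

instance
proof
  fix a b c :: wick
  show "a * b * c = a * (b * c)"
    by (rule wick_eqI) (simp add: times_wick_def kernel_mult_assoc)
  show "(a + b) * c = a * c + b * c" "a * (b + c) = a * b + a * c"
    by (rule wick_eqI; simp add: times_wick_def plus_wick_def kernel_mult_add_left
        kernel_mult_add_right)+
  show "1 * a = a" "a * 1 = a"
    by (rule wick_eqI; simp add: times_wick_def one_wick_def kernel_mult_one_left
        kernel_mult_one_right)+
  have "kernel (0::wick) x [] \<noteq> kernel (1::wick) x []" for x
    by (simp add: zero_wick_def one_wick_def)
  then show "(0::wick) \<noteq> 1" by metis
qed (rule wick_eqI; simp add: plus_wick_def minus_wick_def uminus_wick_def zero_wick_def)+

end

definition wconst :: "complex \<Rightarrow> wick" where
  "wconst z = Wick (\<lambda>x ls. if ls = [] then z else 0)"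

definition wpd :: "4 \<Rightarrow> wick \<Rightarrow> wick" where
  "wpd \<mu> W = Wick (\<lambda>x ls. pd \<mu> (\<lambda>y. kernel W y ls) x)"

definition adjoint :: "wick \<Rightarrow> wick" where
  "adjoint W = Wick (\<lambda>x ls. cnj (kernel W x (map dagger (rev ls))))"

text \<open>Wick polynomials in a set \<open>G\<close> of free fields and their derivatives.\<close>

inductive_set wick_polynomials :: "wick set \<Rightarrow> wick set" for G where
  const: "wconst z \<in> wick_polynomials G"
| field: "W \<in> G \<Longrightarrow> W \<in> wick_polynomials G"
| deriv: "W \<in> wick_polynomials G \<Longrightarrow> wpd \<mu> W \<in> wick_polynomials G"
| sum: "W \<in> wick_polynomials G \<Longrightarrow> V \<in> wick_polynomials G \<Longrightarrow> W + V \<in> wick_polynomials G"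
| prod: "W \<in> wick_polynomials G \<Longrightarrow> V \<in> wick_polynomials G \<Longrightarrow> W * V \<in> wick_polynomials G"

definition eq_up_to_div :: "wick set \<Rightarrow> wick \<Rightarrow> wick \<Rightarrow> bool" where
  "eq_up_to_div G W V \<longleftrightarrow>
     (\<exists>Q :: 4 \<Rightarrow> wick. (\<forall>\<mu>. Q \<mu> \<in> wick_polynomials G) \<and> W - V = (\<Sum>\<mu>\<in>UNIV. wpd \<mu> (Q \<mu>)))"


section \<open>Free quantum fields\<close>

definition fourvec :: "'a \<Rightarrow> 'a^3 \<Rightarrow> 'a^4" where
  "fourvec t v = (\<chi> \<mu>. if \<mu> = 0 then t else if \<mu> = 1 then v$1 else if \<mu> = 2 then v$2 else v$3)"

definition onshell :: "real \<Rightarrow> real^3 \<Rightarrow> real^4" where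
  "onshell m p = fourvec (sqrt (m\<^sup>2 + p \<bullet> p)) p"

definition plane_wave :: "real \<Rightarrow> real^3 \<Rightarrow> spacetime \<Rightarrow> complex" where
  "plane_wave m p x = cis (- mink (onshell m p) x)"

definition lower :: "complex^4 \<Rightarrow> complex^4" where
  "lower w = (\<chi> \<mu>. \<Sum>\<nu>\<in>UNIV. of_real (eta$\<mu>$\<nu>) * w$\<nu>)"

text \<open>The field \<open>\<integral> da u(x,a) a\<close> linear in the annihilation operators.\<close>

definition annihilation_field :: "(spacetime \<Rightarrow> particle \<Rightarrow> complex) \<Rightarrow> wick" where
  "annihilation_field u = Wick (\<lambda>x ls. case ls of [Ann a] \<Rightarrow> u x a | _ \<Rightarrow> 0)"

definition hermitian_field :: "(spacetime \<Rightarrow> particle \<Rightarrow> complex) \<Rightarrow> wick" where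
  "hermitian_field u = annihilation_field u + adjoint (annihilation_field u)"

definition scalar_field :: "real \<Rightarrow> wick" where
  "scalar_field m = hermitian_field (\<lambda>x a. case a of Scalar p \<Rightarrow> plane_wave m p x | _ \<Rightarrow> 0)"

text \<open>Circular polarization vectors (spatial part; the time component is \<open>0\<close>): normalized
  eigenvectors of the helicity operator \<open>w \<mapsto> i p \<times> w / |p|\<close>.\<close>

definition helicity_vectors :: "(real^3 \<Rightarrow> bool \<Rightarrow> complex^3) \<Rightarrow> bool" where
  "helicity_vectors eps \<longleftrightarrow> (\<forall>p s. p \<noteq> 0 \<longrightarrow> norm (eps p s) = 1 \<and>
     (let w = eps p s; q = \<lambda>i. complex_of_real (p$i) in
      \<i> *s (vector [q 2 * w$3 - q 3 * w$2, q 3 * w$1 - q 1 * w$3, q 1 * w$2 - q 2 * w$1] :: complex^3)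
        = complex_of_real ((if s then 1 else -1) * norm p) *s w))"

text \<open>\<open>p\<^sub>\<mu> \<epsilon>\<^sub>\<nu> - p\<^sub>\<nu> \<epsilon>\<^sub>\<mu>\<close> with the four-dimensional lower indices.\<close>

definition wedge :: "(real^3 \<Rightarrow> bool \<Rightarrow> complex^3) \<Rightarrow> real^3 \<Rightarrow> bool \<Rightarrow> 4 \<Rightarrow> 4 \<Rightarrow> complex" where
  "wedge eps p s \<mu> \<nu> =
     (let q = lower (\<chi> \<kappa>. of_real (onshell 0 p $ \<kappa>)); w = lower (fourvec 0 (eps p s))
      in q$\<mu> * w$\<nu> - q$\<nu> * w$\<mu>)"

definition maxwell_field :: "(real^3 \<Rightarrow> bool \<Rightarrow> complex^3) \<Rightarrow> 4 \<Rightarrow> 4 \<Rightarrow> wick" where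
  "maxwell_field eps \<mu> \<nu> = hermitian_field (\<lambda>x a. case a of
     Photon p s \<Rightarrow> (- \<i>) * wedge eps p s \<mu> \<nu> * plane_wave 0 p x | _ \<Rightarrow> 0)"

text \<open>\<open>curvature eps \<mu> \<kappa> \<nu> \<tau>\<close> is \<open>F\<^bsub>[\<mu>\<kappa>][\<nu>\<tau>]\<^esub>\<close>, the linearized curvature of the massless
  helicity-2 particle, with polarization tensor \<open>\<epsilon>\<^sub>\<kappa> \<epsilon>\<^sub>\<tau>\<close>.\<close>

definition curvature :: "(real^3 \<Rightarrow> bool \<Rightarrow> complex^3) \<Rightarrow> 4 \<Rightarrow> 4 \<Rightarrow> 4 \<Rightarrow> 4 \<Rightarrow> wick" where
  "curvature eps \<mu> \<kappa> \<nu> \<tau> = hermitian_field (\<lambda>x a. case a of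
     Graviton p s \<Rightarrow> ((- \<i>) * wedge eps p s \<mu> \<kappa>) * ((- \<i>) * wedge eps p s \<nu> \<tau>) * plane_wave 0 p x
   | _ \<Rightarrow> 0)"

definition string_smearing :: "(spacetime \<Rightarrow> real) \<Rightarrow> bool" where
  "string_smearing c \<longleftrightarrow> smooth c \<and> compact (closure {e. c e \<noteq> 0}) \<and>
     closure {e. c e \<noteq> 0} \<subseteq> {e. mink e e < 0} \<and> (LINT e|lborel. c e) = 1"

text \<open>The string integration \<open>I\<^sub>c\<^sup>\<mu>\<close>. On the kernels of operator-valued distributions, which are plane waves
  in \<open>x\<close>, the integral over \<open>e\<close> is done first: \<open>\<integral> d\<^sup>4e c(e) e\<^sup>\<mu> exp(-i s pe)\<close> is rapidly decreasing
  in \<open>s\<close>, and the result is the distribution in \<open>p\<close> obtained in either order.\<close>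

definition string_integral :: "(spacetime \<Rightarrow> real) \<Rightarrow> 4 \<Rightarrow> wick \<Rightarrow> wick" where
  "string_integral c \<mu> W = Wick (\<lambda>x ls.
     LINT s:{0..}|lborel. LINT e|lborel. of_real (c e * e$\<mu>) * kernel W (x + s *\<^sub>R e) ls)"

definition graviton_field ::
    "(spacetime \<Rightarrow> real) \<Rightarrow> (real^3 \<Rightarrow> bool \<Rightarrow> complex^3) \<Rightarrow> 4 \<Rightarrow> 4 \<Rightarrow> wick" where
  "graviton_field c eps \<mu> \<nu> = (\<Sum>\<kappa>\<in>UNIV. \<Sum>\<tau>\<in>UNIV.
     string_integral c \<kappa> (string_integral c \<tau> (curvature eps \<mu> \<kappa> \<nu> \<tau>)))"

definition dirac_matrices :: "(4 \<Rightarrow> complex^4^4) \<Rightarrow> bool" where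
  "dirac_matrices \<gamma> \<longleftrightarrow>
     (\<forall>\<alpha> \<beta>. \<gamma> \<alpha> ** \<gamma> \<beta> + \<gamma> \<beta> ** \<gamma> \<alpha> = mat (2 * of_real (eta$\<alpha>$\<beta>))) \<and>
     (\<forall>\<alpha>. (\<chi> a b. cnj (\<gamma> \<alpha> $ b $ a)) = \<gamma> 0 ** \<gamma> \<alpha> ** \<gamma> 0)"

definition slash :: "(4 \<Rightarrow> complex^4^4) \<Rightarrow> real^4 \<Rightarrow> complex^4^4" where
  "slash \<gamma> p = (\<Sum>\<mu>\<in>UNIV. \<Sum>\<nu>\<in>UNIV. (eta$\<mu>$\<nu> * p$\<mu>) *\<^sub>R \<gamma> \<nu>)"

text \<open>Bases of positive and negative frequency solutions, with the Lorentz invariant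
  normalization; at \<open>m = 0\<close>, \<open>p = 0\<close> it gives \<open>u = v = 0\<close>.\<close>

definition dirac_spinors :: "(4 \<Rightarrow> complex^4^4) \<Rightarrow> real \<Rightarrow> (real^3 \<Rightarrow> bool \<Rightarrow> complex^4) \<Rightarrow>
    (real^3 \<Rightarrow> bool \<Rightarrow> complex^4) \<Rightarrow> bool" where
  "dirac_spinors \<gamma> m u v \<longleftrightarrow> (\<forall>p s.
     slash \<gamma> (onshell m p) *v u p s = of_real m *s u p s \<and>
     slash \<gamma> (onshell m p) *v v p s = - (of_real m *s v p s) \<and>
     (\<forall>s'. (\<Sum>a\<in>UNIV. cnj (u p s $ a) * u p s' $ a) = (if s = s' then of_real (2 * onshell m p $ 0) else 0) \<and>
           (\<Sum>a\<in>UNIV. cnj (v p s $ a) * v p s' $ a) = (if s = s' then of_real (2 * onshell m p $ 0) else 0)))"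

definition dirac_field ::
    "real \<Rightarrow> (real^3 \<Rightarrow> bool \<Rightarrow> complex^4) \<Rightarrow> (real^3 \<Rightarrow> bool \<Rightarrow> complex^4) \<Rightarrow> 4 \<Rightarrow> wick" where
  "dirac_field m u v a =
     annihilation_field (\<lambda>x b. case b of Electron p s \<Rightarrow> u p s $ a * plane_wave m p x | _ \<Rightarrow> 0)
   + adjoint (annihilation_field (\<lambda>x b. case b of
       Positron p s \<Rightarrow> cnj (v p s $ a) * plane_wave m p x | _ \<Rightarrow> 0))"

definition dirac_conjugate :: "(4 \<Rightarrow> complex^4^4) \<Rightarrow> (4 \<Rightarrow> wick) \<Rightarrow> 4 \<Rightarrow> wick" where
  "dirac_conjugate \<gamma> \<psi> a = (\<Sum>b\<in>UNIV. wconst (\<gamma> 0 $ b $ a) * adjoint (\<psi> b))"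


section \<open>The induced second-order interaction\<close>

abbreviation weta :: "4 \<Rightarrow> 4 \<Rightarrow> wick" where
  "weta \<mu> \<nu> \<equiv> wconst (of_real (eta$\<mu>$\<nu>))"

definition wpd_up :: "4 \<Rightarrow> wick \<Rightarrow> wick" where
  "wpd_up \<mu> W = (\<Sum>\<nu>\<in>UNIV. weta \<mu> \<nu> * wpd \<nu> W)"

definition raise_both :: "(4 \<Rightarrow> 4 \<Rightarrow> wick) \<Rightarrow> 4 \<Rightarrow> 4 \<Rightarrow> wick" where
  "raise_both A \<mu> \<nu> = (\<Sum>\<rho>\<in>UNIV. \<Sum>\<sigma>\<in>UNIV. weta \<mu> \<rho> * weta \<nu> \<sigma> * A \<rho> \<sigma>)"

definition tr2 :: "(4 \<Rightarrow> 4 \<Rightarrow> wick) \<Rightarrow> (4 \<Rightarrow> 4 \<Rightarrow> wick) \<Rightarrow> wick" where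
  "tr2 A B = (\<Sum>\<kappa>\<in>UNIV. \<Sum>\<tau>\<in>UNIV. A \<kappa> \<tau> * raise_both B \<kappa> \<tau>)"

text \<open>In \<open>tr1\<close> and \<open>tr3\<close>, \<open>h\<close> has lower and \<open>\<Theta>\<close> has upper indices.\<close>

definition tr1 :: "(4 \<Rightarrow> 4 \<Rightarrow> wick) \<Rightarrow> wick" where
  "tr1 \<Theta> = (\<Sum>\<mu>\<in>UNIV. \<Sum>\<nu>\<in>UNIV. weta \<mu> \<nu> * \<Theta> \<mu> \<nu>)"

definition tr3 :: "(4 \<Rightarrow> 4 \<Rightarrow> wick) \<Rightarrow> (4 \<Rightarrow> 4 \<Rightarrow> wick) \<Rightarrow> wick" where
  "tr3 h \<Theta> = (\<Sum>\<mu>\<in>UNIV. \<Sum>\<nu>\<in>UNIV.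
     (\<Sum>\<kappa>\<in>UNIV. \<Sum>\<tau>\<in>UNIV. h \<mu> \<kappa> * weta \<kappa> \<tau> * h \<tau> \<nu>) * \<Theta> \<mu> \<nu>)"

definition L2 :: "(4 \<Rightarrow> 4 \<Rightarrow> wick) \<Rightarrow> (4 \<Rightarrow> 4 \<Rightarrow> wick) \<Rightarrow> wick \<Rightarrow> wick" where
  "L2 h \<Theta> L20 = wconst (1/4) * tr2 h h * tr1 \<Theta> - tr3 h \<Theta> + L20"

subsection \<open>Scalar field\<close>

definition \<Theta>_scalar :: "real \<Rightarrow> wick \<Rightarrow> 4 \<Rightarrow> 4 \<Rightarrow> wick" where
  "\<Theta>_scalar m \<phi> \<mu> \<nu> = wpd_up \<mu> \<phi> * wpd_up \<nu> \<phi>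
     - wconst (1/2) * weta \<mu> \<nu> *
       ((\<Sum>\<kappa>\<in>UNIV. wpd \<kappa> \<phi> * wpd_up \<kappa> \<phi>) - wconst (of_real (m\<^sup>2)) * \<phi> * \<phi>)"

definition L0_scalar :: "real \<Rightarrow> wick \<Rightarrow> wick" where
  "L0_scalar m \<phi> = wconst (1/2) *
     ((\<Sum>\<mu>\<in>UNIV. wpd \<mu> \<phi> * wpd_up \<mu> \<phi>) - wconst (of_real (m\<^sup>2)) * \<phi> * \<phi>)"

definition L20_scalar :: "(4 \<Rightarrow> 4 \<Rightarrow> wick) \<Rightarrow> real \<Rightarrow> wick \<Rightarrow> wick" where
  "L20_scalar h m \<phi> = tr3 h (\<Theta>_scalar m \<phi>) + wconst (1/2) * tr2 h h * L0_scalar m \<phi>"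

definition L2_scalar :: "(4 \<Rightarrow> 4 \<Rightarrow> wick) \<Rightarrow> real \<Rightarrow> wick \<Rightarrow> wick" where
  "L2_scalar h m \<phi> = L2 h (\<Theta>_scalar m \<phi>) (L20_scalar h m \<phi>)"

subsection \<open>Maxwell field\<close>

definition \<Theta>_maxwell :: "(4 \<Rightarrow> 4 \<Rightarrow> wick) \<Rightarrow> 4 \<Rightarrow> 4 \<Rightarrow> wick" where
  "\<Theta>_maxwell F \<mu> \<nu> =
     - (\<Sum>\<kappa>\<in>UNIV. \<Sum>\<tau>\<in>UNIV. raise_both F \<mu> \<kappa> * weta \<kappa> \<tau> * raise_both F \<nu> \<tau>)
     + wconst (1/4) * weta \<mu> \<nu> * (\<Sum>\<kappa>\<in>UNIV. \<Sum>\<tau>\<in>UNIV. raise_both F \<kappa> \<tau> * F \<kappa> \<tau>)"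

definition L0_maxwell :: "(4 \<Rightarrow> 4 \<Rightarrow> wick) \<Rightarrow> wick" where
  "L0_maxwell F = - wconst (1/4) * (\<Sum>\<mu>\<in>UNIV. \<Sum>\<nu>\<in>UNIV. F \<mu> \<nu> * raise_both F \<mu> \<nu>)"

definition L20_maxwell :: "(4 \<Rightarrow> 4 \<Rightarrow> wick) \<Rightarrow> (4 \<Rightarrow> 4 \<Rightarrow> wick) \<Rightarrow> wick" where
  "L20_maxwell h F = tr3 h (\<Theta>_maxwell F) + wconst (1/2) * tr2 h h * L0_maxwell F
     - wconst (1/2) * (\<Sum>\<mu>\<in>UNIV. \<Sum>\<nu>\<in>UNIV. \<Sum>\<rho>\<in>UNIV. \<Sum>\<sigma>\<in>UNIV.
         h \<mu> \<nu> * h \<rho> \<sigma> * raise_both F \<mu> \<rho> * raise_both F \<nu> \<sigma>)"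

definition L2_maxwell :: "(4 \<Rightarrow> 4 \<Rightarrow> wick) \<Rightarrow> (4 \<Rightarrow> 4 \<Rightarrow> wick) \<Rightarrow> wick" where
  "L2_maxwell h F = L2 h (\<Theta>_maxwell F) (L20_maxwell h F)"

subsection \<open>Dirac field\<close>

definition sandwich :: "(4 \<Rightarrow> wick) \<Rightarrow> complex^4^4 \<Rightarrow> (4 \<Rightarrow> wick) \<Rightarrow> wick" where
  "sandwich A M B = (\<Sum>a\<in>UNIV. \<Sum>b\<in>UNIV. A a * wconst (M$a$b) * B b)"

definition gamma_low :: "(4 \<Rightarrow> complex^4^4) \<Rightarrow> 4 \<Rightarrow> complex^4^4" where
  "gamma_low \<gamma> \<mu> = (\<Sum>\<nu>\<in>UNIV. (eta$\<mu>$\<nu>) *\<^sub>R \<gamma> \<nu>)"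

definition \<Theta>_dirac :: "(4 \<Rightarrow> complex^4^4) \<Rightarrow> (4 \<Rightarrow> wick) \<Rightarrow> 4 \<Rightarrow> 4 \<Rightarrow> wick" where
  "\<Theta>_dirac \<gamma> \<psi> \<mu> \<nu> = (let \<psi>b = dirac_conjugate \<gamma> \<psi> in wconst (\<i>/4) *
     (sandwich \<psi>b (\<gamma> \<mu>) (\<lambda>a. wpd_up \<nu> (\<psi> a)) - sandwich (\<lambda>a. wpd_up \<nu> (\<psi>b a)) (\<gamma> \<mu>) \<psi>
    + sandwich \<psi>b (\<gamma> \<nu>) (\<lambda>a. wpd_up \<mu> (\<psi> a)) - sandwich (\<lambda>a. wpd_up \<mu> (\<psi>b a)) (\<gamma> \<nu>) \<psi>))"

text \<open>\<open>(h \<partial>\<^sup>\<mu> h)\<^sup>\<rho>\<^sup>\<sigma> = h\<^sup>\<rho>\<^sup>\<tau> \<partial>\<^sup>\<mu> h\<^sub>\<tau>\<^sup>\<sigma>\<close>\<close>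

definition h_dh :: "(4 \<Rightarrow> 4 \<Rightarrow> wick) \<Rightarrow> 4 \<Rightarrow> 4 \<Rightarrow> 4 \<Rightarrow> wick" where
  "h_dh h \<mu> \<rho> \<sigma> = (\<Sum>\<tau>\<in>UNIV. raise_both h \<rho> \<tau> * wpd_up \<mu> (\<Sum>\<nu>\<in>UNIV. weta \<sigma> \<nu> * h \<tau> \<nu>))"

definition L20_dirac :: "(4 \<Rightarrow> 4 \<Rightarrow> wick) \<Rightarrow> (4 \<Rightarrow> complex^4^4) \<Rightarrow> (4 \<Rightarrow> wick) \<Rightarrow> wick" where
  "L20_dirac h \<gamma> \<psi> = wconst (3/4) * tr3 h (\<Theta>_dirac \<gamma> \<psi>)
     - wconst (1/8 * (\<i>/2)) * (\<Sum>\<mu>\<in>UNIV. \<Sum>\<rho>\<in>UNIV. \<Sum>\<sigma>\<in>UNIV. h_dh h \<mu> \<rho> \<sigma> *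
         sandwich (dirac_conjugate \<gamma> \<psi>)
           (gamma_low \<gamma> \<mu> ** gamma_low \<gamma> \<rho> ** gamma_low \<gamma> \<sigma>
            - gamma_low \<gamma> \<sigma> ** gamma_low \<gamma> \<rho> ** gamma_low \<gamma> \<mu>) \<psi>)"

definition L2_dirac :: "(4 \<Rightarrow> 4 \<Rightarrow> wick) \<Rightarrow> (4 \<Rightarrow> complex^4^4) \<Rightarrow> (4 \<Rightarrow> wick) \<Rightarrow> wick" where
  "L2_dirac h \<gamma> \<psi> = L2 h (\<Theta>_dirac \<gamma> \<psi>) (L20_dirac h \<gamma> \<psi>)"


section \<open>Classical generally covariant Lagrangians\<close>

text \<open>\<open>g\<close> is the covariant metric \<open>g\<^sub>\<mu>\<^sub>\<nu>\<close>.\<close>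

definition Lcl_scalar ::
    "real \<Rightarrow> (spacetime \<Rightarrow> real^4^4) \<Rightarrow> (spacetime \<Rightarrow> real) \<Rightarrow> spacetime \<Rightarrow> real" where
  "Lcl_scalar m g \<phi> x = 1/2 * sqrt (- det (g x)) *
     ((\<Sum>\<mu>\<in>UNIV. \<Sum>\<nu>\<in>UNIV. matrix_inv (g x) $\<mu>$\<nu> * pd \<mu> \<phi> x * pd \<nu> \<phi> x) - m\<^sup>2 * (\<phi> x)\<^sup>2)"

definition Lcl_maxwell ::
    "(spacetime \<Rightarrow> real^4^4) \<Rightarrow> (spacetime \<Rightarrow> real^4^4) \<Rightarrow> spacetime \<Rightarrow> real" where
  "Lcl_maxwell g F x = - 1/4 * sqrt (- det (g x)) *
     (\<Sum>\<mu>\<in>UNIV. \<Sum>\<nu>\<in>UNIV. \<Sum>\<kappa>\<in>UNIV. \<Sum>\<tau>\<in>UNIV.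
        matrix_inv (g x) $\<mu>$\<nu> * matrix_inv (g x) $\<kappa>$\<tau> * F x $\<mu>$\<kappa> * F x $\<nu>$\<tau>)"

definition christoffel :: "(spacetime \<Rightarrow> real^4^4) \<Rightarrow> 4 \<Rightarrow> 4 \<Rightarrow> 4 \<Rightarrow> spacetime \<Rightarrow> real" where
  "christoffel g \<tau> \<mu> \<nu> x = 1/2 * (\<Sum>\<rho>\<in>UNIV. matrix_inv (g x) $\<tau>$\<rho> *
     (pd \<mu> (\<lambda>y. g y $\<rho>$\<nu>) x + pd \<nu> (\<lambda>y. g y $\<rho>$\<mu>) x - pd \<rho> (\<lambda>y. g y $\<mu>$\<nu>) x))"

text \<open>The matrix \<open>e\<^sup>\<mu>\<^sub>\<alpha>\<close> (row \<open>\<mu>\<close>, column \<open>\<alpha>\<close>), as a function of the inverse metric near \<open>\<eta>\<close>. Symmetry is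
  that of \<open>e\<^sup>\<mu>\<^sup>\<alpha>\<close>. The bound on the (Frobenius) norm selects the perturbative
  solution: there is at most one in this ball.\<close>

definition tetrad :: "real^4^4 \<Rightarrow> real^4^4" where
  "tetrad gi = (THE E. E ** eta ** transpose E = gi \<and> transpose (E ** eta) = E ** eta \<and>
     norm (E - mat 1) < 1)"

definition spin_connection :: "(spacetime \<Rightarrow> real^4^4) \<Rightarrow> 4 \<Rightarrow> 4 \<Rightarrow> 4 \<Rightarrow> spacetime \<Rightarrow> real" where
  "spin_connection g \<mu> \<alpha> \<beta> x = (let E = \<lambda>y. tetrad (matrix_inv (g y)) in
     \<Sum>\<kappa>\<in>UNIV. \<Sum>\<tau>\<in>UNIV. g x $\<kappa>$\<tau> * E x $\<kappa>$\<alpha> *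
       (pd \<mu> (\<lambda>y. E y $\<tau>$\<beta>) x + (\<Sum>\<nu>\<in>UNIV. christoffel g \<tau> \<mu> \<nu> x * E x $\<nu>$\<beta>)))"

definition spin_term :: "(4 \<Rightarrow> complex^4^4) \<Rightarrow> (spacetime \<Rightarrow> real^4^4) \<Rightarrow> 4 \<Rightarrow> spacetime \<Rightarrow> complex^4^4" where
  "spin_term \<gamma> g \<mu> x = (1/8) *\<^sub>R (\<Sum>\<alpha>\<in>UNIV. \<Sum>\<beta>\<in>UNIV.
     spin_connection g \<mu> \<alpha> \<beta> x *\<^sub>R (\<gamma> \<alpha> ** \<gamma> \<beta> - \<gamma> \<beta> ** \<gamma> \<alpha>))"

definition bar :: "(4 \<Rightarrow> complex^4^4) \<Rightarrow> complex^4 \<Rightarrow> complex^4" where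
  "bar \<gamma> s = (\<chi> a. cnj (s$a)) v* \<gamma> 0"

definition pair :: "complex^4 \<Rightarrow> complex^4 \<Rightarrow> complex" where
  "pair s t = (\<Sum>a\<in>UNIV. s$a * t$a)"

definition Lcl_dirac :: "(4 \<Rightarrow> complex^4^4) \<Rightarrow> real \<Rightarrow> (spacetime \<Rightarrow> real^4^4) \<Rightarrow>
    (spacetime \<Rightarrow> complex^4) \<Rightarrow> spacetime \<Rightarrow> complex" where
  "Lcl_dirac \<gamma> m g \<psi> x =
     (let \<psi>b = \<lambda>y. bar \<gamma> (\<psi> y);
          \<gamma>g = \<lambda>\<mu>. (\<Sum>\<alpha>\<in>UNIV. (tetrad (matrix_inv (g x)) $\<mu>$\<alpha>) *\<^sub>R \<gamma> \<alpha>);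
          D = \<lambda>\<mu>. pd \<mu> \<psi> x + spin_term \<gamma> g \<mu> x *v \<psi> x;
          Db = \<lambda>\<mu>. pd \<mu> \<psi>b x - \<psi>b x v* spin_term \<gamma> g \<mu> x
      in of_real (sqrt (- det (g x))) *
         (\<i>/2 * (\<Sum>\<mu>\<in>UNIV. pair (\<psi>b x) (\<gamma>g \<mu> *v D \<mu>) - pair (Db \<mu>) (\<gamma>g \<mu> *v \<psi> x))
          - of_real m * pair (\<psi>b x) (\<psi> x)))"

text \<open>The free Lagrangians\<close>

definition Lcl0_scalar :: "real \<Rightarrow> (spacetime \<Rightarrow> real) \<Rightarrow> spacetime \<Rightarrow> real" where
  "Lcl0_scalar m \<phi> x =
     1/2 * ((\<Sum>\<mu>\<in>UNIV. \<Sum>\<nu>\<in>UNIV. eta$\<mu>$\<nu> * pd \<mu> \<phi> x * pd \<nu> \<phi> x) - m\<^sup>2 * (\<phi> x)\<^sup>2)"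

definition Lcl0_maxwell :: "(spacetime \<Rightarrow> real^4^4) \<Rightarrow> spacetime \<Rightarrow> real" where
  "Lcl0_maxwell F x =
     - 1/4 * (\<Sum>\<mu>\<in>UNIV. \<Sum>\<nu>\<in>UNIV. F x $\<mu>$\<nu> * (eta ** F x ** eta)$\<mu>$\<nu>)"

definition Lcl0_dirac ::
    "(4 \<Rightarrow> complex^4^4) \<Rightarrow> real \<Rightarrow> (spacetime \<Rightarrow> complex^4) \<Rightarrow> spacetime \<Rightarrow> complex" where
  "Lcl0_dirac \<gamma> m \<psi> x = (let \<psi>b = \<lambda>y. bar \<gamma> (\<psi> y) in
     \<i>/2 * (\<Sum>\<mu>\<in>UNIV. pair (\<psi>b x) (\<gamma> \<mu> *v pd \<mu> \<psi> x) - pair (pd \<mu> \<psi>b x) (\<gamma> \<mu> *v \<psi> x))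
     - of_real m * pair (\<psi>b x) (\<psi> x))"

text \<open>The metric with \<open>\<surd>-g g\<^sup>\<mu>\<^sup>\<nu> = \<eta>\<^sup>\<mu>\<^sup>\<nu> + \<kappa> h\<^sup>\<mu>\<^sup>\<nu>\<close>, where \<open>h\<close> has lower indices.\<close>

definition metric :: "real \<Rightarrow> (spacetime \<Rightarrow> real^4^4) \<Rightarrow> spacetime \<Rightarrow> real^4^4" where
  "metric \<kappa> h x = (THE g. det g < 0 \<and>
     sqrt (- det g) *\<^sub>R matrix_inv g = eta + \<kappa> *\<^sub>R (eta ** h x ** eta))"


section \<open>The second-order term and the substitution of the quantum fields\<close>

text \<open>Differential polynomials: sums of \<open>z * j\<^sub>1 * \<dots> * j\<^sub>k\<close>, where the factors \<open>j\<close> are iterated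
  derivatives of a component \<open>h\<^sub>\<mu>\<^sub>\<nu>\<close> or of a component of the matter field. They are evaluated on
  classical fields, and (with the Wick product) on quantum fields.\<close>

datatype 'm component = Grav 4 4 | Mat 'm

type_synonym 'm diff_poly = "(complex \<times> (4 list \<times> 'm component) list) list"

definition poly_eval :: "(complex \<Rightarrow> 'r::ring_1) \<Rightarrow> (4 list \<times> 'm component \<Rightarrow> 'r) \<Rightarrow> 'm diff_poly \<Rightarrow> 'r" where
  "poly_eval emb val P = sum_list (map (\<lambda>(z, js). emb z * prod_list (map val js)) P)"

definition classical_eval :: "(spacetime \<Rightarrow> real^4^4) \<Rightarrow> ('m \<Rightarrow> spacetime \<Rightarrow> complex) \<Rightarrow>
    'm diff_poly \<Rightarrow> spacetime \<Rightarrow> complex" where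
  "classical_eval h M P x = poly_eval id (\<lambda>(is, X).
     foldr pd is (case X of Grav \<mu> \<nu> \<Rightarrow> (\<lambda>y. of_real (h y $\<mu>$\<nu>)) | Mat a \<Rightarrow> M a) x) P"

definition wick_eval :: "(4 \<Rightarrow> 4 \<Rightarrow> wick) \<Rightarrow> ('m \<Rightarrow> wick) \<Rightarrow> 'm diff_poly \<Rightarrow> wick" where
  "wick_eval h M P = poly_eval wconst (\<lambda>(is, X).
     foldr wpd is (case X of Grav \<mu> \<nu> \<Rightarrow> h \<mu> \<nu> | Mat a \<Rightarrow> M a)) P"

text \<open>\<open>L = L\<^sub>0 + \<kappa> L\<^sub>1 + \<kappa>\<^sup>2/2 L\<^sub>2 + O(\<kappa>\<^sup>3)\<close>\<close>

definition second_order_expansion :: "(real \<Rightarrow> complex) \<Rightarrow> complex \<Rightarrow> complex \<Rightarrow> bool" where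
  "second_order_expansion L L\<^sub>0 L\<^sub>2 \<longleftrightarrow> (\<exists>L\<^sub>1.
     (\<lambda>\<kappa>::real. L \<kappa> - (L\<^sub>0 + of_real \<kappa> * L\<^sub>1 + of_real (\<kappa>\<^sup>2 / 2) * L\<^sub>2)) \<in> O[at 0](\<lambda>\<kappa>. of_real (\<kappa> ^ 3)))"

text \<open>The following predicates say that the differential polynomial \<open>P\<close> is the second-order term of
  the classical Lagrangian, for arbitrary (off-shell) classical fields. This determines \<open>P\<close> up to the
  order of commuting factors and up to relations (like the symmetry of \<open>h\<close>) that hold for the quantum fields as well.\<close>

definition deviation :: "(spacetime \<Rightarrow> real^4^4) \<Rightarrow> bool" where
  "deviation h \<longleftrightarrow> smooth h \<and> (\<forall>x. transpose (h x) = h x)"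

definition scalar_second_order :: "real \<Rightarrow> unit diff_poly \<Rightarrow> bool" where
  "scalar_second_order m P \<longleftrightarrow> (\<forall>h \<phi> x. deviation h \<and> smooth \<phi> \<longrightarrow>
     second_order_expansion (\<lambda>\<kappa>. of_real (Lcl_scalar m (metric \<kappa> h) \<phi> x))
       (of_real (Lcl0_scalar m \<phi> x)) (classical_eval h (\<lambda>_ y. of_real (\<phi> y)) P x))"

definition maxwell_second_order :: "(4 \<times> 4) diff_poly \<Rightarrow> bool" where
  "maxwell_second_order P \<longleftrightarrow>
     (\<forall>h F x. deviation h \<and> smooth F \<and> (\<forall>y. transpose (F y) = - F y) \<longrightarrow>
       second_order_expansion (\<lambda>\<kappa>. of_real (Lcl_maxwell (metric \<kappa> h) F x))
         (of_real (Lcl0_maxwell F x)) (classical_eval h (\<lambda>(\<mu>, \<nu>) y. of_real (F y $\<mu>$\<nu>)) P x))"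

datatype dirac_component = Psi 4 | PsiBar 4

text \<open>The classical spinor components commute, but the quantum ones do not: hence the factor \<open>\<psi>\<close>-bar is
  required to stand left of \<open>\<psi>\<close>, as in the Lagrangian.\<close>

definition dirac_ordered :: "dirac_component diff_poly \<Rightarrow> bool" where
  "dirac_ordered P \<longleftrightarrow> (\<forall>(z, js) \<in> set P. \<exists>a b. [X. (is, Mat X) \<leftarrow> js] = [PsiBar a, Psi b])"

definition dirac_second_order :: "(4 \<Rightarrow> complex^4^4) \<Rightarrow> real \<Rightarrow> dirac_component diff_poly \<Rightarrow> bool" where
  "dirac_second_order \<gamma> m P \<longleftrightarrow> dirac_ordered P \<and> (\<forall>h \<psi> x. deviation h \<and> smooth \<psi> \<longrightarrow>
     second_order_expansion (\<lambda>\<kappa>. Lcl_dirac \<gamma> m (metric \<kappa> h) \<psi> x) (Lcl0_dirac \<gamma> m \<psi> x)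
       (classical_eval h (\<lambda>X y. case X of Psi a \<Rightarrow> \<psi> y $ a | PsiBar a \<Rightarrow> bar \<gamma> (\<psi> y) $ a) P x))"

end

theory Submission
  imports Defs
begin

text \<open>The two interactions agree exactly, so the divergence can be taken to be zero. On the classical
  side put \<open>H = \<eta>h\<close>, \<open>t = tr H\<close>, \<open>q = tr H\<^sup>2\<close>. Then \<open>-g = det(1 + \<kappa>H)\<close>, the inverse metric is
  \<open>(-g)\<^bsup>-1/2\<^esup> (1 + \<kappa>H) \<eta>\<close> and the tetrad is \<open>(-g)\<^bsup>-1/4\<^esup> K\<close> with \<open>K\<^sup>2 = 1 + \<kappa>H\<close>. The expansions of \<open>\<surd>-g\<close>,
  \<open>K\<close> and \<open>\<partial>K\<close> follow by solving their defining quadratic equations order by order.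
  In the Dirac Lagrangian, \<open>{\<gamma>\<^sup>\<rho>, [\<gamma>\<^sup>\<alpha>, \<gamma>\<^sup>\<beta>]}\<close> is totally antisymmetric. Hence the Christoffel symbols
  and the derivative of \<open>(-g)\<^bsup>-1/4\<^esup>\<close> drop out of the spin connection, and only \<open>\<eta> K\<^bsup>-1\<^esup> \<partial>K\<close> is left, whose
  antisymmetric part starts with that of \<open>-(\<kappa>\<^sup>2/4) h \<eta> \<partial>h\<close>.
  On the quantum side \<open>t = 0\<close>, since polarization vectors are null and transversal, and
  \<open>tr(\<Theta>\<^sub>\<psi>) = m \<psi>\<close>-bar \<open>\<psi>\<close> by the Dirac equation. The off-shell classical second-order term differs from
  \<open>L\<^sub>2\<close> by multiples of \<open>t\<close> and of \<open>tr(\<Theta>\<^sub>\<psi>) - m \<psi>\<close>-bar \<open>\<psi>\<close> only.\<close>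

text \<open>\<open>metric\<close> and \<open>tetrad\<close> are definite descriptions, so no formula
  for them is available before uniqueness is shown, and then only for small \<open>\<kappa>\<close>.
  At fixed \<open>\<kappa>\<close> the smallness persists near a point, which permits derivatives in
  \<open>x\<close>. Differentiability of the matrix root in \<open>x\<close> comes from one use of
  the inverse function theorem. In \<open>\<kappa>\<close> no derivative is taken: remainder bounds
  are read off algebraic equations. This matters because the root does not commute with its
  derivative, which is given only implicitly. The 1/4 in the spin term is 3/8 - 1/8:
  \<open>h \<eta> \<partial>h\<close> and its transpose \<open>\<partial>h \<eta> h\<close> enter
  with -3/8 and -1/8, and only the antisymmetric part counts. The witness polynomials must be exact
  off shell and keep the order of the spinors; they are built by operations mirroring the Wick
  expressions, so that both evaluations are computed from one term. On the quantum side
  \<open>pd\<close> is meaningful only for differentiable kernels, so identities with derivatives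
  are proved in explicit plane-wave form.\<close>

definition sg :: "4 \<Rightarrow> real" where
  "sg \<mu> = (if \<mu> = 0 then 1 else -1)"

lemma eta_nth: "eta$\<mu>$\<nu> = (if \<mu> = \<nu> then sg \<mu> else 0)"
  by (simp add: eta_def sg_def)

lemma sg_mult_self [simp]: "sg \<mu> * sg \<mu> = 1" "sg \<mu> * (sg \<mu> * x) = x"
  by (simp_all add: sg_def)

lemma of_real_sg_mult_self [simp]:
  "complex_of_real (sg \<mu>) * complex_of_real (sg \<mu>) = 1"
  "complex_of_real (sg \<mu>) * (complex_of_real (sg \<mu>) * z) = z"
  by (simp_all add: sg_def)

lemma sg_4 [simp]: "sg 1 = -1" "sg 2 = -1" "sg 3 = -1" "sg 4 = 1"
  by (simp_all add: sg_def)

lemma mink_eq: "mink p x = (\<Sum>\<mu>\<in>UNIV. sg \<mu> * p$\<mu> * x$\<mu>)"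
  by (simp add: mink_def eta_nth if_distrib[of "\<lambda>z. z * _"] cong: if_cong)

lemma lower_nth: "lower w $ \<mu> = of_real (sg \<mu>) * w $ \<mu>"
  by (simp add: lower_def eta_nth if_distrib[of "\<lambda>z. of_real z * _"] cong: if_cong)

section \<open>Constants among the Wick fields\<close>

lemma kernel_simps [simp]:
  "kernel 0 x ls = 0"
  "kernel (W + V) x ls = kernel W x ls + kernel V x ls"
  "kernel (W - V) x ls = kernel W x ls - kernel V x ls"
  "kernel (- W) x ls = - kernel W x ls"
  by (simp_all add: zero_wick_def plus_wick_def minus_wick_def uminus_wick_def)

lemma kernel_sum [simp]: "kernel (sum f A) x ls = (\<Sum>i\<in>A. kernel (f i) x ls)"
  by (induction A rule: infinite_finite_induct) simp_all

lemma wconst_kernel: "kernel (wconst z) x = (\<lambda>k. z * (if k = [] then 1 else 0))"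
  by (rule ext) (simp add: wconst_def)

lemma kernel_wconst_mult [simp]: "kernel (wconst z * W) x ls = z * kernel W x ls"
  by (simp add: times_wick_def wconst_kernel kernel_mult_scale_left kernel_mult_one_left)

text \<open>A constant has its kernel at the empty list only, so no operator is moved past another
  and no fermionic sign arises. Constants are thus central although Wick fields do not
  commute.\<close>

lemma wconst_mult_commute: "W * wconst z = wconst z * W"
  by (rule wick_eqI)
    (simp only: kernel_wconst_mult, simp add: times_wick_def wconst_kernel kernel_mult_scale_right kernel_mult_one_right)

lemma wconst_0 [simp]: "wconst 0 = 0"
  and wconst_1 [simp]: "wconst 1 = 1"
  and wconst_add: "wconst (z + w) = wconst z + wconst w"
  and wconst_minus: "wconst (- z) = - wconst z"
  and wconst_mult: "wconst (z * w) = wconst z * wconst w"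
  by (rule wick_eqI, simp add: wconst_def one_wick_def; fail)+
    (rule wick_eqI, simp only: kernel_wconst_mult, simp add: wconst_def)

lemma sum_weta: "(\<Sum>\<nu>\<in>UNIV. weta \<mu> \<nu> * f \<nu>) = wconst (of_real (sg \<mu>)) * f \<mu>"
proof -
  have "weta \<mu> \<nu> * f \<nu> = (if \<nu> = \<mu> then wconst (of_real (sg \<mu>)) * f \<mu> else 0)" for \<nu>
    by (auto simp: eta_nth)
  then show ?thesis by simp
qed

section \<open>Superpositions of plane waves\<close>

text \<open>A momentum attached to ladder operators, rather than to particles, treats creation and
  annihilation parts at once. For fixed \<open>q\<close> these fields are closed under sums,
  constants, derivatives and string integration, so linear field identities reduce to identities
  between coefficients \<open>a l\<close>.\<close>

definition mode_field :: "(ladder \<Rightarrow> real^4) \<Rightarrow> (ladder \<Rightarrow> complex) \<Rightarrow> wick" where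
  "mode_field q a = Wick (\<lambda>x ls. case ls of [l] \<Rightarrow> a l * cis (mink (q l) x) | _ \<Rightarrow> 0)"

lemma kernel_mode_field:
  "kernel (mode_field q a) x ls = (case ls of [l] \<Rightarrow> a l * cis (mink (q l) x) | _ \<Rightarrow> 0)"
  by (simp add: mode_field_def)

lemma wconst_mult_mode_field: "wconst z * mode_field q a = mode_field q (\<lambda>l. z * a l)"
  by (rule wick_eqI) (simp only: kernel_wconst_mult, simp add: kernel_mode_field split: list.split)

lemma mode_field_add: "mode_field q a + mode_field q b = mode_field q (\<lambda>l. a l + b l)"
  by (rule wick_eqI) (simp add: kernel_mode_field algebra_simps split: list.split)

lemma mode_field_minus: "- mode_field q a = mode_field q (\<lambda>l. - a l)"
  by (rule wick_eqI) (simp add: kernel_mode_field split: list.split)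

lemma mode_field_zero: "mode_field q (\<lambda>l. 0) = 0"
  by (rule wick_eqI) (simp add: kernel_mode_field split: list.split)

lemma mode_field_sum: "(\<Sum>i\<in>I. mode_field q (a i)) = mode_field q (\<lambda>l. \<Sum>i\<in>I. a i l)"
  by (induction I rule: infinite_finite_induct) (simp_all add: mode_field_zero mode_field_add)

lemma has_derivative_cis_mink:
  "((\<lambda>x. a * cis (mink q x)) has_derivative (\<lambda>v. a * (mink q v *\<^sub>R (\<i> * cis (mink q x))))) (at x)"
proof -
  have "((\<lambda>x. mink q x) has_derivative (\<lambda>v. mink q v)) (at x)"
    by (rule bounded_linear_imp_has_derivative)
      (auto simp: mink_eq intro!: bounded_linear_sum bounded_linear_const_mult bounded_linear_vec_nth)
  then have "((\<lambda>x. cis (mink q x)) has_derivative (\<lambda>v. mink q v *\<^sub>R (\<i> * cis (mink q x)))) (at x)"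
    unfolding cis_conv_exp scaleR_conv_of_real
    using has_derivative_compose[OF has_derivative_mult_right[OF has_derivative_of_real, of _ _ _ \<i>]
        DERIV_exp[unfolded has_field_derivative_def]]
    by (simp add: mult_ac)
  then show ?thesis
    by (rule has_derivative_mult_right)
qed

lemma pd_eqI: "(f has_derivative f') (at x) \<Longrightarrow> pd \<mu> f x = f' (axis \<mu> 1)"
  unfolding pd_def by (metis frechet_derivative_at)

lemma mink_axis: "mink q (axis \<mu> 1) = sg \<mu> * q$\<mu>"
  by (simp add: mink_eq axis_def if_distrib[of "\<lambda>z. _ * z"] cong: if_cong)

lemma wpd_mode_field:
  "wpd \<mu> (mode_field q a) = mode_field q (\<lambda>l. \<i> * of_real (sg \<mu> * q l $ \<mu>) * a l)"
proof (rule wick_eqI)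
  fix x and ls :: "ladder list"
  consider l where "ls = [l]" | "\<And>l. ls \<noteq> [l]" by blast
  then show "kernel (wpd \<mu> (mode_field q a)) x ls
      = kernel (mode_field q (\<lambda>l. \<i> * of_real (sg \<mu> * q l $ \<mu>) * a l)) x ls"
  proof cases
    case 1
    then show ?thesis
      by (simp add: wpd_def kernel_mode_field pd_eqI[OF has_derivative_cis_mink] mink_axis
          scaleR_conv_of_real mult_ac)
  next
    case 2
    then have "kernel (mode_field q b) y ls = 0" for b y
      by (simp add: kernel_mode_field split: list.split)
    then show ?thesis
      by (simp add: wpd_def pd_def)
  qed
qed

text \<open>The frequency sign is put into the momentum, so that \<open>dagger\<close> reverses it.
  All particle labels share the mass \<open>m\<close>; a given field has nonzero coefficients at its
  own particles only.\<close>

definition mom :: "real \<Rightarrow> ladder \<Rightarrow> real^4" where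
  "mom m l = (let k = \<lambda>b. onshell m (case b of Graviton p s \<Rightarrow> p | Scalar p \<Rightarrow> p | Photon p s \<Rightarrow> p
       | Electron p s \<Rightarrow> p | Positron p s \<Rightarrow> p)
     in case l of Ann b \<Rightarrow> - k b | Cre b \<Rightarrow> k b)"

lemma mink_minus: "mink (- q) x = - mink q x"
  by (simp add: mink_eq sum_negf)

lemma mom_dagger: "mom m (dagger l) = - mom m l"
  by (cases l) (simp_all add: mom_def)

text \<open>Complex conjugation and \<open>dagger\<close> each reverse the momentum. The plane waves
  therefore stay the same and only the coefficients change.\<close>

lemma adjoint_mode_field:
  "adjoint (mode_field (mom m) a) = mode_field (mom m) (\<lambda>l. cnj (a (dagger l)))"
proof (rule wick_eqI)
  fix x and ls :: "ladder list"
  consider "ls = []" | l where "ls = [l]" | l l' ks where "ls = l # l' # ks"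
    by (metis neq_Nil_conv)
  then show "kernel (adjoint (mode_field (mom m) a)) x ls
      = kernel (mode_field (mom m) (\<lambda>l. cnj (a (dagger l)))) x ls"
  proof cases
    case 3
    have "length (map dagger (rev ls)) \<noteq> 1" by (simp add: 3)
    then have "kernel (mode_field (mom m) a) x (map dagger (rev ls)) = 0"
      by (auto simp: kernel_mode_field split: list.split)
    then show ?thesis by (simp add: adjoint_def 3 kernel_mode_field)
  qed (simp_all add: adjoint_def kernel_mode_field mom_dagger mink_minus cis_cnj)
qed

lemma annihilation_field_eq:
  assumes "\<And>x b. w x b = a b * cis (mink (mom m (Ann b)) x)"
  shows "annihilation_field w = mode_field (mom m) (\<lambda>l. case l of Ann b \<Rightarrow> a b | Cre b \<Rightarrow> 0)"
  by (rule wick_eqI)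
    (auto simp: annihilation_field_def kernel_mode_field assms split: list.split ladder.split)

lemma hermitian_field_eq:
  assumes "\<And>x b. w x b = a b * cis (mink (mom m (Ann b)) x)"
  shows "hermitian_field w = mode_field (mom m) (\<lambda>l. case l of Ann b \<Rightarrow> a b | Cre b \<Rightarrow> cnj (a b))"
  unfolding hermitian_field_def annihilation_field_eq[of w a, OF assms] adjoint_mode_field mode_field_add
  by (rule arg_cong[of _ _ "mode_field _"]) (auto simp: fun_eq_iff split: ladder.split)

section \<open>The graviton field\<close>

definition string_factor :: "(spacetime \<Rightarrow> real) \<Rightarrow> 4 \<Rightarrow> real^4 \<Rightarrow> complex" where
  "string_factor c \<mu> q = (LINT s:{0..}|lborel. LINT e|lborel. of_real (c e * e$\<mu>) * cis (s * mink q e))"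

lemma mink_add_scale: "mink q (x + s *\<^sub>R e) = mink q x + s * mink q e"
  by (simp add: mink_eq sum.distrib sum_distrib_left algebra_simps)

text \<open>Translating a plane wave multiplies it by a phase, so integration along strings acts on
  every mode by a factor that depends on its momentum alone. Constants leave a Bochner integral even
  where it takes its default value 0.\<close>

lemma string_integral_mode_field:
  "string_integral c \<mu> (mode_field q a) = mode_field q (\<lambda>l. string_factor c \<mu> (q l) * a l)"
proof (rule wick_eqI)
  fix x and ls :: "ladder list"
  consider l where "ls = [l]" | "\<And>l. ls \<noteq> [l]" by blast
  then show "kernel (string_integral c \<mu> (mode_field q a)) x ls
      = kernel (mode_field q (\<lambda>l. string_factor c \<mu> (q l) * a l)) x ls"
  proof cases
    case 1
    have "(LINT s:{0..}|lborel. LINT e|lborel. of_real (c e * e$\<mu>) * (a l * cis (mink (q l) (x + s *\<^sub>R e))))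
      = (LINT s:{0..}|lborel. (a l * cis (mink (q l) x)) *
            (LINT e|lborel. of_real (c e * e$\<mu>) * cis (s * mink (q l) e)))"
      unfolding mink_add_scale cis_mult[symmetric] Bochner_Integration.integral_mult_right_zero[symmetric]
      by (simp add: mult_ac)
    also have "\<dots> = (a l * cis (mink (q l) x)) * string_factor c \<mu> (q l)"
      unfolding string_factor_def by (rule set_integral_mult_right)
    finally show ?thesis
      by (simp add: 1 string_integral_def kernel_mode_field mult_ac)
  next
    case 2
    then have "kernel (mode_field q b) y ls = 0" for b y
      by (simp add: kernel_mode_field split: list.split)
    then show ?thesis
      by (simp add: string_integral_def set_lebesgue_integral_def)
  qed
qed

definition curv_coeff ::
    "(real^3 \<Rightarrow> bool \<Rightarrow> complex^3) \<Rightarrow> 4 \<Rightarrow> 4 \<Rightarrow> 4 \<Rightarrow> 4 \<Rightarrow> particle \<Rightarrow> complex" where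
  "curv_coeff eps \<mu> \<kappa> \<nu> \<tau> b = (case b of
     Graviton p s \<Rightarrow> - (wedge eps p s \<mu> \<kappa> * wedge eps p s \<nu> \<tau>) | _ \<Rightarrow> 0)"

definition graviton_coeff ::
    "(spacetime \<Rightarrow> real) \<Rightarrow> (real^3 \<Rightarrow> bool \<Rightarrow> complex^3) \<Rightarrow> 4 \<Rightarrow> 4 \<Rightarrow> ladder \<Rightarrow> complex" where
  "graviton_coeff c eps \<mu> \<nu> l = (\<Sum>\<kappa>\<in>UNIV. \<Sum>\<tau>\<in>UNIV.
     string_factor c \<kappa> (mom 0 l) * (string_factor c \<tau> (mom 0 l) *
       (case l of Ann b \<Rightarrow> curv_coeff eps \<mu> \<kappa> \<nu> \<tau> b | Cre b \<Rightarrow> cnj (curv_coeff eps \<mu> \<kappa> \<nu> \<tau> b))))"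

lemma graviton_field_eq:
  "graviton_field c eps \<mu> \<nu> = mode_field (mom 0) (graviton_coeff c eps \<mu> \<nu>)"
proof -
  have i: "(- \<i>) * z * ((- \<i>) * w) = - (z * w)" for z w :: complex
    using i_squared by algebra
  have "curvature eps \<mu> \<kappa> \<nu> \<tau> = mode_field (mom 0)
     (\<lambda>l. case l of Ann b \<Rightarrow> curv_coeff eps \<mu> \<kappa> \<nu> \<tau> b | Cre b \<Rightarrow> cnj (curv_coeff eps \<mu> \<kappa> \<nu> \<tau> b))" for \<kappa> \<tau>
    unfolding curvature_def i
    by (rule hermitian_field_eq)
      (auto simp: plane_wave_def curv_coeff_def mom_def mink_minus split: particle.split)
  then show ?thesis
    by (simp add: graviton_field_def string_integral_mode_field mode_field_sum graviton_coeff_def[abs_def])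
qed

text \<open>Both \<open>p\<close> and \<open>w\<close> are orthogonal to the cross product of
  \<open>p\<close> and \<open>w\<close> in the bilinear (not sesquilinear) product, and by the
  helicity equation this cross product is a nonzero multiple of \<open>w\<close>.\<close>

lemma helicity_transversal:
  assumes "helicity_vectors eps" "p \<noteq> 0"
  shows "(\<Sum>i\<in>UNIV. of_real (p$i) * eps p s $ i) = 0" "(\<Sum>i\<in>UNIV. eps p s $ i * eps p s $ i) = 0"
proof -
  define w where "w = eps p s"
  define N where "N = complex_of_real ((if s then 1 else -1) * norm p)"
  have "N \<noteq> 0" using assms(2) by (simp add: N_def)
  have "\<i> *s (vector [p$2 * w$3 - p$3 * w$2, p$3 * w$1 - p$1 * w$3, p$1 * w$2 - p$2 * w$1] :: complex^3)
      = N *s w"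
    using assms unfolding helicity_vectors_def w_def N_def Let_def by blast
  then have *: "\<i> * (p$2 * w$3 - p$3 * w$2) = N * w$1" "\<i> * (p$3 * w$1 - p$1 * w$3) = N * w$2"
      "\<i> * (p$1 * w$2 - p$2 * w$1) = N * w$3"
    by (simp_all add: vec_eq_iff forall_3 vector_3)
  have "N * (\<Sum>i\<in>UNIV. of_real (p$i) * w $ i) = p$1 * (N * w$1) + p$2 * (N * w$2) + p$3 * (N * w$3)"
    by (simp add: sum_3 algebra_simps)
  also have "\<dots> = 0"
    unfolding *[symmetric] by (simp add: algebra_simps)
  finally show "(\<Sum>i\<in>UNIV. of_real (p$i) * eps p s $ i) = 0"
    using \<open>N \<noteq> 0\<close> by (simp add: w_def)
  have "N * (\<Sum>i\<in>UNIV. w$i * w $ i) = w$1 * (N * w$1) + w$2 * (N * w$2) + w$3 * (N * w$3)"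
    by (simp add: sum_3 algebra_simps)
  also have "\<dots> = 0"
    unfolding *[symmetric] by (simp add: algebra_simps)
  finally show "(\<Sum>i\<in>UNIV. eps p s $ i * eps p s $ i) = 0"
    using \<open>N \<noteq> 0\<close> by (simp add: w_def)
qed

text \<open>Expanding the product leaves the three Minkowski squares and products of
  \<open>q\<close> and \<open>w\<close>. They vanish because the momentum is null and the
  polarization is transversal and null.\<close>

lemma wedge_trace:
  assumes "helicity_vectors eps"
  shows "(\<Sum>\<mu>\<in>UNIV. of_real (sg \<mu>) * (wedge eps p s \<mu> \<kappa> * wedge eps p s \<mu> \<tau>)) = 0"
proof (cases "p = 0")
  case True
  \<comment> \<open>\<open>helicity_vectors\<close> leaves the polarization at \<open>p = 0\<close>
    open; there the massless four-momentum itself vanishes, and with it the wedge.\<close>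
  have "onshell 0 (0::real^3) = 0"
    by (simp add: onshell_def fourvec_def vec_eq_iff)
  with True show ?thesis
    by (simp add: wedge_def lower_nth Let_def)
next
  case False
  define q where "q = lower (\<chi> \<kappa>. of_real (onshell 0 p $ \<kappa>))"
  define w where "w = lower (fourvec 0 (eps p s))"
  note T = helicity_transversal[OF assms False, of s]
  have q: "q$1 = - p$1" "q$2 = - p$2" "q$3 = - p$3" "q$4 = of_real (norm p)"
    unfolding q_def lower_nth onshell_def fourvec_def
    by (simp_all add: norm_eq_sqrt_inner)
  have w: "w$1 = - eps p s$1" "w$2 = - eps p s$2" "w$3 = - eps p s$3" "w$4 = 0"
    unfolding w_def lower_nth fourvec_def by simp_all
  have "norm p * norm p = p$1 * p$1 + p$2 * p$2 + p$3 * p$3"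
    using dot_square_norm[of p] by (simp add: inner_vec_def sum_3 power2_eq_square)
  from arg_cong[OF this, of complex_of_real]
  have qq: "(\<Sum>\<mu>\<in>UNIV. of_real (sg \<mu>) * (q$\<mu> * q$\<mu>)) = 0"
    unfolding sum_4 q by simp
  have qw: "(\<Sum>\<mu>\<in>UNIV. of_real (sg \<mu>) * (q$\<mu> * w$\<mu>)) = 0"
    using T(1) unfolding sum_4 q w sum_3 by (simp add: neg_eq_iff_add_eq_0 algebra_simps)
  have "(\<Sum>\<mu>\<in>UNIV. of_real (sg \<mu>) * (w$\<mu> * w$\<mu>)) = - (\<Sum>i\<in>UNIV. eps p s $ i * eps p s $ i)"
    unfolding sum_4 sum_3 w by simp
  then have ww: "(\<Sum>\<mu>\<in>UNIV. of_real (sg \<mu>) * (w$\<mu> * w$\<mu>)) = 0"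
    by (simp only: T(2) minus_zero)
  have "(\<Sum>\<mu>\<in>UNIV. of_real (sg \<mu>) * (wedge eps p s \<mu> \<kappa> * wedge eps p s \<mu> \<tau>))
    = w$\<kappa> * w$\<tau> * (\<Sum>\<mu>\<in>UNIV. of_real (sg \<mu>) * (q$\<mu> * q$\<mu>))
      - w$\<kappa> * q$\<tau> * (\<Sum>\<mu>\<in>UNIV. of_real (sg \<mu>) * (q$\<mu> * w$\<mu>))
      - q$\<kappa> * w$\<tau> * (\<Sum>\<mu>\<in>UNIV. of_real (sg \<mu>) * (q$\<mu> * w$\<mu>))
      + q$\<kappa> * q$\<tau> * (\<Sum>\<mu>\<in>UNIV. of_real (sg \<mu>) * (w$\<mu> * w$\<mu>))"
    unfolding wedge_def Let_def q_def[symmetric] w_def[symmetric]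
    by (simp only: sum_distrib_left sum_subtractf[symmetric] sum.distrib[symmetric])
      (simp add: algebra_simps)
  then show ?thesis
    by (simp add: qq qw ww)
qed

text \<open>The string factors carry the indices \<open>\<kappa>\<close>, \<open>\<tau>\<close>,
  while the trace runs over the other index of each wedge. It thus passes through the string
  integrals to the curvature coefficients; the creation part is the complex conjugate.\<close>

lemma graviton_traceless:
  assumes "helicity_vectors eps"
  shows "(\<Sum>\<mu>\<in>UNIV. wconst (of_real (sg \<mu>)) * graviton_field c eps \<mu> \<mu>) = 0"
proof -
  have *: "(\<Sum>\<mu>\<in>UNIV. of_real (sg \<mu>) * curv_coeff eps \<mu> \<kappa> \<mu> \<tau> b) = 0" for \<kappa> \<tau> b
    using wedge_trace[OF assms] by (cases b) (simp_all add: curv_coeff_def sum_negf)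
  from arg_cong[OF this, of cnj]
  have **: "(\<Sum>\<mu>\<in>UNIV. of_real (sg \<mu>) * cnj (curv_coeff eps \<mu> \<kappa> \<mu> \<tau> b)) = 0" for \<kappa> \<tau> b
    by simp
  have "(\<Sum>\<mu>\<in>UNIV. of_real (sg \<mu>) * graviton_coeff c eps \<mu> \<mu> l) =
     (\<Sum>\<kappa>\<in>UNIV. \<Sum>\<tau>\<in>UNIV. string_factor c \<kappa> (mom 0 l) * string_factor c \<tau> (mom 0 l) *
       (\<Sum>\<mu>\<in>UNIV. of_real (sg \<mu>) *
         (case l of Ann b \<Rightarrow> curv_coeff eps \<mu> \<kappa> \<mu> \<tau> b | Cre b \<Rightarrow> cnj (curv_coeff eps \<mu> \<kappa> \<mu> \<tau> b))))" for l
    unfolding graviton_coeff_def sum_distrib_left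
    by (subst sum.swap, rule sum.cong[OF refl], subst sum.swap) (simp add: mult_ac)
  then have "(\<Sum>\<mu>\<in>UNIV. of_real (sg \<mu>) * graviton_coeff c eps \<mu> \<mu> l) = 0" for l
    by (cases l) (simp_all add: * **)
  then show ?thesis
    by (simp add: graviton_field_eq wconst_mult_mode_field mode_field_sum mode_field_zero)
qed

text \<open>Pulling a constant out of \<open>wpd\<close> is not formal, since \<open>pd\<close> is
  unspecified where a kernel is not differentiable. The explicit modes of the graviton field settle
  it.\<close>

lemma wpd_wconst_mult_graviton:
  "wpd \<mu> (wconst z * graviton_field c eps \<nu> \<rho>) = wconst z * wpd \<mu> (graviton_field c eps \<nu> \<rho>)"
  by (simp add: graviton_field_eq wconst_mult_mode_field wpd_mode_field mult_ac)

section \<open>The Dirac equation\<close>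

definition dirac_coeff ::
    "(real^3 \<Rightarrow> bool \<Rightarrow> complex^4) \<Rightarrow> (real^3 \<Rightarrow> bool \<Rightarrow> complex^4) \<Rightarrow> ladder \<Rightarrow> complex^4" where
  "dirac_coeff u v l = (case l of Ann (Electron p s) \<Rightarrow> u p s | Cre (Positron p s) \<Rightarrow> v p s | _ \<Rightarrow> 0)"

lemma dirac_field_eq: "dirac_field m u v a = mode_field (mom m) (\<lambda>l. dirac_coeff u v l $ a)"
proof -
  have 1: "annihilation_field (\<lambda>x b. case b of Electron p s \<Rightarrow> u p s $ a * plane_wave m p x | _ \<Rightarrow> 0)
    = mode_field (mom m) (\<lambda>l. case l of Ann b \<Rightarrow> (case b of Electron p s \<Rightarrow> u p s $ a | _ \<Rightarrow> 0) | Cre b \<Rightarrow> 0)"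
    by (rule annihilation_field_eq)
      (auto simp: plane_wave_def mom_def mink_minus split: particle.split)
  have 2: "annihilation_field (\<lambda>x b. case b of Positron p s \<Rightarrow> cnj (v p s $ a) * plane_wave m p x | _ \<Rightarrow> 0)
    = mode_field (mom m) (\<lambda>l. case l of Ann b \<Rightarrow> (case b of Positron p s \<Rightarrow> cnj (v p s $ a) | _ \<Rightarrow> 0) | Cre b \<Rightarrow> 0)"
    by (rule annihilation_field_eq)
      (auto simp: plane_wave_def mom_def mink_minus split: particle.split)
  show ?thesis
    unfolding dirac_field_def 1 2 adjoint_mode_field mode_field_add
    by (rule arg_cong[of _ _ "mode_field _"])
      (auto simp: fun_eq_iff dirac_coeff_def split: ladder.split particle.split)
qed

lemma dirac_conjugate_eq:
  "dirac_conjugate \<gamma> (dirac_field m u v) a =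
     mode_field (mom m) (\<lambda>l. \<Sum>b\<in>UNIV. \<gamma> 0 $ b $ a * cnj (dirac_coeff u v (dagger l) $ b))"
  by (simp add: dirac_conjugate_def dirac_field_eq adjoint_mode_field wconst_mult_mode_field mode_field_sum)

lemma slash_eq: "slash \<gamma> p = (\<Sum>\<mu>\<in>UNIV. (sg \<mu> * p$\<mu>) *\<^sub>R \<gamma> \<mu>)"
proof -
  have "(\<Sum>\<nu>\<in>UNIV. (eta$\<mu>$\<nu> * p$\<mu>) *\<^sub>R \<gamma> \<nu>) = (sg \<mu> * p$\<mu>) *\<^sub>R \<gamma> \<mu>" for \<mu>
    by (simp add: eta_nth if_distrib[of "\<lambda>z. (z * _) *\<^sub>R _"] cong: if_cong)
  then show ?thesis by (simp add: slash_def)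
qed

lemma slash_minus: "slash \<gamma> (- p) = - slash \<gamma> p"
  by (simp add: slash_eq sum_negf)

lemma slash_nth: "slash \<gamma> p $ a $ b = (\<Sum>\<mu>\<in>UNIV. of_real (sg \<mu> * p$\<mu>) * \<gamma> \<mu> $ a $ b)"
  unfolding slash_eq sum_component vector_scaleR_component by (simp add: scaleR_conv_of_real)

text \<open>For electrons the minus sign comes from the reversed momentum of an annihilator, for
  positrons from the negative eigenvalue of \<open>v\<close>. Both parts of the field thus obey one
  equation.\<close>

lemma dirac_coeff_eq:
  assumes "dirac_spinors \<gamma> m u v"
  shows "slash \<gamma> (mom m l) *v dirac_coeff u v l = - (of_real m *s dirac_coeff u v l)"
proof -
  from assms have "slash \<gamma> (onshell m p) *v u p s = of_real m *s u p s"
     "slash \<gamma> (onshell m p) *v v p s = - (of_real m *s v p s)" for p s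
    by (auto simp: dirac_spinors_def)
  moreover have "(- A) *v x = - (A *v x)" for A :: "complex^4^4" and x
    by (simp add: vec_eq_iff matrix_vector_mult_def sum_negf)
  ultimately show ?thesis
    by (auto simp: dirac_coeff_def mom_def slash_minus split: ladder.split particle.split)
qed

text \<open>One factor \<open>\<i>\<close> stands in the equation, the other comes from
  differentiating the plane wave; their product -1 turns the eigenvalue \<open>- m\<close> into
  \<open>m\<close>.\<close>

lemma dirac_equation:
  assumes "dirac_spinors \<gamma> m u v"
  shows "(\<Sum>\<mu>\<in>UNIV. \<Sum>b\<in>UNIV. wconst (\<i> * \<gamma> \<mu> $ a $ b) * wpd \<mu> (dirac_field m u v b))
    = wconst (of_real m) * dirac_field m u v a"
proof -
  have "(\<Sum>\<mu>\<in>UNIV. \<Sum>b\<in>UNIV. \<i> * \<gamma> \<mu> $ a $ b * (\<i> * of_real (sg \<mu> * mom m l $ \<mu>) * dirac_coeff u v l $ b))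
    = - (slash \<gamma> (mom m l) *v dirac_coeff u v l) $ a" for l
  proof -
    have *: "\<i> * \<gamma> \<mu> $ a $ b * (\<i> * of_real (sg \<mu> * mom m l $ \<mu>) * dirac_coeff u v l $ b)
      = - (of_real (sg \<mu> * mom m l $ \<mu>) * \<gamma> \<mu> $ a $ b * dirac_coeff u v l $ b)" for \<mu> b
      by (simp add: algebra_simps)
    show ?thesis
      unfolding * sum_negf
      by (subst sum.swap) (simp add: matrix_vector_mult_def slash_nth sum_distrib_right)
  qed
  then show ?thesis
    by (simp add: dirac_field_eq wpd_mode_field wconst_mult_mode_field mode_field_sum dirac_coeff_eq[OF assms]
        vector_scalar_mult_def)
qed

lemma matrix_nth_eq: "A = B \<Longrightarrow> A$a$b = B$a$b"
  by simp

lemma gamma0_square: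
  assumes "dirac_matrices \<gamma>"
  shows "\<gamma> 0 ** \<gamma> 0 = mat 1"
proof -
  have "\<gamma> 0 ** \<gamma> 0 + \<gamma> 0 ** \<gamma> 0 = mat (2 * of_real (eta$0$0))"
    using assms unfolding dirac_matrices_def by blast
  then have "(\<gamma> 0 ** \<gamma> 0) $ a $ b = (mat 1 :: complex^4^4) $ a $ b" for a b
    by (drule_tac matrix_nth_eq[of _ _ a b]) (auto simp: eta_nth mat_def sg_def split: if_splits)
  then show ?thesis by (simp add: vec_eq_iff)
qed

text \<open>The hermiticity condition times \<open>\<gamma> 0\<close> from the right, simplified by
  \<open>gamma0_square\<close>. It moves a hermitian adjoint past \<open>\<gamma> 0\<close>, as
  needed to conjugate the Dirac equation.\<close>

lemma gamma0_gamma: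
  assumes "dirac_matrices \<gamma>"
  shows "(\<Sum>b\<in>UNIV. cnj (\<gamma> \<mu> $ b $ a) * \<gamma> 0 $ b $ d) = (\<gamma> 0 ** \<gamma> \<mu>) $ a $ d"
proof -
  have "(\<chi> a b. cnj (\<gamma> \<mu> $ b $ a)) ** \<gamma> 0 = \<gamma> 0 ** \<gamma> \<mu> ** (\<gamma> 0 ** \<gamma> 0)"
    using assms unfolding dirac_matrices_def by (metis matrix_mul_assoc)
  then have "(\<chi> a b. cnj (\<gamma> \<mu> $ b $ a)) ** \<gamma> 0 = \<gamma> 0 ** \<gamma> \<mu>"
    by (simp add: gamma0_square[OF assms])
  from matrix_nth_eq[OF this, of a d] show ?thesis
    by (simp add: matrix_matrix_mult_def)
qed

text \<open>The coefficients of the conjugate field are taken at \<open>dagger l\<close>, whose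
  momentum is reversed. This explains the sign opposite to that in
  \<open>dirac_equation\<close>.\<close>

lemma dirac_equation_conjugate:
  assumes "dirac_spinors \<gamma> m u v" and "dirac_matrices \<gamma>"
  shows "(\<Sum>\<mu>\<in>UNIV. \<Sum>a\<in>UNIV. wconst (\<i> * \<gamma> \<mu> $ a $ d) * wpd \<mu> (dirac_conjugate \<gamma> (dirac_field m u v) a))
    = - (wconst (of_real m) * dirac_conjugate \<gamma> (dirac_field m u v) d)"
proof -
  have "(\<Sum>\<mu>\<in>UNIV. \<Sum>a\<in>UNIV. \<i> * \<gamma> \<mu> $ a $ d * (\<i> * of_real (sg \<mu> * mom m l $ \<mu>) *
          (\<Sum>b\<in>UNIV. \<gamma> 0 $ b $ a * cnj (dirac_coeff u v (dagger l) $ b))))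
    = - (of_real m * (\<Sum>b\<in>UNIV. \<gamma> 0 $ b $ d * cnj (dirac_coeff u v (dagger l) $ b)))" for l
  proof -
    define w where "w = dirac_coeff u v (dagger l)"
    define k where "k = (\<lambda>\<mu>. sg \<mu> * mom m l $ \<mu>)"
    have s: "cnj ((slash \<gamma> (mom m l) *v w) $ b) = of_real m * cnj (w $ b)" for b
    proof -
      have "slash \<gamma> (mom m (dagger l)) *v w = - (of_real m *s w)"
        unfolding w_def by (rule dirac_coeff_eq[OF assms(1)])
      moreover have "(- A) *v x = - (A *v x)" for A :: "complex^4^4" and x
        by (simp add: vec_eq_iff matrix_vector_mult_def sum_negf)
      ultimately show ?thesis
        by (simp add: mom_dagger slash_minus)
    qed
    have "(\<Sum>\<mu>\<in>UNIV. \<Sum>a\<in>UNIV. \<i> * \<gamma> \<mu> $ a $ d * (\<i> * of_real (k \<mu>) * (\<Sum>b\<in>UNIV. \<gamma> 0 $ b $ a * cnj (w $ b))))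
      = (\<Sum>\<mu>\<in>UNIV. \<Sum>b\<in>UNIV. - (of_real (k \<mu>) * cnj (w $ b) * (\<gamma> 0 ** \<gamma> \<mu>) $ b $ d))"
      by (rule sum.cong[OF refl], simp add: matrix_matrix_mult_def sum_distrib_left sum_negf, subst sum.swap)
        (simp add: sum_negf mult_ac)
    also have "\<dots> = (\<Sum>\<mu>\<in>UNIV. \<Sum>b\<in>UNIV. \<Sum>a\<in>UNIV. - (of_real (k \<mu>) * cnj (w $ b) * (cnj (\<gamma> \<mu> $ a $ b) * \<gamma> 0 $ a $ d)))"
      by (simp add: gamma0_gamma[OF assms(2), symmetric] sum_distrib_left sum_negf)
    also have "\<dots> = (\<Sum>a\<in>UNIV. \<Sum>\<mu>\<in>UNIV. \<Sum>b\<in>UNIV. - (of_real (k \<mu>) * cnj (w $ b) * (cnj (\<gamma> \<mu> $ a $ b) * \<gamma> 0 $ a $ d)))"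
      by (subst sum.swap[of _ "UNIV::4 set" "UNIV::4 set"], subst (2) sum.swap, rule refl)
    also have "\<dots> = (\<Sum>a\<in>UNIV. - \<gamma> 0 $ a $ d * cnj ((slash \<gamma> (mom m l) *v w) $ a))"
      by (rule sum.cong[OF refl], subst sum.swap)
        (simp add: matrix_vector_mult_def slash_nth sum_distrib_left sum_distrib_right sum_negf k_def mult_ac)
    finally show ?thesis
      unfolding s by (simp add: w_def k_def sum_distrib_left sum_negf mult_ac)
  qed
  then show ?thesis
    by (simp add: dirac_conjugate_eq wpd_mode_field wconst_mult_mode_field mode_field_sum mode_field_minus)
qed

section \<open>Expansion to second order\<close>

text \<open>Big O of \<open>k ^ n\<close> at 0 with values in any normed space, so that matrices are
  covered. The filter sees only small nonzero \<open>k\<close>, where the metric and the tetrad are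
  under control.\<close>

definition vanish :: "nat \<Rightarrow> (real \<Rightarrow> 'a::real_normed_vector) \<Rightarrow> bool" where
  "vanish n F \<longleftrightarrow> (\<exists>C. \<forall>\<^sub>F k in at 0. norm (F k) \<le> C * \<bar>k\<bar> ^ n)"

lemma vanishE:
  assumes "vanish n F"
  obtains C where "0 \<le> C" "\<forall>\<^sub>F k in at 0. norm (F k) \<le> C * \<bar>k\<bar> ^ n"
proof -
  obtain C where "\<forall>\<^sub>F k in at 0. norm (F k) \<le> C * \<bar>k\<bar> ^ n"
    using assms unfolding vanish_def by blast
  then have "\<forall>\<^sub>F k in at 0. norm (F k) \<le> max C 0 * \<bar>k\<bar> ^ n"
    by (rule eventually_mono) (erule order_trans, rule mult_right_mono, auto)
  then show ?thesis by (rule that[rotated]) simp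
qed

lemma vanish_cong: "\<forall>\<^sub>F k in at 0. F k = G k \<Longrightarrow> vanish n F \<Longrightarrow> vanish n G"
  unfolding vanish_def by (elim exE, rule exI, erule (1) eventually_elim2) simp

lemma vanish_add:
  assumes "vanish n F" "vanish n G"
  shows "vanish n (\<lambda>k. F k + G k)"
proof -
  obtain C D where "\<forall>\<^sub>F k in at 0. norm (F k) \<le> C * \<bar>k\<bar> ^ n" "\<forall>\<^sub>F k in at 0. norm (G k) \<le> D * \<bar>k\<bar> ^ n"
    using assms unfolding vanish_def by blast
  then have "\<forall>\<^sub>F k in at 0. norm (F k + G k) \<le> (C + D) * \<bar>k\<bar> ^ n"
  proof eventually_elim
    case (elim k)
    then show ?case
      using norm_triangle_ineq[of "F k" "G k"] by (simp add: distrib_right)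
  qed
  then show ?thesis unfolding vanish_def by blast
qed

lemma vanish_prod:
  assumes "bounded_bilinear p" "vanish m F" "vanish n G"
  shows "vanish (m + n) (\<lambda>k. p (F k) (G k))"
proof -
  obtain K where K: "0 < K" "\<And>a b. norm (p a b) \<le> norm a * norm b * K"
    using bounded_bilinear.pos_bounded[OF assms(1)] by blast
  obtain C where C: "0 \<le> C" "\<forall>\<^sub>F k in at 0. norm (F k) \<le> C * \<bar>k\<bar> ^ m"
    using assms(2) by (rule vanishE)
  obtain D where D: "0 \<le> D" "\<forall>\<^sub>F k in at 0. norm (G k) \<le> D * \<bar>k\<bar> ^ n"
    using assms(3) by (rule vanishE)
  from C(2) D(2) have "\<forall>\<^sub>F k in at 0. norm (p (F k) (G k)) \<le> (C * D * K) * \<bar>k\<bar> ^ (m + n)"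
  proof eventually_elim
    case (elim k)
    have "norm (p (F k) (G k)) \<le> norm (F k) * norm (G k) * K" by (rule K)
    also have "\<dots> \<le> (C * \<bar>k\<bar> ^ m) * (D * \<bar>k\<bar> ^ n) * K"
      using elim C D K by (intro mult_mono) auto
    finally show ?case by (simp add: power_add mult_ac)
  qed
  then show ?thesis unfolding vanish_def by blast
qed

lemma vanish_mono:
  assumes "vanish n F" "m \<le> n"
  shows "vanish m F"
proof -
  obtain C where C: "0 \<le> C" "\<forall>\<^sub>F k in at 0. norm (F k) \<le> C * \<bar>k\<bar> ^ n"
    using assms(1) by (rule vanishE)
  have "\<forall>\<^sub>F k in at 0. \<bar>k::real\<bar> \<le> 1"
    unfolding eventually_at by (rule exI[of _ 1]) (simp add: dist_real_def)
  with C(2) have "\<forall>\<^sub>F k in at 0. norm (F k) \<le> C * \<bar>k\<bar> ^ m"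
  proof eventually_elim
    case (elim k)
    have "C * \<bar>k\<bar> ^ n \<le> C * \<bar>k\<bar> ^ m"
      using elim(2) C(1) assms(2) by (intro mult_left_mono power_decreasing) auto
    with elim(1) show ?case by simp
  qed
  then show ?thesis unfolding vanish_def by blast
qed

lemma vanish_power: "vanish n (\<lambda>k. k ^ n *\<^sub>R a)"
  unfolding vanish_def by (intro exI[of _ "norm a"]) (simp add: power_abs mult_ac)

lemma vanish_1: "vanish 1 (\<lambda>k. k *\<^sub>R a)"
  using vanish_power[of 1 a] by simp

lemma vanish_const: "vanish 0 (\<lambda>k. a)"
  using vanish_power[of 0 a] by simp

lemma vanish_linear:
  assumes "bounded_linear f" "vanish n F"
  shows "vanish n (\<lambda>k. f (F k))"
proof -
  obtain K where K: "0 < K" "\<And>x. norm (f x) \<le> norm x * K"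
    using bounded_linear.pos_bounded[OF assms(1)] by blast
  obtain C where "\<forall>\<^sub>F k in at 0. norm (F k) \<le> C * \<bar>k\<bar> ^ n"
    using assms(2) unfolding vanish_def by blast
  then have "\<forall>\<^sub>F k in at 0. norm (f (F k)) \<le> (C * K) * \<bar>k\<bar> ^ n"
  proof eventually_elim
    case (elim k)
    then have "norm (F k) * K \<le> C * \<bar>k\<bar> ^ n * K"
      using K by simp
    with K(2)[of "F k"] show ?case by (simp add: mult_ac)
  qed
  then show ?thesis unfolding vanish_def by blast
qed

lemma vanish_minus: "vanish n F \<Longrightarrow> vanish n (\<lambda>k. - F k)"
  by (simp add: vanish_def)

lemma vanish_diff: "vanish n F \<Longrightarrow> vanish n G \<Longrightarrow> vanish n (\<lambda>k. F k - G k)"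
  using vanish_add[of n F "\<lambda>k. - G k"] vanish_minus by auto

text \<open>Here \<open>c\<close> is the full coefficient of \<open>k\<^sup>2\<close>, hence half of
  the second-order term in \<open>second_order_expansion\<close>. No derivatives of \<open>F\<close>
  are asserted to exist.\<close>

definition jet :: "(real \<Rightarrow> 'a::real_normed_vector) \<Rightarrow> 'a \<Rightarrow> 'a \<Rightarrow> 'a \<Rightarrow> bool" where
  "jet F a b c \<longleftrightarrow> vanish 3 (\<lambda>k. F k - (a + k *\<^sub>R b + k\<^sup>2 *\<^sub>R c))"

lemma jet_cong: "\<forall>\<^sub>F k in at 0. F k = G k \<Longrightarrow> jet F a b c \<Longrightarrow> jet G a b c"
  unfolding jet_def by (erule vanish_cong[rotated]) (auto elim: eventually_mono)

lemma jet_const: "jet (\<lambda>k. a) a 0 0"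
  by (auto simp: jet_def vanish_def intro!: exI[of _ 0])

lemma jet_monom: "jet (\<lambda>k. k *\<^sub>R a) 0 a 0"
  by (auto simp: jet_def vanish_def intro!: exI[of _ 0])

lemma jet_add: "jet F a b c \<Longrightarrow> jet G a' b' c' \<Longrightarrow> jet (\<lambda>k. F k + G k) (a + a') (b + b') (c + c')"
  unfolding jet_def by (drule (1) vanish_add) (simp add: algebra_simps)

lemma jet_linear:
  assumes "bounded_linear f" "jet F a b c"
  shows "jet (\<lambda>k. f (F k)) (f a) (f b) (f c)"
proof -
  interpret f: bounded_linear f by fact
  show ?thesis
    using vanish_linear[OF assms(1) assms(2)[unfolded jet_def]]
    by (simp add: jet_def f.diff f.add f.scaleR)
qed

lemma jet_minus: "jet F a b c \<Longrightarrow> jet (\<lambda>k. - F k) (- a) (- b) (- c)"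
  by (rule jet_linear[OF bounded_linear_minus[OF bounded_linear_ident]])

lemma jet_diff: "jet F a b c \<Longrightarrow> jet G a' b' c' \<Longrightarrow> jet (\<lambda>k. F k - G k) (a - a') (b - b') (c - c')"
  using jet_add[OF _ jet_minus, of F a b c G a' b' c'] by simp

lemma jet_sum:
  "(\<And>i. i \<in> I \<Longrightarrow> jet (F i) (a i) (b i) (c i)) \<Longrightarrow>
    jet (\<lambda>k. \<Sum>i\<in>I. F i k) (\<Sum>i\<in>I. a i) (\<Sum>i\<in>I. b i) (\<Sum>i\<in>I. c i)"
  by (induction I rule: infinite_finite_induct) (simp_all add: jet_const jet_add)

lemma jet_bounded: "jet F a b c \<Longrightarrow> vanish 0 F"
  unfolding jet_def
  by (drule vanish_add[OF vanish_mono[of _ _ 0]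
      vanish_add[OF vanish_add[OF vanish_const[of a] vanish_mono[OF vanish_1[of b], of 0]]
        vanish_mono[OF vanish_power[of 2 c], of 0]]]) simp_all

lemma jet_prod:
  assumes p: "bounded_bilinear p" and F: "jet F a b c" and G: "jet G a' b' c'"
  shows "jet (\<lambda>k. p (F k) (G k)) (p a a') (p a b' + p b a') (p a c' + p b b' + p c a')"
proof -
  interpret p: bounded_bilinear p by (rule p)
  let ?P = "\<lambda>k::real. a + k *\<^sub>R b + k\<^sup>2 *\<^sub>R c" and ?Q = "\<lambda>k::real. a' + k *\<^sub>R b' + k\<^sup>2 *\<^sub>R c'"
  have P: "vanish 0 ?P"
    by (intro vanish_add vanish_const vanish_mono[OF vanish_1] vanish_mono[OF vanish_power]) auto
  \<comment> \<open>The error splits into \<open>(F - P) G + P (G - Q)\<close> and the cubic and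
    quartic terms of the product of the two quadratic polynomials.\<close>
  have "vanish 3 (\<lambda>k. p (F k - ?P k) (G k))"
    using vanish_prod[OF p F[unfolded jet_def] jet_bounded[OF G]] by simp
  moreover have "vanish 3 (\<lambda>k. p (?P k) (G k - ?Q k))"
    using vanish_prod[OF p P G[unfolded jet_def]] by simp
  moreover have "vanish 3 (\<lambda>k. k^3 *\<^sub>R (p b c' + p c b'))"
    by (rule vanish_power)
  moreover have "vanish 3 (\<lambda>k. k^4 *\<^sub>R p c c')"
    by (rule vanish_mono[OF vanish_power]) simp
  ultimately have "vanish 3 (\<lambda>k. p (F k - ?P k) (G k) + p (?P k) (G k - ?Q k)
      + k^3 *\<^sub>R (p b c' + p c b') + k^4 *\<^sub>R p c c')"
    by (intro vanish_add)
  then show ?thesis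
    unfolding jet_def
    by (rule vanish_cong[rotated])
      (simp add: p.add_left p.add_right p.diff_left p.diff_right p.scaleR_left p.scaleR_right
        algebra_simps power2_eq_square power3_eq_cube power4_eq_xxxx)
qed

lemma jet_scaleR: "jet F a b c \<Longrightarrow> jet G a' b' c' \<Longrightarrow>
    jet (\<lambda>k. F k *\<^sub>R G k) (a *\<^sub>R a') (a *\<^sub>R b' + b *\<^sub>R a') (a *\<^sub>R c' + b *\<^sub>R b' + c *\<^sub>R a')"
  by (rule jet_prod[OF bounded_bilinear_scaleR])

lemma jet_mult:
  fixes F G :: "real \<Rightarrow> 'a::real_normed_algebra"
  shows "jet F a b c \<Longrightarrow> jet G a' b' c' \<Longrightarrow>
    jet (\<lambda>k. F k * G k) (a * a') (a * b' + b * a') (a * c' + b * b' + c * a')"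
  by (rule jet_prod[OF bounded_bilinear_mult])

lemma jet_second_order_expansion:
  assumes "jet L a b (c /\<^sub>R 2)"
  shows "second_order_expansion L a c"
proof -
  obtain C where "\<forall>\<^sub>F k in at 0. norm (L k - (a + k *\<^sub>R b + k\<^sup>2 *\<^sub>R (c /\<^sub>R 2))) \<le> C * \<bar>k\<bar> ^ 3"
    using assms unfolding jet_def vanish_def by blast
  then have "(\<lambda>k. L k - (a + of_real k * b + of_real (k\<^sup>2 / 2) * c)) \<in> O[at 0](\<lambda>k. of_real (k ^ 3))"
    by (intro bigoI[of _ C])
      (auto elim!: eventually_mono simp: scaleR_conv_of_real norm_power power_abs norm_mult mult_ac)
  then show ?thesis
    unfolding second_order_expansion_def by blast
qed

section \<open>Jets of functions known only through an equation\<close>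

lemma vanish_1_dominated:
  assumes "vanish 1 X" "\<forall>\<^sub>F k in at 0. norm (A k) \<le> norm (X k)"
  shows "vanish 1 A"
proof -
  obtain C where "\<forall>\<^sub>F k in at 0. norm (X k) \<le> C * \<bar>k\<bar> ^ 1"
    using assms(1) unfolding vanish_def by blast
  with assms(2) have "\<forall>\<^sub>F k in at 0. norm (A k) \<le> C * \<bar>k\<bar> ^ 1"
    by eventually_elim simp
  then show ?thesis unfolding vanish_def by blast
qed

lemma jet_vanish_1: "jet X 0 x y \<Longrightarrow> vanish 1 X"
  unfolding jet_def
  by (drule vanish_add[OF vanish_mono[of _ _ 1]
      vanish_add[OF vanish_1[of x] vanish_mono[OF vanish_power[of 2 y], of 1]]]) simp_all

lemma jet_vanish_2: "jet X 0 x y \<Longrightarrow> vanish 2 (\<lambda>k. X k - k *\<^sub>R x)"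
  unfolding jet_def
  by (drule vanish_add[OF vanish_mono[of _ _ 2] vanish_power[of 2 y]]) (simp_all add: algebra_simps)

text \<open>When both factors vanish at 0, their product is known to second order once the factors
  are known to first order. This gain of one order drives the bootstrapping in the next two
  lemmas.\<close>

lemma jet_prod_0:
  assumes "bounded_bilinear p" "vanish 1 A" "vanish 2 (\<lambda>k. A k - k *\<^sub>R a)"
    "vanish 1 B" "vanish 2 (\<lambda>k. B k - k *\<^sub>R b)"
  shows "jet (\<lambda>k. p (A k) (B k)) 0 0 (p a b)"
proof -
  interpret p: bounded_bilinear p by fact
  have "vanish 3 (\<lambda>k. p (A k - k *\<^sub>R a) (B k) + p (k *\<^sub>R a) (B k - k *\<^sub>R b))"
    using vanish_prod[OF assms(1,3,4)] vanish_prod[OF assms(1) vanish_1 assms(5)]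
    by (intro vanish_add) (simp_all add: numeral_3_eq_3)
  then show ?thesis
    unfolding jet_def
    by (rule vanish_cong[rotated])
      (simp add: p.diff_left p.diff_right p.scaleR_left p.scaleR_right power2_eq_square)
qed

text \<open>The equation \<open>2 A + A A = X\<close> says that \<open>1 + A\<close> is a square root of \<open>1 + X\<close>. Its right-hand side
  determines \<open>A\<close> to one more order each time the equation is used.\<close>

lemma jet_square_root:
  assumes p: "bounded_bilinear p" and le: "\<And>a b. norm (p a b) \<le> norm a * norm b"
    and X: "jet X 0 x y"
    and eq: "\<forall>\<^sub>F k in at 0. 2 *\<^sub>R A k + p (A k) (A k) = X k" and "\<forall>\<^sub>F k in at 0. norm (A k) < 1"
  shows "jet A 0 (x /\<^sub>R 2) (y /\<^sub>R 2 - p x x /\<^sub>R 8)"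
proof -
  interpret p: bounded_bilinear p by (rule p)
  \<comment> \<open>The bound by 1 lets the quadratic term be absorbed on the left. It excludes the
    other roots, such as the one near -2 in the case of numbers.\<close>
  have "\<forall>\<^sub>F k in at 0. norm (A k) \<le> norm (X k)"
    using eq assms(5)
  proof eventually_elim
    case (elim k)
    have "2 * norm (A k) = norm (X k - p (A k) (A k))"
      by (simp add: elim(1)[symmetric])
    also have "\<dots> \<le> norm (X k) + norm (A k) * norm (A k)"
      using norm_triangle_ineq4[of "X k" "p (A k) (A k)"] le[of "A k" "A k"] by linarith
    also have "norm (A k) * norm (A k) \<le> 1 * norm (A k)"
      using elim by (intro mult_right_mono) auto
    finally show ?case by simp
  qed
  then have A1: "vanish 1 A"
    using X by (intro vanish_1_dominated[OF jet_vanish_1])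
  have *: "\<forall>\<^sub>F k in at 0. A k = (X k - p (A k) (A k)) /\<^sub>R 2"
    using eq proof eventually_elim
    case (elim k)
    then have "X k - p (A k) (A k) = 2 *\<^sub>R A k"
      by (simp flip: elim)
    then show ?case by simp
  qed
  have "vanish 2 (\<lambda>k. (X k - k *\<^sub>R x - p (A k) (A k)) /\<^sub>R 2)"
    using vanish_prod[OF p A1 A1]
    by (intro vanish_linear[OF bounded_linear_scaleR_right] vanish_diff jet_vanish_2[OF X])
      (simp add: numeral_2_eq_2)
  then have A2: "vanish 2 (\<lambda>k. A k - k *\<^sub>R (x /\<^sub>R 2))"
    by (rule vanish_cong[rotated]) (use * in \<open>eventually_elim, simp add: algebra_simps\<close>)
  have "jet (\<lambda>k. (X k - p (A k) (A k)) /\<^sub>R 2) ((0 - 0) /\<^sub>R 2) ((x - 0) /\<^sub>R 2) ((y - p (x /\<^sub>R 2) (x /\<^sub>R 2)) /\<^sub>R 2)"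
    by (intro jet_linear[OF bounded_linear_scaleR_right] jet_diff X jet_prod_0[OF p A1 A2 A1 A2])
  then have "jet A ((0 - 0) /\<^sub>R 2) ((x - 0) /\<^sub>R 2) ((y - p (x /\<^sub>R 2) (x /\<^sub>R 2)) /\<^sub>R 2)"
    by (rule jet_cong[rotated]) (use * in \<open>eventually_elim, simp\<close>)
  then show ?thesis
    by (simp add: p.scaleR_left p.scaleR_right algebra_simps)
qed

text \<open>Both the derivative of the square root, \<open>2 J = k d - A J - J A\<close>, and the quotient
  \<open>Y = J - A Y\<close> are solved for in the same way.\<close>

lemma jet_fixed_point:
  assumes p: "bounded_bilinear p" and q: "bounded_bilinear q"
    and le: "\<And>a b. norm (p a b) + norm (q b a) \<le> norm a * norm b"
    and X: "jet X 0 x y" and A: "jet A 0 a a'"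
    and eq: "\<forall>\<^sub>F k in at 0. J k = X k - p (A k) (J k) - q (J k) (A k)"
  shows "jet J 0 x (y - p a x - q x a)"
proof -
  have A1: "vanish 1 A" and A2: "vanish 2 (\<lambda>k. A k - k *\<^sub>R a)"
    using A by (rule jet_vanish_1 jet_vanish_2)+
  obtain C where C: "0 \<le> C" "\<forall>\<^sub>F k in at 0. norm (A k) \<le> C * \<bar>k\<bar>"
    using vanishE[OF A1] by auto
  \<comment> \<open>Smallness of \<open>A\<close> makes the terms containing \<open>J\<close> at
    most half of \<open>J\<close>, so that they are absorbed on the left and \<open>J\<close>
    inherits the order of \<open>X\<close>.\<close>
  have "\<forall>\<^sub>F k in at 0. C * \<bar>k::real\<bar> < 1/2"
    by (rule order_tendstoD(2)[where y = 0]) (auto intro!: tendsto_eq_intros)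
  with C(2) eq have "\<forall>\<^sub>F k in at 0. norm (J k) \<le> norm (2 *\<^sub>R X k)"
  proof eventually_elim
    case (elim k)
    have "norm (J k) = norm (X k - p (A k) (J k) - q (J k) (A k))"
      by (rule arg_cong[OF elim(2)])
    also have "\<dots> \<le> norm (X k) + norm (p (A k) (J k)) + norm (q (J k) (A k))"
      using norm_triangle_ineq4[of "X k - p (A k) (J k)" "q (J k) (A k)"]
        norm_triangle_ineq4[of "X k" "p (A k) (J k)"] by linarith
    also have "\<dots> \<le> norm (X k) + norm (A k) * norm (J k)"
      using le[of "A k" "J k"] by simp
    also have "norm (A k) * norm (J k) \<le> 1/2 * norm (J k)"
      using elim by (intro mult_right_mono) auto
    finally show ?case by simp
  qed
  then have J1: "vanish 1 J"
    by (rule vanish_1_dominated[OF vanish_linear[OF bounded_linear_scaleR_right jet_vanish_1[OF X]]])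
  have "vanish 2 (\<lambda>k. X k - k *\<^sub>R x - p (A k) (J k) - q (J k) (A k))"
    using vanish_prod[OF p A1 J1] vanish_prod[OF q J1 A1]
    by (intro vanish_diff jet_vanish_2[OF X]) (simp_all add: numeral_2_eq_2)
  then have J2: "vanish 2 (\<lambda>k. J k - k *\<^sub>R x)"
    by (rule vanish_cong[rotated]) (use eq in \<open>eventually_elim, simp add: algebra_simps\<close>)
  have "jet (\<lambda>k. X k - p (A k) (J k) - q (J k) (A k)) (0 - 0 - 0) (x - 0 - 0) (y - p a x - q x a)"
    by (intro jet_diff X jet_prod_0[OF p A1 A2 J1 J2] jet_prod_0[OF q J1 J2 A1 A2])
  then have "jet J (0 - 0 - 0) (x - 0 - 0) (y - p a x - q x a)"
    by (rule jet_cong[rotated]) (use eq in \<open>eventually_elim, simp\<close>)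
  then show ?thesis by simp
qed

section \<open>Matrices\<close>

lemma norm_matrix_sq: "(norm (A :: real^'n^'m))\<^sup>2 = (\<Sum>i\<in>UNIV. \<Sum>j\<in>UNIV. (A$i$j)\<^sup>2)"
  by (simp add: norm_vec_def L2_set_def sum_nonneg)

text \<open>The norm of nested vectors is the Frobenius norm, and Cauchy-Schwarz is applied to every
  entry of the product. The constant 1 is what \<open>jet_square_root\<close> and the unit ball in
  \<open>tetrad\<close> rely on.\<close>

lemma norm_matrix_mult_le:
  fixes A :: "real^'n^'m" and B :: "real^'p^'n"
  shows "norm (A ** B) \<le> norm A * norm B"
proof (rule power2_le_imp_le)
  have "(norm (A ** B))\<^sup>2 = (\<Sum>i\<in>UNIV. \<Sum>j\<in>UNIV. (\<Sum>k\<in>UNIV. A$i$k * B$k$j)\<^sup>2)"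
    by (simp add: norm_matrix_sq matrix_matrix_mult_def)
  also have "\<dots> \<le> (\<Sum>i\<in>UNIV. \<Sum>j\<in>UNIV. (\<Sum>k\<in>UNIV. (A$i$k)\<^sup>2) * (\<Sum>k\<in>UNIV. (B$k$j)\<^sup>2))"
    by (intro sum_mono Cauchy_Schwarz_ineq_sum)
  also have "\<dots> = (\<Sum>i\<in>UNIV. \<Sum>k\<in>UNIV. (A$i$k)\<^sup>2) * (\<Sum>j\<in>UNIV. \<Sum>k\<in>UNIV. (B$k$j)\<^sup>2)"
    by (simp add: sum_product)
  also have "(\<Sum>j\<in>UNIV. \<Sum>k\<in>UNIV. (B$k$j)\<^sup>2) = (norm B)\<^sup>2"
    unfolding norm_matrix_sq by (rule sum.swap)
  finally show "(norm (A ** B))\<^sup>2 \<le> (norm A * norm B)\<^sup>2"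
    by (simp add: norm_matrix_sq power_mult_distrib)
qed simp

lemma bounded_bilinear_matrix_mult:
  "bounded_bilinear ((**) :: real^'n^'m \<Rightarrow> real^'p^'n \<Rightarrow> real^'p^'m)"
proof
  show "\<exists>K. \<forall>(a :: real^'n^'m) (b :: real^'p^'n). norm (a ** b) \<le> norm a * norm b * K"
    by (intro exI[of _ 1]) (simp add: norm_matrix_mult_le)
qed (simp_all add: vec_eq_iff matrix_matrix_mult_def sum.distrib sum_distrib_left algebra_simps)

interpretation mm: bounded_bilinear "(**) :: real^'n^'m \<Rightarrow> real^'p^'n \<Rightarrow> real^'p^'m"
  by (rule bounded_bilinear_matrix_mult)

text \<open>With \<open>A = 1 + P\<close> and \<open>B = 1 + Q\<close>, equal squares give
  \<open>2 (P - Q) = - (P (P - Q) + (P - Q) Q)\<close>, a splitting that respects the order of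
  factors; for norms below 1 it forces \<open>P = Q\<close>. It makes the tetrad unique and the root
  symmetric.\<close>

lemma matrix_root_unique:
  fixes A B :: "real^'n^'n"
  assumes eq: "A ** A = B ** B" and "norm (A - mat 1) < 1" "norm (B - mat 1) < 1"
  shows "A = B"
proof (rule ccontr)
  assume "A \<noteq> B"
  define P Q where "P = A - mat 1" and "Q = B - mat 1"
  have AB: "A = P + mat 1" "B = Q + mat 1" by (simp_all add: P_def Q_def)
  have "2 *\<^sub>R (P - Q) = - (P ** (P - Q) + (P - Q) ** Q)"
    using eq unfolding AB
    by (simp add: mm.add_left mm.add_right mm.diff_left mm.diff_right algebra_simps scaleR_2)
  from arg_cong[OF this, of norm] have "2 * norm (P - Q) = norm (P ** (P - Q) + (P - Q) ** Q)"
    by (simp only: norm_scaleR norm_minus_cancel abs_numeral)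
  also have "\<dots> \<le> norm P * norm (P - Q) + norm (P - Q) * norm Q"
    by (rule norm_triangle_mono) (rule norm_matrix_mult_le)+
  also have "\<dots> = (norm P + norm Q) * norm (P - Q)"
    by (simp add: algebra_simps)
  also have "\<dots> < 2 * norm (P - Q)"
    using assms(2,3) \<open>A \<noteq> B\<close> by (intro mult_strict_right_mono) (auto simp: P_def Q_def)
  finally show False by simp
qed

lemma matrix_inv_eqI:
  fixes A B :: "real^'n^'n"
  assumes "A ** B = mat 1"
  shows "matrix_inv A = B"
proof -
  have BA: "B ** A = mat 1"
    using assms matrix_left_right_inverse by blast
  have *: "A ** matrix_inv A = mat 1 \<and> matrix_inv A ** A = mat 1"
    unfolding matrix_inv_def by (rule someI[of _ B]) (simp add: assms BA)
  then have "matrix_inv A = matrix_inv A ** (A ** B)"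
    by (simp add: assms)
  with * show ?thesis
    by (simp add: matrix_mul_assoc)
qed

section \<open>Determinants in dimension four and the volume density\<close>

lemma det_4:
  "det (A::'a::comm_ring_1^4^4) =
     A$1$1 * (A$2$2 * (A$3$3 * A$4$4 - A$3$4 * A$4$3) - A$2$3 * (A$3$2 * A$4$4 - A$3$4 * A$4$2)
        + A$2$4 * (A$3$2 * A$4$3 - A$3$3 * A$4$2))
   - A$1$2 * (A$2$1 * (A$3$3 * A$4$4 - A$3$4 * A$4$3) - A$2$3 * (A$3$1 * A$4$4 - A$3$4 * A$4$1)
        + A$2$4 * (A$3$1 * A$4$3 - A$3$3 * A$4$1))
   + A$1$3 * (A$2$1 * (A$3$2 * A$4$4 - A$3$4 * A$4$2) - A$2$2 * (A$3$1 * A$4$4 - A$3$4 * A$4$1)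
        + A$2$4 * (A$3$1 * A$4$2 - A$3$2 * A$4$1))
   - A$1$4 * (A$2$1 * (A$3$2 * A$4$3 - A$3$3 * A$4$2) - A$2$2 * (A$3$1 * A$4$3 - A$3$3 * A$4$1)
        + A$2$3 * (A$3$1 * A$4$2 - A$3$2 * A$4$1))"
proof -
  have f1: "finite {2::4, 3, 4}" "1 \<notin> {2::4, 3, 4}"
    and f2: "finite {3::4, 4}" "2 \<notin> {3::4, 4}"
    and f3: "finite {4::4}" "3 \<notin> {4::4}"
    by auto
  show ?thesis
    unfolding det_def UNIV_4
    unfolding sum_over_permutations_insert[OF f1] sum_over_permutations_insert[OF f2]
      sum_over_permutations_insert[OF f3] permutes_sing
    by (simp add: sign_swap_id permutation_swap_id permutation_compose sign_compose sign_id
        swap_id_eq transpose_def algebra_simps)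
qed

lemma det_scaleR_4: "det (c *\<^sub>R A) = c ^ 4 * det (A :: real^4^4)"
  unfolding det_4 by (simp add: algebra_simps power4_eq_xxxx)

abbreviation trace :: "real^4^4 \<Rightarrow> real" where
  "trace X \<equiv> (\<Sum>\<mu>\<in>UNIV. X$\<mu>$\<mu>)"

text \<open>This is \<open>\<surd>-g\<close> for the metric given by \<open>X = \<kappa>\<eta>h\<close>.\<close>

definition volume :: "real^4^4 \<Rightarrow> real" where
  "volume X = sqrt (det (mat 1 + X))"

lemma mat_nth: "(mat c :: 'a::zero^'n^'n) $ i $ j = (if i = j then c else 0)"
  by (simp add: mat_def)

lemma jet_det:
  fixes X :: "real^4^4"
  shows "jet (\<lambda>k. det (mat 1 + k *\<^sub>R X)) 1 (trace X) (((trace X)\<^sup>2 - trace (X ** X)) / 2)"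
proof -
  \<comment> \<open>The sum of the four principal minors of size three, that is, the coefficient of
    \<open>k^3\<close>. With it the remainder of the expansion is exact.\<close>
  define c3 where "c3 =
     X$1$1 * (X$2$2 * X$3$3 - X$2$3 * X$3$2) - X$1$2 * (X$2$1 * X$3$3 - X$2$3 * X$3$1) + X$1$3 * (X$2$1 * X$3$2 - X$2$2 * X$3$1)
   + X$1$1 * (X$2$2 * X$4$4 - X$2$4 * X$4$2) - X$1$2 * (X$2$1 * X$4$4 - X$2$4 * X$4$1) + X$1$4 * (X$2$1 * X$4$2 - X$2$2 * X$4$1)
   + X$1$1 * (X$3$3 * X$4$4 - X$3$4 * X$4$3) - X$1$3 * (X$3$1 * X$4$4 - X$3$4 * X$4$1) + X$1$4 * (X$3$1 * X$4$3 - X$3$3 * X$4$1)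
   + X$2$2 * (X$3$3 * X$4$4 - X$3$4 * X$4$3) - X$2$3 * (X$3$2 * X$4$4 - X$3$4 * X$4$2) + X$2$4 * (X$3$2 * X$4$3 - X$3$3 * X$4$2)"
  have "vanish 3 (\<lambda>k. k^3 *\<^sub>R c3 + k^4 *\<^sub>R det X)"
    by (intro vanish_add vanish_power vanish_mono[OF vanish_power[of 4]]) simp
  then show ?thesis
    unfolding jet_def
    by (rule vanish_cong[rotated])
      (simp add: det_4 mat_nth c3_def matrix_matrix_mult_def sum_4 field_simps power2_eq_square power3_eq_cube power4_eq_xxxx)
qed

lemma tendsto_det:
  fixes A :: "'b \<Rightarrow> real^4^4"
  assumes "(A \<longlongrightarrow> a) F"
  shows "((\<lambda>x. det (A x)) \<longlongrightarrow> det a) F"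
  unfolding det_4 by (intro tendsto_intros assms)

lemma differentiable_det:
  fixes A :: "'b::real_normed_vector \<Rightarrow> real^4^4"
  assumes "A differentiable (at x)"
  shows "(\<lambda>x. det (A x)) differentiable (at x)"
proof -
  have "(\<lambda>x. A x $ i $ j) differentiable (at x)" for i j
    using assms bounded_linear.has_derivative[OF
        bounded_linear_compose[OF bounded_linear_vec_nth[of j] bounded_linear_vec_nth[of i]]]
    unfolding differentiable_def by blast
  then show ?thesis
    unfolding det_4 by (intro differentiable_add differentiable_diff differentiable_mult)
qed

text \<open>Everything needed near the identity is collected under one radius. The last inequality
  puts the rescaled root, which will be the tetrad, into the ball that \<open>tetrad\<close>
  prescribes.\<close>

lemma matrix_root_exists:
  obtains \<epsilon> R where "\<epsilon> > 0"
    and "\<And>X :: real^4^4. norm X < \<epsilon> \<Longrightarrow> R X ** R X = mat 1 + X \<and> norm (R X - mat 1) < 1 \<and>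
      R differentiable (at X) \<and> 0 < det (mat 1 + X) \<and>
      norm ((1 / sqrt (volume X)) *\<^sub>R R X - mat 1) < 1"
proof -
  define f where "f = (\<lambda>A :: real^4^4. A ** A)"
  define f' where "f' = (\<lambda>A :: real^4^4. mm.prod_right A + mm.prod_left A)"
  have der: "(f has_derivative blinfun_apply (f' A)) (at A)" for A
    unfolding f_def f'_def
    using mm.FDERIV[OF has_derivative_ident has_derivative_ident]
    by (simp add: blinfun.add_left[abs_def])
  have cont: "continuous_on UNIV f'"
    unfolding f'_def
    by (intro continuous_intros bounded_linear.continuous_on[OF mm.bounded_linear_prod_right]
        bounded_linear.continuous_on[OF mm.bounded_linear_prod_left])
  \<comment> \<open>At the identity, left and right multiplication coincide, so squaring has
    derivative twice the identity.\<close>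
  have inv: "((1/2) *\<^sub>R id_blinfun) o\<^sub>L f' (mat 1) = id_blinfun"
    by (rule blinfun_eqI) (simp add: f'_def blinfun.add_left blinfun.scaleR_left flip: scaleR_2)
  obtain U' V g g' where 1: "mat 1 \<in> U'" "open V" "f (mat 1) \<in> V" "homeomorphism U' V f g"
    "\<And>y. y \<in> V \<Longrightarrow> (g has_derivative (g' y)) (at y)"
  proof (rule inverse_function_theorem[OF open_UNIV der cont UNIV_I inv])
    fix U' V g g'
    assume "mat 1 \<in> U'" "open V" "f (mat 1) \<in> V" "homeomorphism U' V f g"
      "\<And>y. y \<in> V \<Longrightarrow> (g has_derivative (g' y)) (at y)"
    then show thesis by (rule that)
  qed
  define R where "R = (\<lambda>X. g (mat 1 + X))"
  have "f (mat 1) = mat 1" by (simp add: f_def)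
  with 1 have V: "mat 1 \<in> V" and g1: "g (mat 1) = mat 1"
    unfolding homeomorphism_def by auto
  have dR: "R differentiable (at X)" if "mat 1 + X \<in> V" for X
  proof -
    have "((\<lambda>X. mat 1 + X) has_derivative (\<lambda>v. v)) (at X)"
      by (auto intro!: derivative_eq_intros)
    from has_derivative_compose[OF this 1(5)[OF that]]
    have "(R has_derivative (\<lambda>v. g' (mat 1 + X) v)) (at X)"
      unfolding R_def .
    then show ?thesis unfolding differentiable_def by blast
  qed
  have R0: "(R \<longlongrightarrow> mat 1) (nhds 0)"
  proof -
    have "isCont R 0" using dR[of 0] V by (simp add: differentiable_imp_continuous_within)
    moreover have "R 0 = mat 1" by (simp add: R_def g1)
    ultimately show ?thesis
      unfolding isCont_def using tendsto_at_iff_tendsto_nhds[of R 0] by simp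
  qed
  have X0: "((\<lambda>X. mat 1 + X) \<longlongrightarrow> (mat 1 :: real^4^4)) (nhds 0)"
    by (auto intro!: tendsto_eq_intros filterlim_ident)
  have det: "((\<lambda>X :: real^4^4. det (mat 1 + X)) \<longlongrightarrow> 1) (nhds 0)"
    using tendsto_det[OF X0] by simp
  have e1: "\<forall>\<^sub>F X in nhds 0. mat 1 + X \<in> V"
    by (rule topological_tendstoD[OF X0 1(2) V])
  have e2: "\<forall>\<^sub>F X in nhds 0. norm (R X - mat 1) < 1"
    by (rule order_tendstoD(2)[where y = 0]) (auto intro!: tendsto_eq_intros R0)
  have e3: "\<forall>\<^sub>F X :: real^4^4 in nhds 0. 0 < det (mat 1 + X)"
    by (rule order_tendstoD(1)[OF det]) simp
  have e4: "\<forall>\<^sub>F X in nhds 0. norm ((1 / sqrt (volume X)) *\<^sub>R R X - mat 1) < 1"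
    by (rule order_tendstoD(2)[where y = 0]) (auto intro!: tendsto_eq_intros R0 det simp: volume_def)
  have "\<forall>\<^sub>F X in nhds 0. R X ** R X = mat 1 + X \<and> norm (R X - mat 1) < 1 \<and>
      R differentiable (at X) \<and> 0 < det (mat 1 + X) \<and>
      norm ((1 / sqrt (volume X)) *\<^sub>R R X - mat 1) < 1"
    using e1 e2 e3 e4
  proof eventually_elim
    case (elim X)
    have "f (R X) = mat 1 + X"
      using 1(4) elim(1) by (simp add: R_def homeomorphism_def)
    with elim dR show ?case by (simp add: f_def)
  qed
  then show ?thesis
    unfolding eventually_nhds_metric by (metis dist_0_norm dist_commute that)
qed

section \<open>The metric and the tetrad\<close>

lemma eta_eta: "eta ** eta = mat 1"
  by (simp add: vec_eq_iff matrix_matrix_mult_def eta_nth mat_nth if_distrib[of "\<lambda>z. z * _"] cong: if_cong)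

lemma transpose_eta: "transpose eta = eta"
  by (simp add: vec_eq_iff transpose_def eta_nth)

lemma det_eta: "det eta = -1"
  unfolding det_4 by (simp add: eta_nth)

lemma eta_mult_nth:
  "(eta ** A) $ i $ j = sg i * A $ i $ j" "(A ** eta) $ i $ j = A $ i $ j * sg j"
  by (simp_all add: matrix_matrix_mult_def eta_nth if_distrib[of "\<lambda>z. z * _"] if_distrib[of "\<lambda>z. _ * z"] cong: if_cong)

lemma norm_eta_conj: "norm (eta ** transpose A ** eta) = norm A"
proof (rule power2_eq_imp_eq)
  have "(sg i)\<^sup>2 = 1" for i
    by (simp add: sg_def)
  then show "(norm (eta ** transpose A ** eta))\<^sup>2 = (norm A)\<^sup>2"
    unfolding norm_matrix_sq by (subst sum.swap) (simp add: eta_mult_nth transpose_def power_mult_distrib)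
qed simp_all

definition mixed :: "real \<Rightarrow> (spacetime \<Rightarrow> real^4^4) \<Rightarrow> spacetime \<Rightarrow> real^4^4" where
  "mixed \<kappa> h x = \<kappa> *\<^sub>R (eta ** h x)"

lemma inverse_density: "eta + \<kappa> *\<^sub>R (eta ** h x ** eta) = (mat 1 + mixed \<kappa> h x) ** eta"
  by (simp add: mixed_def mm.add_left mm.scaleR_left)

text \<open>In dimension four the determinant of
  \<open>sqrt (- det g) *\<^sub>R matrix_inv g\<close> is
  \<open>(det g)\<^sup>2 / det g = det g\<close>. The defining equation thus fixes the determinant
  first and then the metric itself, which gives existence and uniqueness for the
  description.\<close>

lemma metric_eq:
  fixes h \<kappa> x
  defines "X \<equiv> mixed \<kappa> h x"
  assumes pos: "0 < det (mat 1 + X)"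
  shows "metric \<kappa> h x = volume X *\<^sub>R matrix_inv ((mat 1 + X) ** eta)"
    and "det (metric \<kappa> h x) = - det (mat 1 + X)"
    and "matrix_inv (metric \<kappa> h x) = (1 / volume X) *\<^sub>R ((mat 1 + X) ** eta)"
proof -
  define G where "G = (mat 1 + X) ** eta"
  define Gi where "Gi = matrix_inv G"
  have detG: "det G = - det (mat 1 + X)"
    by (simp add: G_def det_mul det_eta)
  with pos have "invertible G" by (simp add: invertible_det_nz)
  then obtain B where B: "G ** B = mat 1" unfolding invertible_def by blast
  then have GGi: "G ** Gi = mat 1" using matrix_inv_eqI Gi_def by blast
  then have GiG: "Gi ** G = mat 1" using matrix_left_right_inverse by blast
  have v: "0 < volume X" "volume X * volume X = det (mat 1 + X)"
    using pos by (simp_all add: volume_def)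
  have v4: "volume X ^ 4 = det (mat 1 + X) * det (mat 1 + X)"
    by (simp flip: v(2) add: power4_eq_xxxx)
  have "det G * det Gi = 1"
    using arg_cong[OF GGi, of det] by (simp add: det_mul)
  then have "- (det (mat 1 + X) * det Gi) = 1" by (simp add: detG)
  then have detg: "det (volume X *\<^sub>R Gi) = - det (mat 1 + X)"
    unfolding det_scaleR_4 v4 by algebra
  have invg: "matrix_inv (volume X *\<^sub>R Gi) = (1 / volume X) *\<^sub>R G"
    using v by (intro matrix_inv_eqI) (simp add: mm.scaleR_left mm.scaleR_right GiG)
  have m: "metric \<kappa> h x = volume X *\<^sub>R Gi"
    unfolding metric_def inverse_density X_def[symmetric] G_def[symmetric]
  proof (rule the_equality)
    show "det (volume X *\<^sub>R Gi) < 0 \<and> sqrt (- det (volume X *\<^sub>R Gi)) *\<^sub>R matrix_inv (volume X *\<^sub>R Gi) = G"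
      unfolding detg invg using pos v by (simp add: volume_def)
  next
    fix g :: "real^4^4"
    assume g: "det g < 0 \<and> sqrt (- det g) *\<^sub>R matrix_inv g = G"
    then have "invertible g" by (simp add: invertible_det_nz)
    then obtain C where C: "g ** C = mat 1" unfolding invertible_def by blast
    then have gC: "matrix_inv g = C" by (rule matrix_inv_eqI)
    have Cg: "C ** g = mat 1" using C matrix_left_right_inverse by blast
    have "sqrt (- det g) ^ 4 = det g * det g"
      using g by (simp add: power4_eq_xxxx flip: mult.assoc)
        (simp add: mult.assoc)
    then have "det G = det g * (det g * det C)"
      using g gC det_scaleR_4[of "sqrt (- det g)" C] by (simp add: mult.assoc)
    also have "det g * det C = 1"
      using arg_cong[OF C, of det] by (simp add: det_mul)
    finally have d: "sqrt (- det g) = volume X"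
      by (simp add: detG volume_def)
    have "volume X *\<^sub>R Gi = volume X *\<^sub>R (Gi ** (C ** g))"
      by (simp add: Cg)
    also have "\<dots> = (Gi ** (volume X *\<^sub>R C)) ** g"
      by (simp add: matrix_mul_assoc mm.scaleR_left mm.scaleR_right)
    also have "volume X *\<^sub>R C = G"
      using g gC d by simp
    finally show "g = volume X *\<^sub>R Gi"
      by (simp add: GiG)
  qed
  show "metric \<kappa> h x = volume X *\<^sub>R matrix_inv ((mat 1 + X) ** eta)"
    "det (metric \<kappa> h x) = - det (mat 1 + X)"
    "matrix_inv (metric \<kappa> h x) = (1 / volume X) *\<^sub>R ((mat 1 + X) ** eta)"
    unfolding m detg invg by (simp_all add: Gi_def G_def)
qed

text \<open>As \<open>h x\<close> is symmetric, \<open>eta ** transpose K ** eta\<close> is another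
  root of the same matrix. Conjugation with \<open>eta\<close> and transposition preserve the
  Frobenius norm, so uniqueness of the root in the ball identifies the two.\<close>

lemma eta_root_symmetric:
  assumes "K ** K = mat 1 + mixed \<kappa> h x" "norm (K - mat 1) < 1" "transpose (h x) = h x"
  shows "eta ** transpose K = K ** eta"
proof -
  have "eta ** transpose (mixed \<kappa> h x) ** eta = mixed \<kappa> h x"
    using assms(3)
    by (simp add: mixed_def transpose_scalar matrix_transpose_mul transpose_eta mm.scaleR_left mm.scaleR_right
        matrix_mul_assoc[symmetric] eta_eta)
  have "(eta ** transpose K ** eta) ** (eta ** transpose K ** eta) = eta ** (transpose K ** (eta ** eta) ** transpose K) ** eta"
    by (simp add: matrix_mul_assoc)
  also have "\<dots> = eta ** transpose (K ** K) ** eta"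
    by (simp add: eta_eta matrix_transpose_mul)
  also have "\<dots> = K ** K"
    unfolding assms(1)
    by (simp add: vec_eq_iff eta_mult_nth transpose_def mat_nth mixed_def)
      (use assms(3) in \<open>auto simp: vec_eq_iff transpose_def\<close>)
  finally have "eta ** transpose K ** eta = K"
  proof (rule matrix_root_unique)
    have "eta ** transpose K ** eta - mat 1 = eta ** transpose (K - mat 1) ** eta"
      by (simp add: vec_eq_iff eta_mult_nth transpose_def mat_nth algebra_simps)
    then show "norm (eta ** transpose K ** eta - mat 1) < 1"
      using assms(2) by (simp add: norm_eta_conj)
  qed (rule assms(2))
  then have "eta ** transpose K ** (eta ** eta) = K ** eta"
    by (metis matrix_mul_assoc)
  then show ?thesis by (simp add: eta_eta)
qed

text \<open>Symmetry allows \<open>eta ** transpose E\<close> to be replaced by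
  \<open>E ** eta\<close>, which turns the quadratic condition on the tetrad into an equation for a
  matrix square root. \<open>matrix_root_unique\<close> then applies.\<close>

lemma tetrad_eq:
  assumes K: "K ** K = mat 1 + mixed \<kappa> h x" "norm (K - mat 1) < 1" and sym: "transpose (h x) = h x"
    and pos: "0 < det (mat 1 + mixed \<kappa> h x)"
    and E: "norm ((1 / sqrt (volume (mixed \<kappa> h x))) *\<^sub>R K - mat 1) < 1"
  shows "tetrad (matrix_inv (metric \<kappa> h x)) = (1 / sqrt (volume (mixed \<kappa> h x))) *\<^sub>R K"
proof -
  define v where "v = volume (mixed \<kappa> h x)"
  have v: "0 < v" using pos by (simp add: v_def volume_def)
  define E0 where "E0 = (1 / sqrt v) *\<^sub>R K"
  have sq: "E0 ** E0 = (1 / v) *\<^sub>R (mat 1 + mixed \<kappa> h x)"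
    using v by (simp add: E0_def mm.scaleR_left mm.scaleR_right K(1))
  have E0: "eta ** transpose E0 = E0 ** eta"
    using eta_root_symmetric[OF K sym] by (simp add: E0_def transpose_scalar mm.scaleR_left mm.scaleR_right)
  have inv: "matrix_inv (metric \<kappa> h x) = E0 ** E0 ** eta"
    unfolding sq using metric_eq(3)[OF pos] by (simp add: v_def mm.scaleR_left)
  have "tetrad (matrix_inv (metric \<kappa> h x)) = E0"
    unfolding tetrad_def inv
  proof (rule the_equality)
    show "E0 ** eta ** transpose E0 = E0 ** E0 ** eta \<and> transpose (E0 ** eta) = E0 ** eta \<and> norm (E0 - mat 1) < 1"
      using E unfolding matrix_transpose_mul transpose_eta matrix_mul_assoc[symmetric] E0
      by (simp add: E0_def v_def)
  next
    fix E assume *: "E ** eta ** transpose E = E0 ** E0 ** eta \<and> transpose (E ** eta) = E ** eta \<and> norm (E - mat 1) < 1"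
    then have "eta ** transpose E = E ** eta"
      by (simp add: matrix_transpose_mul transpose_eta)
    with * have "E ** E ** eta = E0 ** E0 ** eta"
      by (metis matrix_mul_assoc)
    then have "E ** E ** (eta ** eta) = E0 ** E0 ** (eta ** eta)"
      by (metis matrix_mul_assoc)
    then have "E ** E = E0 ** E0" by (simp add: eta_eta)
    then show "E = E0"
      by (rule matrix_root_unique) (use * E in \<open>auto simp: E0_def v_def\<close>)
  qed
  then show ?thesis by (simp add: E0_def v_def)
qed

section \<open>Expansion of the density and of the root\<close>

lemma vanish_tendsto:
  assumes "vanish 1 F"
  shows "(F \<longlongrightarrow> 0) (at 0)"
proof -
  obtain C where "\<forall>\<^sub>F k in at 0. norm (F k) \<le> C * \<bar>k\<bar> ^ 1"
    using assms unfolding vanish_def by blast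
  moreover have "((\<lambda>k::real. C * \<bar>k\<bar> ^ 1) \<longlongrightarrow> 0) (at 0)"
    by (auto intro!: tendsto_eq_intros)
  ultimately show ?thesis
    by (rule Lim_null_comparison)
qed

lemma jet_shift: "jet F a b c \<Longrightarrow> jet (\<lambda>k. F k - a) 0 b c"
  using jet_diff[OF _ jet_const[of a], of F a b c] by simp

lemma jet_tendsto: "jet F a b c \<Longrightarrow> (F \<longlongrightarrow> a) (at 0)"
  using vanish_tendsto[OF jet_vanish_1[OF jet_shift]] by (simp add: LIM_zero_iff)

text \<open>Instance of \<open>jet_square_root\<close> for numbers with
  \<open>A = sqrt F - 1\<close>; continuity at 0 supplies the bound that selects the branch.\<close>

lemma jet_sqrt:
  assumes "jet F 1 a b"
  shows "jet (\<lambda>k. sqrt (F k)) 1 (a / 2) (b / 2 - a\<^sup>2 / 8)"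
proof -
  have "\<forall>\<^sub>F k in at 0. F k > 0"
    using jet_tendsto[OF assms] by (rule order_tendstoD) simp
  then have eq: "\<forall>\<^sub>F k in at 0. 2 *\<^sub>R (sqrt (F k) - 1) + (sqrt (F k) - 1) * (sqrt (F k) - 1) = F k - 1"
    by eventually_elim (simp add: algebra_simps)
  have "((\<lambda>k. norm (sqrt (F k) - 1)) \<longlongrightarrow> 0) (at 0)"
    by (auto intro!: tendsto_eq_intros jet_tendsto[OF assms])
  then have "\<forall>\<^sub>F k in at 0. norm (sqrt (F k) - 1) < 1"
    by (rule order_tendstoD) simp
  from jet_square_root[OF bounded_bilinear_mult norm_mult_ineq jet_shift[OF assms] eq this]
  have "jet (\<lambda>k. sqrt (F k) - 1) 0 (a / 2) (b / 2 - a\<^sup>2 / 8)"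
    by (simp add: power2_eq_square)
  from jet_add[OF this jet_const[of 1]] show ?thesis by simp
qed

text \<open>Adapts \<open>jet_fixed_point\<close> to equations with a product on one side
  only.\<close>

lemma bounded_bilinear_zero: "bounded_bilinear (\<lambda>x y. 0)"
  by standard (auto intro: exI[of _ 0])

text \<open>The function \<open>y = 1 / F - 1\<close> solves
  \<open>y = - (F - 1) - (F - 1) y\<close>, a case of \<open>jet_fixed_point\<close>.\<close>

lemma jet_inverse:
  fixes F :: "real \<Rightarrow> real"
  assumes "jet F 1 a b"
  shows "jet (\<lambda>k. 1 / F k) 1 (- a) (a\<^sup>2 - b)"
proof -
  have "\<forall>\<^sub>F k in at 0. F k > 0"
    using jet_tendsto[OF assms] by (rule order_tendstoD) simp
  then have eq: "\<forall>\<^sub>F k in at 0. 1 / F k - 1 = - (F k - 1) - (F k - 1) * (1 / F k - 1) - 0"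
    by eventually_elim (simp add: field_simps)
  have "jet (\<lambda>k. - (F k - 1)) 0 (- a) (- b)"
    using jet_minus[OF jet_shift[OF assms]] by (simp only: minus_zero)
  from jet_fixed_point[OF bounded_bilinear_mult bounded_bilinear_zero _ this jet_shift[OF assms] eq]
  have "jet (\<lambda>k. 1 / F k - 1) 0 (- a) (a\<^sup>2 - b)"
    by (simp add: abs_mult power2_eq_square)
  from jet_add[OF this jet_const[of 1]] show ?thesis by simp
qed

lemma jet_volume:
  "jet (\<lambda>k. volume (k *\<^sub>R H)) 1 (trace H / 2) ((trace H)\<^sup>2 / 8 - trace (H ** H) / 4)"
  unfolding volume_def
  by (rule back_subst[of "jet _ _ _", OF jet_sqrt[OF jet_det]]) (simp add: field_simps power2_eq_square)

lemma jet_root: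
  fixes K :: "real \<Rightarrow> real^4^4"
  assumes "\<forall>\<^sub>F k in at 0. K k ** K k = mat 1 + k *\<^sub>R H" "\<forall>\<^sub>F k in at 0. norm (K k - mat 1) < 1"
  shows "jet (\<lambda>k. K k - mat 1) 0 (H /\<^sub>R 2) (- ((H ** H) /\<^sub>R 8))"
proof -
  have "\<forall>\<^sub>F k in at 0. 2 *\<^sub>R (K k - mat 1) + (K k - mat 1) ** (K k - mat 1) = k *\<^sub>R H"
    using assms(1) by eventually_elim (simp add: mm.diff_left mm.diff_right scaleR_2)
  from jet_square_root[OF bounded_bilinear_matrix_mult norm_matrix_mult_le jet_monom this assms(2)]
  show ?thesis by simp
qed

lemma eventually_mixed_small:
  assumes "0 < \<epsilon>"
  shows "\<forall>\<^sub>F k in at 0. norm (mixed k h x) < \<epsilon>"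
proof -
  have "((\<lambda>k. norm (mixed k h x)) \<longlongrightarrow> 0) (at 0)"
    unfolding mixed_def by (auto intro!: tendsto_eq_intros)
  then show ?thesis by (rule order_tendstoD) (rule assms)
qed

lemma eventually_det_positive: "\<forall>\<^sub>F k in at 0. 0 < det (mat 1 + mixed k h x)"
  using order_tendstoD(1)[OF jet_tendsto[OF jet_det[of "eta ** h x"]], of 0]
  by (simp add: mixed_def)

lemma jet_of_real: "jet F a b c \<Longrightarrow> jet (\<lambda>k. complex_of_real (F k)) (of_real a) (of_real b) (of_real c)"
  by (rule jet_linear[OF bounded_linear_of_real])

lemma jet_nth: "jet F a b c \<Longrightarrow> jet (\<lambda>k. F k $ i $ j) (a $ i $ j) (b $ i $ j) (c $ i $ j)"
  by (rule jet_linear[OF bounded_linear_compose[OF bounded_linear_vec_nth bounded_linear_vec_nth], unfolded comp_def])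

lemma jet_mult_const_right: "jet F a b c \<Longrightarrow> jet (\<lambda>k. F k * z) (a * z) (b * z) (c * (z :: 'a :: real_normed_algebra))"
  by (rule jet_linear[OF bounded_linear_mult_left])

lemma jet_mult_const_left: "jet F a b c \<Longrightarrow> jet (\<lambda>k. z * F k) (z * a) (z * b) ((z :: 'a :: real_normed_algebra) * c)"
  by (rule jet_linear[OF bounded_linear_mult_right])

lemma sum_if_const: "(\<Sum>i\<in>A. if P then f i else 0) = (if P then sum f A else 0)"
  by simp

text \<open>In the kinetic term the density and the inverse metric combine to a matrix exactly
  linear in \<open>\<kappa>\<close>. Second order is therefore due to the density in front of the
  mass term alone.\<close>

lemma scalar_expansion:
  fixes h \<phi> x m
  defines "H \<equiv> eta ** h x"
  shows "second_order_expansion (\<lambda>\<kappa>. of_real (Lcl_scalar m (metric \<kappa> h) \<phi> x)) (of_real (Lcl0_scalar m \<phi> x))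
     (of_real (- (m\<^sup>2) * (\<phi> x)\<^sup>2 * ((trace H)\<^sup>2 / 8 - trace (H ** H) / 4)))"
proof -
  define d where "d = (\<lambda>\<mu>. pd \<mu> \<phi> x)"
  have eq: "\<forall>\<^sub>F k in at 0. 1/2 * ((\<Sum>\<mu>\<in>UNIV. \<Sum>\<nu>\<in>UNIV. ((mat 1 + k *\<^sub>R H) ** eta) $\<mu>$\<nu> * (d \<mu> * d \<nu>))
      - volume (k *\<^sub>R H) * (m\<^sup>2 * (\<phi> x)\<^sup>2)) = Lcl_scalar m (metric k h) \<phi> x"
    using eventually_det_positive[of h x]
  proof eventually_elim
    case (elim k)
    define v where "v = volume (mixed k h x)"
    have v: "v > 0" "sqrt (det (mat 1 + mixed k h x)) = v" using elim by (simp_all add: v_def volume_def)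
    have X: "k *\<^sub>R H = mixed k h x" by (simp add: H_def mixed_def)
    define S where "S = (\<Sum>\<mu>\<in>UNIV. \<Sum>\<nu>\<in>UNIV. ((mat 1 + mixed k h x) ** eta) $\<mu>$\<nu> * (d \<mu> * d \<nu>))"
    have "Lcl_scalar m (metric k h) \<phi> x = 1/2 * v * ((1/v) * S - m\<^sup>2 * (\<phi> x)\<^sup>2)"
      unfolding Lcl_scalar_def metric_eq(2,3)[OF elim] S_def v(2)[symmetric]
      by (simp add: v_def[symmetric] v(2) d_def sum_distrib_left mult_ac)
    then show ?case
      using v(1) unfolding X S_def[symmetric] v_def[symmetric] by (simp add: right_diff_distrib)
  qed
  have "jet (\<lambda>k. (mat 1 + k *\<^sub>R H) ** eta) (mat 1 ** eta) (H ** eta) 0"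
    using jet_linear[OF mm.bounded_linear_left[of eta] jet_add[OF jet_const[of "mat 1"] jet_monom[of H]]]
    by simp
  from jet_cong[OF eq jet_mult_const_left[OF jet_diff[OF
      jet_sum[OF jet_sum[OF jet_mult_const_right[OF jet_nth[OF this]]]]
      jet_mult_const_right[OF jet_volume]]]]
  have "jet (\<lambda>\<kappa>. Lcl_scalar m (metric \<kappa> h) \<phi> x) (Lcl0_scalar m \<phi> x)
     (1/2 * ((\<Sum>\<mu>\<in>UNIV. \<Sum>\<nu>\<in>UNIV. (H ** eta) $\<mu>$\<nu> * (d \<mu> * d \<nu>)) - trace H / 2 * (m\<^sup>2 * (\<phi> x)\<^sup>2)))
     ((- (m\<^sup>2) * (\<phi> x)\<^sup>2 * ((trace H)\<^sup>2 / 8 - trace (H ** H) / 4)) / 2)"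
    by (simp add: Lcl0_scalar_def d_def mult_ac)
  from jet_of_real[OF this] show ?thesis
    by (intro jet_second_order_expansion) (simp add: scaleR_conv_of_real)
qed

text \<open>Two inverse metrics against one density leave \<open>1 / volume\<close> times a
  quadratic form in the linear matrix \<open>Q\<close>. The three orders of
  \<open>1 / volume\<close> meet the three orders of this form.\<close>

lemma maxwell_expansion:
  fixes h F x
  defines "H \<equiv> eta ** h x"
  defines "Fs \<equiv> \<lambda>A B. (\<Sum>\<mu>\<in>UNIV. \<Sum>\<nu>\<in>UNIV. \<Sum>\<kappa>\<in>UNIV. \<Sum>\<tau>\<in>UNIV.
     (A :: real^4^4)$\<mu>$\<nu> * (B :: real^4^4)$\<kappa>$\<tau> * (F x $\<mu>$\<kappa> * F x $\<nu>$\<tau>))"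
  shows "second_order_expansion (\<lambda>\<kappa>. of_real (Lcl_maxwell (metric \<kappa> h) F x)) (of_real (Lcl0_maxwell F x))
     (of_real (- 1/2 * (Fs (H ** eta) (H ** eta) - trace H / 2 * (Fs eta (H ** eta) + Fs (H ** eta) eta)
        + ((trace H)\<^sup>2 / 8 + trace (H ** H) / 4) * Fs eta eta)))"
proof -
  define Q where "Q = (\<lambda>k. (mat 1 + k *\<^sub>R H) ** eta)"
  have eq: "\<forall>\<^sub>F k in at 0. - 1/4 * ((1 / volume (k *\<^sub>R H)) * Fs (Q k) (Q k)) = Lcl_maxwell (metric k h) F x"
    using eventually_det_positive[of h x]
  proof eventually_elim
    case (elim k)
    define v where "v = volume (mixed k h x)"
    have v: "v > 0" "sqrt (det (mat 1 + mixed k h x)) = v" using elim by (simp_all add: v_def volume_def)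
    have X: "k *\<^sub>R H = mixed k h x" by (simp add: H_def mixed_def)
    have "Lcl_maxwell (metric k h) F x = - 1/4 * v * ((1/v) * (1/v) * Fs (Q k) (Q k))"
      unfolding Lcl_maxwell_def metric_eq(2,3)[OF elim] Fs_def Q_def X
      by (simp add: v_def[symmetric] v(2) sum_distrib_left mult_ac)
    then show ?case
      using v(1) unfolding X v_def[symmetric] by (simp add: field_simps)
  qed
  have Q: "jet Q (mat 1 ** eta) (H ** eta) 0"
    unfolding Q_def using jet_linear[OF mm.bounded_linear_left[of eta] jet_add[OF jet_const[of "mat 1"] jet_monom[of H]]]
    by simp
  have "jet (\<lambda>k. Fs (Q k) (Q k)) (Fs eta eta) (Fs eta (H ** eta) + Fs (H ** eta) eta) (Fs (H ** eta) (H ** eta))"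
    unfolding Fs_def
    using jet_sum[OF jet_sum[OF jet_sum[OF jet_sum[OF jet_mult_const_right[OF jet_mult[OF jet_nth[OF Q] jet_nth[OF Q]]]]]]]
    by (simp add: distrib_right sum.distrib)
  from jet_cong[OF eq jet_mult_const_left[OF jet_mult[OF jet_inverse[OF jet_volume] this]]]
  have "jet (\<lambda>\<kappa>. Lcl_maxwell (metric \<kappa> h) F x) (- 1/4 * Fs eta eta)
     (- 1/4 * (Fs eta (H ** eta) + Fs (H ** eta) eta - trace H / 2 * Fs eta eta))
     (- 1/4 * (Fs (H ** eta) (H ** eta) - trace H / 2 * (Fs eta (H ** eta) + Fs (H ** eta) eta)
        + ((trace H / 2)\<^sup>2 - ((trace H)\<^sup>2 / 8 - trace (H ** H) / 4)) * Fs eta eta))"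
    by (simp add: algebra_simps)
  moreover have "- 1/4 * Fs eta eta = Lcl0_maxwell F x"
    by (simp add: Lcl0_maxwell_def Fs_def eta_nth eta_mult_nth mult_ac if_distrib[of "\<lambda>z. z * _"]
        if_distrib[of "\<lambda>z. _ * z"] sum_if_const cong: if_cong)
  moreover have "- 1/4 * (Fs (H ** eta) (H ** eta) - trace H / 2 * (Fs eta (H ** eta) + Fs (H ** eta) eta)
        + ((trace H / 2)\<^sup>2 - ((trace H)\<^sup>2 / 8 - trace (H ** H) / 4)) * Fs eta eta)
    = (- 1/2 * (Fs (H ** eta) (H ** eta) - trace H / 2 * (Fs eta (H ** eta) + Fs (H ** eta) eta)
        + ((trace H)\<^sup>2 / 8 + trace (H ** H) / 4) * Fs eta eta)) / 2"
    by (simp add: field_simps power2_eq_square)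
  ultimately have "jet (\<lambda>\<kappa>. Lcl_maxwell (metric \<kappa> h) F x) (Lcl0_maxwell F x)
     (- 1/4 * (Fs eta (H ** eta) + Fs (H ** eta) eta - trace H / 2 * Fs eta eta))
     ((- 1/2 * (Fs (H ** eta) (H ** eta) - trace H / 2 * (Fs eta (H ** eta) + Fs (H ** eta) eta)
        + ((trace H)\<^sup>2 / 8 + trace (H ** H) / 4) * Fs eta eta)) / 2)"
    by (simp only:)
  from jet_of_real[OF this] show ?thesis
    by (intro jet_second_order_expansion) (simp add: scaleR_conv_of_real)
qed

section \<open>Derivatives of smooth fields\<close>

lemma smooth_has_derivative:
  assumes "smooth f"
  shows "(f has_derivative (\<lambda>v. \<Sum>\<mu>\<in>UNIV. v$\<mu> *\<^sub>R pd \<mu> f x)) (at x)"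
proof -
  obtain D where D: "D [] = f"
    "\<And>is x. (D is has_derivative (\<lambda>v. \<Sum>\<mu>\<in>UNIV. v$\<mu> *\<^sub>R D (\<mu> # is) x)) (at x)"
    using assms unfolding smooth_def by blast
  have d: "(f has_derivative (\<lambda>v. \<Sum>\<mu>\<in>UNIV. v$\<mu> *\<^sub>R D [\<mu>] x)) (at x)"
    using D(2)[of "[]"] D(1) by simp
  have "pd \<mu> f x = D [\<mu>] x" for \<mu>
    unfolding pd_eqI[OF d] by (simp add: axis_def if_distrib[of "\<lambda>c. c *\<^sub>R _"] cong: if_cong)
  with d show ?thesis by simp
qed

lemma pd_linear:
  assumes "bounded_linear L" "smooth f"
  shows "pd \<mu> (\<lambda>y. L (f y)) x = L (pd \<mu> f x)"
proof -
  have "pd \<mu> (\<lambda>y. L (f y)) x = L (\<Sum>\<nu>\<in>UNIV. axis \<mu> 1 $ \<nu> *\<^sub>R pd \<nu> f x)"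
    by (rule pd_eqI[OF bounded_linear.has_derivative[OF assms(1) smooth_has_derivative[OF assms(2)]]])
  also have "(\<Sum>\<nu>\<in>UNIV. axis \<mu> 1 $ \<nu> *\<^sub>R pd \<nu> f x) = pd \<mu> f x"
    by (simp add: axis_def if_distrib[of "\<lambda>c. c *\<^sub>R _"] cong: if_cong)
  finally show ?thesis .
qed

text \<open>Metric and tetrad obey their explicit formulas only near a point. Since
  \<open>frechet_derivative\<close> is a choice, the two functions are shown to have the same
  derivatives in the relational sense.\<close>

lemma pd_cong:
  assumes "\<forall>\<^sub>F y in nhds x. f y = g y"
  shows "pd \<mu> f x = pd \<mu> g x"
proof -
  have x: "f x = g x"
    using eventually_nhds_x_imp_x[OF assms] .
  have ev: "\<forall>\<^sub>F y in at x. f y = g y" "\<forall>\<^sub>F y in at x. g y = f y"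
    using assms by (auto simp: eventually_at_filter elim: eventually_mono)
  then have "(f has_derivative f') (at x) \<longleftrightarrow> (g has_derivative f') (at x)" for f'
    using has_derivative_transform_eventually[OF _ ev(1) x UNIV_I, of f']
      has_derivative_transform_eventually[OF _ ev(2) x[symmetric] UNIV_I, of f'] by blast
  then show ?thesis
    by (simp add: pd_def frechet_derivative_def)
qed

section \<open>Dirac bilinears\<close>

lemma matrix_sum_linear:
  fixes A :: "'i \<Rightarrow> complex^4^4"
  shows "(\<Sum>i\<in>I. c i *\<^sub>R A i) ** B = (\<Sum>i\<in>I. c i *\<^sub>R (A i ** B))"
    "B ** (\<Sum>i\<in>I. c i *\<^sub>R A i) = (\<Sum>i\<in>I. c i *\<^sub>R (B ** A i))"
    "(\<Sum>i\<in>I. c i *\<^sub>R A i) *v s = (\<Sum>i\<in>I. c i *\<^sub>R (A i *v s))"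
proof -
  have l: "linear (\<lambda>A. A ** B)" "linear (\<lambda>A. B ** A)" "linear (\<lambda>A :: complex^4^4. A *v s)"
    by (intro linearI; simp add: vec_eq_iff matrix_matrix_mult_def matrix_vector_mult_def sum.distrib
        distrib_left distrib_right scaleR_sum_right)+
  show "(\<Sum>i\<in>I. c i *\<^sub>R A i) ** B = (\<Sum>i\<in>I. c i *\<^sub>R (A i ** B))"
    "B ** (\<Sum>i\<in>I. c i *\<^sub>R A i) = (\<Sum>i\<in>I. c i *\<^sub>R (B ** A i))"
    "(\<Sum>i\<in>I. c i *\<^sub>R A i) *v s = (\<Sum>i\<in>I. c i *\<^sub>R (A i *v s))"
    by (simp_all add: linear_sum[OF l(1)] linear_sum[OF l(2)] linear_sum[OF l(3)]
        linear_cmul[OF l(1)] linear_cmul[OF l(2)] linear_cmul[OF l(3)])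
qed

lemma matrix_mult_diff:
  fixes A B C :: "complex^4^4"
  shows "(A - B) ** C = A ** C - B ** C" "C ** (A - B) = C ** A - C ** B" "(A + B) ** C = A ** C + B ** C"
  by (simp_all add: vec_eq_iff matrix_matrix_mult_def sum_subtractf sum.distrib algebra_simps)

lemma pair_add: "pair b (s + t) = pair b s + pair b t" "pair (b + c) s = pair b s + pair c s"
  and pair_diff: "pair (b - c) s = pair b s - pair c s"
  by (simp_all add: pair_def sum.distrib sum_subtractf algebra_simps)

lemma linear_pair: "linear (pair b)"
  by (intro linearI) (simp_all add: pair_def sum.distrib scaleR_sum_right algebra_simps)

lemma pair_sum: "pair b (\<Sum>i\<in>I. c i *\<^sub>R s i) = (\<Sum>i\<in>I. of_real (c i) * pair b (s i))"
  by (simp add: linear_sum[OF linear_pair] linear_cmul[OF linear_pair] scaleR_conv_of_real[where 'a = complex])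

lemma pair_vector_matrix: "pair (b v* S) s = pair b (S *v s)"
proof -
  have "pair (b v* S) s = (\<Sum>i\<in>UNIV. \<Sum>j\<in>UNIV. S$j$i * b$j * s$i)"
    by (simp add: pair_def vector_matrix_mult_def sum_distrib_left mult_ac)
  also have "\<dots> = pair b (S *v s)"
    by (subst sum.swap) (simp add: pair_def matrix_vector_mult_def sum_distrib_left mult_ac)
  finally show ?thesis .
qed

definition bilin :: "(4 \<Rightarrow> complex^4^4) \<Rightarrow> complex^4 \<Rightarrow> complex^4^4 \<Rightarrow> complex" where
  "bilin \<gamma> s M = pair (bar \<gamma> s) (M *v s)"

lemma linear_bilin: "linear (bilin \<gamma> s)"
proof (rule linearI)
  show "bilin \<gamma> s (M + N) = bilin \<gamma> s M + bilin \<gamma> s N" for M N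
    by (simp add: bilin_def matrix_vector_mult_add_rdistrib pair_add)
  show "bilin \<gamma> s (c *\<^sub>R M) = c *\<^sub>R bilin \<gamma> s M" for c M
    using matrix_sum_linear(3)[of "\<lambda>_. c" "\<lambda>_. M" "{()}" s]
    by (simp add: bilin_def linear_cmul[OF linear_pair])
qed

lemma bilin_sum: "bilin \<gamma> s (\<Sum>i\<in>I. c i *\<^sub>R M i) = (\<Sum>i\<in>I. of_real (c i) * bilin \<gamma> s (M i))"
  by (simp add: linear_sum[OF linear_bilin] linear_cmul[OF linear_bilin] scaleR_conv_of_real[where 'a = complex])

definition comm :: "(4 \<Rightarrow> complex^4^4) \<Rightarrow> 4 \<Rightarrow> 4 \<Rightarrow> complex^4^4" where
  "comm \<gamma> \<alpha> \<beta> = \<gamma> \<alpha> ** \<gamma> \<beta> - \<gamma> \<beta> ** \<gamma> \<alpha>"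

text \<open>An anticommutator appears because the spin term enters the two covariant derivatives
  with opposite signs and the Lagrangian takes their difference.\<close>

definition gamma3 :: "(4 \<Rightarrow> complex^4^4) \<Rightarrow> 4 \<Rightarrow> 4 \<Rightarrow> 4 \<Rightarrow> complex^4^4" where
  "gamma3 \<gamma> \<rho> \<alpha> \<beta> = \<gamma> \<rho> ** comm \<gamma> \<alpha> \<beta> + comm \<gamma> \<alpha> \<beta> ** \<gamma> \<rho>"

lemma mat_commute: "mat c ** A = A ** (mat c :: complex^4^4)"
  by (simp add: vec_eq_iff matrix_matrix_mult_def mat_nth if_distrib[of "\<lambda>z. z * _"] if_distrib[of "\<lambda>z. _ * z"]
      mult.commute cong: if_cong)

text \<open>The anticommutator \<open>P\<close> of two Dirac matrices is a multiple of the identity.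
  The second and third identities hold up to a commutator with some \<open>P\<close>, which
  vanishes. The third form is the one occurring in \<open>L20_dirac\<close>.\<close>

lemma gamma3_antisym:
  assumes "dirac_matrices \<gamma>"
  shows "gamma3 \<gamma> \<rho> \<beta> \<alpha> = - gamma3 \<gamma> \<rho> \<alpha> \<beta>" "gamma3 \<gamma> \<beta> \<alpha> \<rho> = - gamma3 \<gamma> \<rho> \<alpha> \<beta>"
    "gamma3 \<gamma> \<rho> \<alpha> \<beta> = 2 *\<^sub>R (\<gamma> \<rho> ** \<gamma> \<alpha> ** \<gamma> \<beta> - \<gamma> \<beta> ** \<gamma> \<alpha> ** \<gamma> \<rho>)"
proof -
  note distribs = matrix_mult_diff matrix_add_ldistrib matrix_mul_assoc
  define P where "P = (\<lambda>\<rho> \<beta>. \<gamma> \<rho> ** \<gamma> \<beta> + \<gamma> \<beta> ** \<gamma> \<rho>)"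
  have comm: "A ** P \<rho> \<beta> = P \<rho> \<beta> ** A" for A \<rho> \<beta>
  proof -
    have "P \<rho> \<beta> = mat (2 * of_real (eta$\<rho>$\<beta>))"
      using assms by (simp add: dirac_matrices_def P_def)
    then show ?thesis by (simp add: mat_commute)
  qed
  show "gamma3 \<gamma> \<rho> \<beta> \<alpha> = - gamma3 \<gamma> \<rho> \<alpha> \<beta>"
    by (simp add: gamma3_def comm_def distribs)
  have "gamma3 \<gamma> \<beta> \<alpha> \<rho> + gamma3 \<gamma> \<rho> \<alpha> \<beta> = \<gamma> \<alpha> ** P \<rho> \<beta> - P \<rho> \<beta> ** \<gamma> \<alpha>"
    unfolding gamma3_def comm_def P_def distribs by simp
  then show "gamma3 \<gamma> \<beta> \<alpha> \<rho> = - gamma3 \<gamma> \<rho> \<alpha> \<beta>"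
    by (simp add: comm eq_neg_iff_add_eq_0)
  have "2 *\<^sub>R (\<gamma> \<rho> ** \<gamma> \<alpha> ** \<gamma> \<beta> - \<gamma> \<beta> ** \<gamma> \<alpha> ** \<gamma> \<rho>) - gamma3 \<gamma> \<rho> \<alpha> \<beta> = \<gamma> \<rho> ** P \<alpha> \<beta> - P \<alpha> \<beta> ** \<gamma> \<rho>"
    unfolding gamma3_def comm_def P_def distribs scaleR_2 by simp
  then show "gamma3 \<gamma> \<rho> \<alpha> \<beta> = 2 *\<^sub>R (\<gamma> \<rho> ** \<gamma> \<alpha> ** \<gamma> \<beta> - \<gamma> \<beta> ** \<gamma> \<alpha> ** \<gamma> \<rho>)"
    by (simp add: comm)
qed

definition kin :: "(4 \<Rightarrow> complex^4^4) \<Rightarrow> (spacetime \<Rightarrow> complex^4) \<Rightarrow> spacetime \<Rightarrow> 4 \<Rightarrow> 4 \<Rightarrow> complex" where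
  "kin \<gamma> \<psi> x \<mu> \<alpha> = pair (bar \<gamma> (\<psi> x)) (\<gamma> \<alpha> *v pd \<mu> \<psi> x)
     - pair (pd \<mu> (\<lambda>y. bar \<gamma> (\<psi> y)) x) (\<gamma> \<alpha> *v \<psi> x)"

text \<open>Separates real coefficients, which depend on the metric, from spinor bilinears, which do
  not. The factor \<open>\<i>/16\<close> is \<open>\<i>/2\<close> from the Lagrangian times 1/8 from
  \<open>spin_term\<close>.\<close>

lemma Lcl_dirac_eq:
  fixes g x
  defines "E \<equiv> tetrad (matrix_inv (g x))"
  shows "Lcl_dirac \<gamma> m g \<psi> x = of_real (sqrt (- det (g x))) *
     (\<i>/2 * (\<Sum>\<mu>\<in>UNIV. \<Sum>\<alpha>\<in>UNIV. of_real (E$\<mu>$\<alpha>) * kin \<gamma> \<psi> x \<mu> \<alpha>)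
    + \<i>/16 * (\<Sum>\<mu>\<in>UNIV. \<Sum>\<rho>\<in>UNIV. \<Sum>\<alpha>\<in>UNIV. \<Sum>\<beta>\<in>UNIV.
        of_real (E$\<mu>$\<rho> * spin_connection g \<mu> \<alpha> \<beta> x) * bilin \<gamma> (\<psi> x) (gamma3 \<gamma> \<rho> \<alpha> \<beta>))
    - of_real m * bilin \<gamma> (\<psi> x) (mat 1))"
proof -
  define G where "G = (\<lambda>\<mu>. \<Sum>\<alpha>\<in>UNIV. E$\<mu>$\<alpha> *\<^sub>R \<gamma> \<alpha>)"
  define S where "S = (\<lambda>\<mu>. spin_term \<gamma> g \<mu> x)"
  have S': "spin_term \<gamma> g \<mu> x = S \<mu>" for \<mu> by (simp add: S_def)
  have S: "S \<mu> = (\<Sum>\<alpha>\<in>UNIV. \<Sum>\<beta>\<in>UNIV. (spin_connection g \<mu> \<alpha> \<beta> x / 8) *\<^sub>R comm \<gamma> \<alpha> \<beta>)" for \<mu>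
    by (simp add: S_def spin_term_def comm_def scaleR_sum_right)
  have spin: "bilin \<gamma> (\<psi> x) (G \<mu> ** S \<mu>) + bilin \<gamma> (\<psi> x) (S \<mu> ** G \<mu>)
    = (\<Sum>\<rho>\<in>UNIV. \<Sum>\<alpha>\<in>UNIV. \<Sum>\<beta>\<in>UNIV. of_real (E$\<mu>$\<rho> * spin_connection g \<mu> \<alpha> \<beta> x) * bilin \<gamma> (\<psi> x) (gamma3 \<gamma> \<rho> \<alpha> \<beta>)) / 8" for \<mu>
  proof -
    have "\<gamma> \<rho> ** S \<mu> + S \<mu> ** \<gamma> \<rho> = (\<Sum>\<alpha>\<in>UNIV. \<Sum>\<beta>\<in>UNIV. (spin_connection g \<mu> \<alpha> \<beta> x / 8) *\<^sub>R gamma3 \<gamma> \<rho> \<alpha> \<beta>)" for \<rho>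
      unfolding S sum.cartesian_product
      by (simp add: case_prod_unfold matrix_sum_linear gamma3_def sum.distrib scaleR_right_distrib)
    then have "bilin \<gamma> (\<psi> x) (\<gamma> \<rho> ** S \<mu> + S \<mu> ** \<gamma> \<rho>) =
      (\<Sum>\<alpha>\<in>UNIV. \<Sum>\<beta>\<in>UNIV. of_real (spin_connection g \<mu> \<alpha> \<beta> x / 8) * bilin \<gamma> (\<psi> x) (gamma3 \<gamma> \<rho> \<alpha> \<beta>))" for \<rho>
      by (simp add: linear_sum[OF linear_bilin] linear_cmul[OF linear_bilin] scaleR_conv_of_real[where 'a = complex])
    moreover have "bilin \<gamma> (\<psi> x) (G \<mu> ** S \<mu>) + bilin \<gamma> (\<psi> x) (S \<mu> ** G \<mu>)
      = (\<Sum>\<rho>\<in>UNIV. of_real (E$\<mu>$\<rho>) * bilin \<gamma> (\<psi> x) (\<gamma> \<rho> ** S \<mu> + S \<mu> ** \<gamma> \<rho>))"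
      unfolding G_def matrix_sum_linear bilin_sum linear_add[OF linear_bilin]
      by (simp add: sum.distrib distrib_left)
    ultimately show ?thesis
      by (simp add: sum_distrib_left sum_divide_distrib mult_ac)
  qed
  have "pair (bar \<gamma> (\<psi> x)) (G \<mu> *v (pd \<mu> \<psi> x + S \<mu> *v \<psi> x))
      - pair (pd \<mu> (\<lambda>y. bar \<gamma> (\<psi> y)) x - bar \<gamma> (\<psi> x) v* S \<mu>) (G \<mu> *v \<psi> x)
    = (\<Sum>\<alpha>\<in>UNIV. of_real (E$\<mu>$\<alpha>) * kin \<gamma> \<psi> x \<mu> \<alpha>)
      + (bilin \<gamma> (\<psi> x) (G \<mu> ** S \<mu>) + bilin \<gamma> (\<psi> x) (S \<mu> ** G \<mu>))" for \<mu>
  proof -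
    have "(\<Sum>\<alpha>\<in>UNIV. of_real (E$\<mu>$\<alpha>) * kin \<gamma> \<psi> x \<mu> \<alpha>)
      = pair (bar \<gamma> (\<psi> x)) (G \<mu> *v pd \<mu> \<psi> x) - pair (pd \<mu> (\<lambda>y. bar \<gamma> (\<psi> y)) x) (G \<mu> *v \<psi> x)"
      by (simp add: kin_def G_def matrix_sum_linear pair_sum right_diff_distrib sum_subtractf)
    then show ?thesis
      by (simp add: bilin_def matrix_vector_right_distrib pair_add pair_diff pair_vector_matrix matrix_vector_mul_assoc)
  qed
  then show ?thesis
    unfolding Lcl_dirac_def Let_def E_def[symmetric] G_def[symmetric] S' spin
    by (simp add: sum.distrib bilin_def sum_divide_distrib[symmetric] distrib_left)
qed

section \<open>The spin connection and its contraction with antisymmetric bilinears\<close>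

lemma sum_antisym:
  fixes f :: "4 \<Rightarrow> 4 \<Rightarrow> complex"
  assumes "\<And>i j. f i j = - f j i"
  shows "(\<Sum>i\<in>UNIV. \<Sum>j\<in>UNIV. f i j) = 0"
proof -
  have "(\<Sum>i\<in>UNIV. \<Sum>j\<in>UNIV. f i j) = (\<Sum>i\<in>UNIV. \<Sum>j\<in>UNIV. - f j i)"
    by (intro sum.cong refl assms)
  also have "\<dots> = - (\<Sum>i\<in>UNIV. \<Sum>j\<in>UNIV. f i j)"
    unfolding sum_negf by (subst sum.swap) (rule refl)
  finally show ?thesis
    by (simp add: eq_neg_iff_add_eq_0)
qed

lemma symmetric_nth:
  assumes "transpose A = A"
  shows "A$i$j = A$j$i"
proof -
  have "A$i$j = transpose A $j$i" by (simp add: transpose_def)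
  then show ?thesis by (simp only: assms)
qed

text \<open>The \<open>l\<close> term is symmetric in \<open>\<alpha>\<close>,
  \<open>\<beta>\<close>. In the \<open>Z\<close> term, symmetry in the two spacetime indices makes
  the contraction with two tetrads symmetric in \<open>\<rho>\<close>, \<open>\<beta>\<close>. Both
  are paired with an \<open>A\<close> antisymmetric in these indices.\<close>

lemma spin_contraction:
  fixes E :: "real^4^4" and A :: "4 \<Rightarrow> 4 \<Rightarrow> 4 \<Rightarrow> complex"
  assumes A: "\<And>\<rho> \<alpha> \<beta>. A \<rho> \<beta> \<alpha> = - A \<rho> \<alpha> \<beta>" "\<And>\<rho> \<alpha> \<beta>. A \<beta> \<alpha> \<rho> = - A \<rho> \<alpha> \<beta>"
    and w: "\<And>\<mu> \<alpha> \<beta>. w \<mu> \<alpha> \<beta> = l \<mu> * eta$\<alpha>$\<beta> + Y \<mu> \<alpha> \<beta> + (\<Sum>\<nu>\<in>UNIV. Z \<alpha> \<mu> \<nu> * E$\<nu>$\<beta>)"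
    and Z: "\<And>\<alpha> \<mu> \<nu>. Z \<alpha> \<mu> \<nu> = Z \<alpha> \<nu> \<mu>"
  shows "(\<Sum>\<mu>\<in>UNIV. \<Sum>\<rho>\<in>UNIV. \<Sum>\<alpha>\<in>UNIV. \<Sum>\<beta>\<in>UNIV. of_real (E$\<mu>$\<rho> * w \<mu> \<alpha> \<beta>) * A \<rho> \<alpha> \<beta>)
    = (\<Sum>\<mu>\<in>UNIV. \<Sum>\<rho>\<in>UNIV. \<Sum>\<alpha>\<in>UNIV. \<Sum>\<beta>\<in>UNIV. of_real (E$\<mu>$\<rho> * Y \<mu> \<alpha> \<beta>) * A \<rho> \<alpha> \<beta>)"
proof -
  have A0: "A \<rho> \<alpha> \<alpha> = 0" for \<rho> \<alpha>
    using A(1)[of \<rho> \<alpha> \<alpha>] by (simp add: eq_neg_iff_add_eq_0)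
  have "(\<Sum>\<alpha>\<in>UNIV. \<Sum>\<beta>\<in>UNIV. of_real (E$\<mu>$\<rho> * (l \<mu> * eta$\<alpha>$\<beta>)) * A \<rho> \<alpha> \<beta>) = 0" for \<mu> \<rho>
    by (rule sum_antisym) (auto simp: eta_nth A0)
  then have 1: "(\<Sum>\<mu>\<in>UNIV. \<Sum>\<rho>\<in>UNIV. \<Sum>\<alpha>\<in>UNIV. \<Sum>\<beta>\<in>UNIV. of_real (E$\<mu>$\<rho> * (l \<mu> * eta$\<alpha>$\<beta>)) * A \<rho> \<alpha> \<beta>) = 0"
    by simp
  define N where "N = (\<lambda>\<alpha> \<rho> \<beta>. \<Sum>\<mu>\<in>UNIV. \<Sum>\<nu>\<in>UNIV. E$\<mu>$\<rho> * (Z \<alpha> \<mu> \<nu> * E$\<nu>$\<beta>))"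
  have N: "N \<alpha> \<rho> \<beta> = N \<alpha> \<beta> \<rho>" for \<alpha> \<rho> \<beta>
    unfolding N_def by (subst sum.swap, subst Z) (simp add: mult_ac)
  define g where "g = (\<lambda>\<mu> \<rho> \<alpha> \<beta>. of_real (E$\<mu>$\<rho> * (\<Sum>\<nu>\<in>UNIV. Z \<alpha> \<mu> \<nu> * E$\<nu>$\<beta>)) * A \<rho> \<alpha> \<beta>)"
  have "(\<Sum>\<mu>\<in>UNIV. \<Sum>\<rho>\<in>UNIV. \<Sum>\<alpha>\<in>UNIV. \<Sum>\<beta>\<in>UNIV. g \<mu> \<rho> \<alpha> \<beta>) = (\<Sum>\<rho>\<in>UNIV. \<Sum>\<mu>\<in>UNIV. \<Sum>\<alpha>\<in>UNIV. \<Sum>\<beta>\<in>UNIV. g \<mu> \<rho> \<alpha> \<beta>)"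
    by (rule sum.swap)
  also have "\<dots> = (\<Sum>\<rho>\<in>UNIV. \<Sum>\<alpha>\<in>UNIV. \<Sum>\<mu>\<in>UNIV. \<Sum>\<beta>\<in>UNIV. g \<mu> \<rho> \<alpha> \<beta>)"
    by (intro sum.cong refl sum.swap)
  also have "\<dots> = (\<Sum>\<alpha>\<in>UNIV. \<Sum>\<rho>\<in>UNIV. \<Sum>\<mu>\<in>UNIV. \<Sum>\<beta>\<in>UNIV. g \<mu> \<rho> \<alpha> \<beta>)"
    by (rule sum.swap)
  also have "\<dots> = (\<Sum>\<alpha>\<in>UNIV. \<Sum>\<rho>\<in>UNIV. \<Sum>\<beta>\<in>UNIV. \<Sum>\<mu>\<in>UNIV. g \<mu> \<rho> \<alpha> \<beta>)"
    by (rule sum.cong[OF refl], rule sum.cong[OF refl], rule sum.swap)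
  also have "\<dots> = (\<Sum>\<alpha>\<in>UNIV. \<Sum>\<rho>\<in>UNIV. \<Sum>\<beta>\<in>UNIV. of_real (N \<alpha> \<rho> \<beta>) * A \<rho> \<alpha> \<beta>)"
    by (simp add: g_def N_def sum_distrib_left sum_distrib_right)
  also have "\<dots> = (\<Sum>\<alpha>\<in>(UNIV :: 4 set). 0)"
  proof (rule sum.cong[OF refl], rule sum_antisym)
    fix \<alpha> \<rho> \<beta>
    show "of_real (N \<alpha> \<rho> \<beta>) * A \<rho> \<alpha> \<beta> = - (of_real (N \<alpha> \<beta> \<rho>) * A \<beta> \<alpha> \<rho>)"
      by (simp add: N[of \<alpha> \<rho> \<beta>] A(2)[of \<beta> \<alpha> \<rho>])
  qed
  finally have 2: "(\<Sum>\<mu>\<in>UNIV. \<Sum>\<rho>\<in>UNIV. \<Sum>\<alpha>\<in>UNIV. \<Sum>\<beta>\<in>UNIV. g \<mu> \<rho> \<alpha> \<beta>) = 0"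
    by simp
  have "of_real (E$\<mu>$\<rho> * w \<mu> \<alpha> \<beta>) * A \<rho> \<alpha> \<beta> = of_real (E$\<mu>$\<rho> * (l \<mu> * eta$\<alpha>$\<beta>)) * A \<rho> \<alpha> \<beta>
     + of_real (E$\<mu>$\<rho> * Y \<mu> \<alpha> \<beta>) * A \<rho> \<alpha> \<beta> + g \<mu> \<rho> \<alpha> \<beta>" for \<mu> \<rho> \<alpha> \<beta>
    unfolding w g_def by (simp add: distrib_left distrib_right)
  then show ?thesis
    by (simp only: sum.distrib 1 2 add_0_left add_0_right)
qed

lemma eta_sandwich_nth:
  fixes A B :: "real^4^4"
  shows "(A ** eta ** B) $ i $ j = (\<Sum>k\<in>UNIV. A $ i $ k * sg k * B $ k $ j)"
  unfolding matrix_matrix_mult_def[of "A ** eta"] by (simp add: eta_mult_nth)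

lemma bounded_linear_mixed: "bounded_linear (\<lambda>M. \<kappa> *\<^sub>R (eta ** M))"
  by (intro bounded_linear_compose[OF bounded_linear_scaleR_right mm.bounded_linear_right])

lemma transpose_metric:
  assumes "0 < det (mat 1 + mixed \<kappa> h y)" "transpose (h y) = h y"
  shows "transpose (metric \<kappa> h y) = metric \<kappa> h y"
proof -
  define G where "G = (mat 1 + mixed \<kappa> h y) ** eta"
  have "det G \<noteq> 0" using assms(1) by (simp add: G_def det_mul det_eta)
  then obtain B where B: "G ** B = mat 1"
    using invertible_det_nz[of G] unfolding invertible_def by blast
  then have "B ** G = mat 1" using matrix_left_right_inverse by blast
  then have "transpose G ** transpose B = mat 1"
    by (simp flip: matrix_transpose_mul)
  moreover have "transpose G = G"
    unfolding G_def inverse_density[symmetric]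
    using assms(2) by (simp add: vec_eq_iff transpose_def eta_mult_nth eta_nth)
  ultimately have "transpose B = B"
    using B matrix_inv_eqI[of G] by metis
  then show ?thesis
    unfolding metric_eq(1)[OF assms(1)] G_def[symmetric] matrix_inv_eqI[OF B]
    by (simp add: transpose_scalar)
qed

text \<open>\<open>J\<close> is the derivative of the root, \<open>l\<close> stems from the
  derivative of the scalar factor of the tetrad, and \<open>Z\<close> is the Christoffel symbol with
  its upper index converted by the tetrad. In this shape \<open>spin_contraction\<close> removes the
  \<open>l\<close> and \<open>Z\<close> terms.\<close>

lemma spin_connection_eq:
  assumes R: "\<And>X :: real^4^4. norm X < \<epsilon> \<Longrightarrow> R X ** R X = mat 1 + X \<and> norm (R X - mat 1) < 1 \<and>
      R differentiable (at X) \<and> 0 < det (mat 1 + X) \<and>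
      norm ((1 / sqrt (volume X)) *\<^sub>R R X - mat 1) < 1"
    and h: "deviation h" and small: "norm (mixed \<kappa> h x) < \<epsilon>"
  obtains J l Z where
    "\<And>\<mu>. R (mixed \<kappa> h x) ** J \<mu> + J \<mu> ** R (mixed \<kappa> h x) = \<kappa> *\<^sub>R (eta ** pd \<mu> h x)"
    "\<And>\<alpha> \<mu> \<nu>. Z \<alpha> \<mu> \<nu> = Z \<alpha> \<nu> \<mu>"
    "\<And>\<mu> \<alpha> \<beta>. spin_connection (metric \<kappa> h) \<mu> \<alpha> \<beta> x = l \<mu> * eta$\<alpha>$\<beta>
      + (eta ** (matrix_inv (R (mixed \<kappa> h x)) ** J \<mu>))$\<alpha>$\<beta>
      + (\<Sum>\<nu>\<in>UNIV. Z \<alpha> \<mu> \<nu> * tetrad (matrix_inv (metric \<kappa> h x))$\<nu>$\<beta>)"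
proof -
  define X where "X = mixed \<kappa> h"
  define v where "v = (\<lambda>y. volume (X y))"
  define r where "r = (\<lambda>y. 1 / sqrt (v y))"
  define K where "K = (\<lambda>y. R (X y))"
  define E where "E = (\<lambda>y. tetrad (matrix_inv (metric \<kappa> h y)))"
  have sm: "smooth h" and sym: "transpose (h y) = h y" for y
    using h by (auto simp: deviation_def)
  define X' where "X' = (\<lambda>w. \<kappa> *\<^sub>R (eta ** (\<Sum>\<mu>\<in>UNIV. w$\<mu> *\<^sub>R pd \<mu> h x)))"
  have dX: "(X has_derivative X') (at x)"
    unfolding X_def mixed_def[abs_def] X'_def
    by (rule bounded_linear.has_derivative[OF bounded_linear_mixed smooth_has_derivative[OF sm]])
  have "((\<lambda>y. norm (X y)) \<longlongrightarrow> norm (X x)) (nhds x)"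
    using has_derivative_continuous[OF dX] unfolding isCont_def tendsto_at_iff_tendsto_nhds
    by (rule tendsto_norm)
  then have ev: "\<forall>\<^sub>F y in nhds x. norm (X y) < \<epsilon>"
    by (rule order_tendstoD) (use small in \<open>simp add: X_def\<close>)
  note Rx = R[OF small, folded X_def]
  obtain R' where "(R has_derivative R') (at (X x))"
    using Rx unfolding differentiable_def by blast
  from has_derivative_compose[OF dX this] obtain K' where dK: "(K has_derivative K') (at x)"
    unfolding K_def by blast
  define J where "J = (\<lambda>\<mu>. K' (axis \<mu> 1))"
  \<comment> \<open>The product rule for \<open>K ** K = 1 + X\<close>. This linear equation, with
    \<open>K\<close> on both sides of \<open>J\<close>, is all that will be used about the
    derivative of the root.\<close>
  have KK: "K x ** J \<mu> + J \<mu> ** K x = \<kappa> *\<^sub>R (eta ** pd \<mu> h x)" for \<mu>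
  proof -
    have d1: "((\<lambda>y. mat 1 + X y) has_derivative X') (at x)"
      using has_derivative_add[OF has_derivative_const dX] by simp
    have "pd \<mu> (\<lambda>y. K y ** K y) x = pd \<mu> (\<lambda>y. mat 1 + X y) x"
      by (rule pd_cong) (use ev in eventually_elim, simp add: K_def R)
    then show ?thesis
      unfolding pd_eqI[OF mm.FDERIV[OF dK dK]] pd_eqI[OF d1]
      by (simp add: J_def X'_def axis_def if_distrib[of "\<lambda>c. c *\<^sub>R _"] cong: if_cong)
  qed
  have det_pos: "0 < det (mat 1 + X x)" using Rx by blast
  obtain r' where dr: "(r has_derivative r') (at x)"
  proof -
    have "(\<lambda>y. det (mat 1 + X y)) differentiable (at x)"
      using dX by (intro differentiable_det differentiable_add differentiable_const) (auto simp: differentiable_def)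
    then obtain D where D: "((\<lambda>y. det (mat 1 + X y)) has_derivative D) (at x)"
      unfolding differentiable_def by blast
    have "\<exists>d. ((\<lambda>z. 1 / sqrt (sqrt z)) has_real_derivative d) (at (det (mat 1 + X x)))"
      by (rule exI, (rule derivative_eq_intros refl | use det_pos in simp)+)
    then obtain d where "((\<lambda>z. 1 / sqrt (sqrt z)) has_derivative (*) d) (at (det (mat 1 + X x)))"
      unfolding has_field_derivative_def by blast
    from has_derivative_compose[OF D this] have "(r has_derivative (\<lambda>w. d * D w)) (at x)"
      unfolding r_def v_def volume_def .
    then show ?thesis by (rule that)
  qed
  have evE: "\<forall>\<^sub>F y in nhds x. E y = r y *\<^sub>R K y"
    using ev
  proof eventually_elim
    case (elim y)
    show ?case
      using tetrad_eq[of "K y" \<kappa> h y] R[OF elim] sym by (simp add: E_def r_def v_def K_def X_def)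
  qed
  have Ex: "E x = r x *\<^sub>R K x" by (rule eventually_nhds_x_imp_x[OF evE])
  define r1 where "r1 = (\<lambda>\<mu>. r' (axis \<mu> 1))"
  have pdE: "pd \<mu> (\<lambda>y. E y $ \<tau> $ \<beta>) x = (r x *\<^sub>R J \<mu> + r1 \<mu> *\<^sub>R K x) $ \<tau> $ \<beta>" for \<mu> \<tau> \<beta>
  proof -
    have "pd \<mu> (\<lambda>y. E y $ \<tau> $ \<beta>) x = pd \<mu> (\<lambda>y. (r y *\<^sub>R K y) $ \<tau> $ \<beta>) x"
      by (rule pd_cong) (use evE in eventually_elim, simp)
    also have "\<dots> = (r x *\<^sub>R K' (axis \<mu> 1) + r' (axis \<mu> 1) *\<^sub>R K x) $ \<tau> $ \<beta>"
      by (rule pd_eqI[OF bounded_linear.has_derivative[OF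
            bounded_linear_compose[OF bounded_linear_vec_nth[of \<beta>] bounded_linear_vec_nth[of \<tau>]]
            has_derivative_scaleR[OF dr dK]]])
    finally show ?thesis by (simp add: J_def r1_def)
  qed
  have vpos: "0 < v x" using det_pos by (simp add: v_def volume_def)
  define s where "s = sqrt (v x)"
  have sr: "s * r x = 1" "r x * v x = s"
    using vpos by (simp_all add: s_def r_def real_div_sqrt)
  have "det (K x) * det (K x) = det (mat 1 + X x)"
    using Rx by (simp add: K_def flip: det_mul)
  then have "det (K x) \<noteq> 0" using det_pos by auto
  then obtain Ki where Ki: "K x ** Ki = mat 1"
    using invertible_det_nz[of "K x"] unfolding invertible_def by blast
  then have Ki': "Ki ** K x = mat 1" using matrix_left_right_inverse by blast
  have inv: "matrix_inv (K x) = Ki" by (rule matrix_inv_eqI[OF Ki])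
  have g: "metric \<kappa> h x = v x *\<^sub>R (eta ** Ki ** Ki)"
  proof -
    have "(mat 1 + X x) ** eta ** (eta ** Ki ** Ki) = K x ** (K x ** (eta ** eta) ** Ki) ** Ki"
      using Rx by (simp add: K_def matrix_mul_assoc)
    also have "\<dots> = mat 1" by (simp add: eta_eta Ki)
    finally have "matrix_inv ((mat 1 + X x) ** eta) = eta ** Ki ** Ki"
      by (rule matrix_inv_eqI)
    then show ?thesis
      using metric_eq(1)[of \<kappa> h x] det_pos by (simp add: X_def v_def)
  qed
  \<comment> \<open>The tetrad with its spacetime index lowered: symmetry of the root cancels one of
    the two inverses in the metric, and the scalar factors \<open>r\<close> and \<open>v\<close>
    combine to \<open>s\<close>.\<close>
  define W where "W = transpose (E x) ** metric \<kappa> h x"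
  have W: "W = s *\<^sub>R (eta ** Ki)"
  proof -
    have "eta ** (eta ** transpose (K x)) = eta ** (K x ** eta)"
      using eta_root_symmetric[of "K x" \<kappa> h x] Rx sym by (simp add: K_def X_def)
    then have tK: "transpose (K x) = eta ** K x ** eta"
      by (simp add: matrix_mul_assoc eta_eta)
    have "W = (r x * v x) *\<^sub>R (eta ** K x ** (eta ** eta) ** Ki ** Ki)"
      unfolding W_def Ex g
      by (simp add: transpose_scalar tK mm.scaleR_left mm.scaleR_right matrix_mul_assoc mult.commute)
    also have "eta ** K x ** (eta ** eta) ** Ki ** Ki = eta ** (K x ** Ki) ** Ki"
      by (simp add: eta_eta matrix_mul_assoc)
    finally show ?thesis by (simp add: Ki sr)
  qed
  define Z where "Z = (\<lambda>\<alpha> \<mu> \<nu>. \<Sum>\<tau>\<in>UNIV. W$\<alpha>$\<tau> * christoffel (metric \<kappa> h) \<tau> \<mu> \<nu> x)"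
  have Z: "Z \<alpha> \<mu> \<nu> = Z \<alpha> \<nu> \<mu>" for \<alpha> \<mu> \<nu>
  proof -
    have "pd \<rho> (\<lambda>y. metric \<kappa> h y $\<mu>$\<nu>) x = pd \<rho> (\<lambda>y. metric \<kappa> h y $\<nu>$\<mu>) x" for \<rho>
    proof (rule pd_cong, use ev in eventually_elim)
      case (elim y)
      show ?case
        by (rule symmetric_nth, rule transpose_metric) (use R[OF elim] sym in \<open>auto simp: X_def\<close>)
    qed
    then show ?thesis
      by (simp add: Z_def christoffel_def algebra_simps)
  qed
  have "spin_connection (metric \<kappa> h) \<mu> \<alpha> \<beta> x = (s * r1 \<mu>) * eta$\<alpha>$\<beta> + (eta ** (Ki ** J \<mu>))$\<alpha>$\<beta>
      + (\<Sum>\<nu>\<in>UNIV. Z \<alpha> \<mu> \<nu> * E x$\<nu>$\<beta>)" for \<mu> \<alpha> \<beta>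
  proof -
    define P where "P = (\<lambda>\<tau>. \<Sum>\<nu>\<in>UNIV. christoffel (metric \<kappa> h) \<tau> \<mu> \<nu> x * E x$\<nu>$\<beta>)"
    have "spin_connection (metric \<kappa> h) \<mu> \<alpha> \<beta> x =
      (\<Sum>\<kappa>'\<in>UNIV. \<Sum>\<tau>\<in>UNIV. metric \<kappa> h x $\<kappa>'$\<tau> * E x $\<kappa>'$\<alpha> * ((r x *\<^sub>R J \<mu> + r1 \<mu> *\<^sub>R K x)$\<tau>$\<beta> + P \<tau>))"
      unfolding spin_connection_def Let_def E_def[symmetric] pdE P_def ..
    also have "\<dots> = (\<Sum>\<tau>\<in>UNIV. W$\<alpha>$\<tau> * ((r x *\<^sub>R J \<mu> + r1 \<mu> *\<^sub>R K x)$\<tau>$\<beta> + P \<tau>))"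
      by (subst sum.swap) (simp add: W_def matrix_matrix_mult_def transpose_def sum_distrib_left sum_distrib_right mult_ac)
    also have "\<dots> = (W ** (r x *\<^sub>R J \<mu> + r1 \<mu> *\<^sub>R K x))$\<alpha>$\<beta> + (\<Sum>\<tau>\<in>UNIV. W$\<alpha>$\<tau> * P \<tau>)"
      by (simp add: matrix_matrix_mult_def sum.distrib distrib_left)
    also have "W ** (r x *\<^sub>R J \<mu> + r1 \<mu> *\<^sub>R K x) = (s * r x) *\<^sub>R (eta ** (Ki ** J \<mu>)) + (s * r1 \<mu>) *\<^sub>R (eta ** (Ki ** K x))"
      unfolding W by (simp add: mm.add_right mm.scaleR_left mm.scaleR_right matrix_mul_assoc scaleR_right_distrib mult.commute)
    also have "(\<Sum>\<tau>\<in>UNIV. W$\<alpha>$\<tau> * P \<tau>) = (\<Sum>\<nu>\<in>UNIV. Z \<alpha> \<mu> \<nu> * E x$\<nu>$\<beta>)"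
      unfolding P_def Z_def sum_distrib_left sum_distrib_right by (subst sum.swap) (simp add: mult_ac)
    finally show ?thesis by (simp add: sr Ki')
  qed
  then have "spin_connection (metric \<kappa> h) \<mu> \<alpha> \<beta> x = (s * r1 \<mu>) * eta$\<alpha>$\<beta>
      + (eta ** (matrix_inv (R (mixed \<kappa> h x)) ** J \<mu>))$\<alpha>$\<beta>
      + (\<Sum>\<nu>\<in>UNIV. Z \<alpha> \<mu> \<nu> * tetrad (matrix_inv (metric \<kappa> h x))$\<nu>$\<beta>)" for \<mu> \<alpha> \<beta>
    using inv unfolding E_def K_def X_def by simp
  from that[OF KK[unfolded K_def X_def] Z this] show ?thesis .
qed

section \<open>Second-order expansion of the Dirac Lagrangian\<close>

lemma jet_eq: "jet F a b c \<Longrightarrow> a = a' \<Longrightarrow> b = b' \<Longrightarrow> c = c' \<Longrightarrow> jet F a' b' c'"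
  by simp

definition spin_bilinear :: "(spacetime \<Rightarrow> real^4^4) \<Rightarrow> (4 \<Rightarrow> complex^4^4) \<Rightarrow> (spacetime \<Rightarrow> complex^4) \<Rightarrow> spacetime \<Rightarrow> complex" where
  "spin_bilinear h \<gamma> \<psi> x = (\<Sum>\<mu>\<in>UNIV. \<Sum>\<alpha>\<in>UNIV. \<Sum>\<beta>\<in>UNIV.
     of_real ((h x ** eta ** pd \<mu> h x)$\<alpha>$\<beta>) * bilin \<gamma> (\<psi> x) (gamma3 \<gamma> \<mu> \<alpha> \<beta>))"

text \<open>The density is \<open>s\<^sup>2\<close> and the tetrad is \<open>K / s\<close>, so their
  product is \<open>s K\<close>, and jets are needed only for \<open>s\<close>, \<open>K\<close>,
  \<open>\<eta> K\<^sup>-\<^sup>1 J\<close> and the density. The 1/32 is the 1/16 of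
  \<open>Lcl_dirac_eq\<close> times 1/4, doubled since the expansion counts
  \<open>\<kappa>\<^sup>2 / 2\<close>.\<close>

lemma dirac_expansion:
  fixes h x \<psi>
  defines "H \<equiv> eta ** h x"
  assumes h: "deviation h" and \<gamma>: "dirac_matrices \<gamma>"
  shows "second_order_expansion (\<lambda>\<kappa>. Lcl_dirac \<gamma> m (metric \<kappa> h) \<psi> x) (Lcl0_dirac \<gamma> m \<psi> x)
    (\<i> * (\<Sum>\<mu>\<in>UNIV. \<Sum>\<alpha>\<in>UNIV. of_real
        ((- ((H ** H) /\<^sub>R 8) + (trace H / 8) *\<^sub>R H + ((trace H)\<^sup>2 / 32 - trace (H ** H) / 8) *\<^sub>R mat 1)$\<mu>$\<alpha>) * kin \<gamma> \<psi> x \<mu> \<alpha>)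
     - \<i>/32 * spin_bilinear h \<gamma> \<psi> x
     - of_real (m * ((trace H)\<^sup>2 / 4 - trace (H ** H) / 2)) * bilin \<gamma> (\<psi> x) (mat 1))"
proof -
  obtain \<epsilon> R where \<epsilon>: "\<epsilon> > 0" and R: "\<And>X :: real^4^4. norm X < \<epsilon> \<Longrightarrow> R X ** R X = mat 1 + X \<and> norm (R X - mat 1) < 1 \<and>
      R differentiable (at X) \<and> 0 < det (mat 1 + X) \<and>
      norm ((1 / sqrt (volume X)) *\<^sub>R R X - mat 1) < 1"
    using matrix_root_exists by blast
  have sym: "transpose (h y) = h y" for y
    using h by (simp add: deviation_def)
  define A where "A = (\<lambda>\<rho> \<alpha> \<beta>. bilin \<gamma> (\<psi> x) (gamma3 \<gamma> \<rho> \<alpha> \<beta>))"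
  have A_fold: "bilin \<gamma> (\<psi> x) (gamma3 \<gamma> \<rho> \<alpha> \<beta>) = A \<rho> \<alpha> \<beta>" for \<rho> \<alpha> \<beta>
    by (simp add: A_def)
  have A: "A \<rho> \<beta> \<alpha> = - A \<rho> \<alpha> \<beta>" "A \<beta> \<alpha> \<rho> = - A \<rho> \<alpha> \<beta>" for \<rho> \<alpha> \<beta>
    unfolding A_def gamma3_antisym(1)[OF \<gamma>, of \<rho> \<beta> \<alpha>] gamma3_antisym(2)[OF \<gamma>, of \<beta> \<alpha> \<rho>]
    by (simp_all add: linear_neg[OF linear_bilin])
  define K where "K = (\<lambda>k. R (k *\<^sub>R H))"
  define s where "s = (\<lambda>k. sqrt (volume (k *\<^sub>R H)))"
  define small where "small = (\<lambda>k. norm (k *\<^sub>R H) < \<epsilon>)"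
  have X: "mixed k h x = k *\<^sub>R H" for k by (simp add: mixed_def H_def)
  have ev: "\<forall>\<^sub>F k in at 0. small k"
    using eventually_mixed_small[OF \<epsilon>, of h x] by (simp add: X small_def)
  define d where "d = (\<lambda>\<mu>. eta ** pd \<mu> h x)"
  \<comment> \<open>The three witnesses are packed into a triple, so that a single choice turns them
    into functions of \<open>k\<close>.\<close>
  define Q where "Q = (\<lambda>k (J, l, Z). (\<forall>\<mu>. K k ** J \<mu> + J \<mu> ** K k = k *\<^sub>R d \<mu>) \<and> (\<forall>\<alpha> \<mu> \<nu>. Z \<alpha> \<mu> \<nu> = Z \<alpha> \<nu> \<mu>) \<and>
      (\<forall>\<mu> \<alpha> \<beta>. spin_connection (metric k h) \<mu> \<alpha> \<beta> x = l \<mu> * eta$\<alpha>$\<beta>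
      + (eta ** (matrix_inv (K k) ** J \<mu>))$\<alpha>$\<beta>
      + (\<Sum>\<nu>\<in>UNIV. Z \<alpha> \<mu> \<nu> * tetrad (matrix_inv (metric k h x))$\<nu>$\<beta>)))"
  have "\<exists>p. Q k p" if "small k" for k
  proof (rule spin_connection_eq[OF R h, where x = x and \<kappa> = k])
    show "norm (mixed k h x) < \<epsilon>" using that by (simp add: small_def X)
    fix J l Z
    assume "\<And>\<mu>. R (mixed k h x) ** J \<mu> + J \<mu> ** R (mixed k h x) = k *\<^sub>R (eta ** pd \<mu> h x)"
      "\<And>\<alpha> \<mu> \<nu>. Z \<alpha> \<mu> \<nu> = Z \<alpha> \<nu> \<mu>"
      "\<And>\<mu> \<alpha> \<beta>. spin_connection (metric k h) \<mu> \<alpha> \<beta> x = l \<mu> * eta$\<alpha>$\<beta>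
        + (eta ** (matrix_inv (R (mixed k h x)) ** J \<mu>))$\<alpha>$\<beta>
        + (\<Sum>\<nu>\<in>UNIV. Z \<alpha> \<mu> \<nu> * tetrad (matrix_inv (metric k h x))$\<nu>$\<beta>)"
    then show ?thesis
      unfolding Q_def K_def d_def X by (intro exI[of _ "(J, l, Z)"]) simp
  qed
  then obtain p where p: "Q k (p k)" if "small k" for k
    by metis
  define J l Z where "J = (\<lambda>k. fst (p k))" and "l = (\<lambda>k. fst (snd (p k)))" and "Z = (\<lambda>k. snd (snd (p k)))"
  have J: "K k ** J k \<mu> + J k \<mu> ** K k = k *\<^sub>R d \<mu>"
    and Z: "Z k \<alpha> \<mu> \<nu> = Z k \<alpha> \<nu> \<mu>"
    and sc: "spin_connection (metric k h) \<mu> \<alpha> \<beta> x = l k \<mu> * eta$\<alpha>$\<beta>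
      + (eta ** (matrix_inv (K k) ** J k \<mu>))$\<alpha>$\<beta>
      + (\<Sum>\<nu>\<in>UNIV. Z k \<alpha> \<mu> \<nu> * tetrad (matrix_inv (metric k h x))$\<nu>$\<beta>)" if "small k" for k \<alpha> \<beta> \<mu> \<nu>
    using p[OF that] unfolding Q_def J_def l_def Z_def split_beta by blast+
  \<comment> \<open>The relation \<open>K Y = J\<close>, read as \<open>Y = J - (K - 1) Y\<close>,
    will give the jet of \<open>Y\<close> without an expansion of the inverse matrix.\<close>
  define Y where "Y = (\<lambda>\<mu> k. matrix_inv (K k) ** J k \<mu>)"
  have Ksmall: "K k ** K k = mat 1 + k *\<^sub>R H" "norm (K k - mat 1) < 1" "0 < det (mat 1 + k *\<^sub>R H)"
    "norm ((1 / s k) *\<^sub>R K k - mat 1) < 1" if "small k" for k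
    using R[of "k *\<^sub>R H"] that by (simp_all add: small_def K_def s_def)
  have KY: "K k ** Y \<mu> k = J k \<mu>" if "small k" for k \<mu>
  proof -
    have "det (K k) * det (K k) > 0"
      using Ksmall[OF that] by (simp flip: det_mul)
    then have "det (K k) \<noteq> 0" by auto
    then obtain B where B: "K k ** B = mat 1"
      using invertible_det_nz[of "K k"] unfolding invertible_def by blast
    show ?thesis
      by (simp add: Y_def matrix_inv_eqI[OF B] matrix_mul_assoc B)
  qed
  have eq: "\<forall>\<^sub>F k in at 0. \<i>/2 * (\<Sum>\<mu>\<in>UNIV. \<Sum>\<alpha>\<in>UNIV. of_real ((s k *\<^sub>R K k)$\<mu>$\<alpha>) * kin \<gamma> \<psi> x \<mu> \<alpha>)
    + \<i>/16 * (\<Sum>\<mu>\<in>UNIV. \<Sum>\<rho>\<in>UNIV. \<Sum>\<alpha>\<in>UNIV. \<Sum>\<beta>\<in>UNIV.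
        of_real ((s k *\<^sub>R K k)$\<mu>$\<rho> * (eta ** Y \<mu> k)$\<alpha>$\<beta>) * A \<rho> \<alpha> \<beta>)
    - of_real (volume (k *\<^sub>R H)) * (of_real m * bilin \<gamma> (\<psi> x) (mat 1)) = Lcl_dirac \<gamma> m (metric k h) \<psi> x"
    using ev
  proof eventually_elim
    case (elim k)
    note K = Ksmall[OF elim]
    define E where "E = tetrad (matrix_inv (metric k h x))"
    have v: "0 < volume (k *\<^sub>R H)" "volume (k *\<^sub>R H) = s k * s k" "s k > 0"
      using K(3) by (simp_all add: volume_def s_def)
    have E: "E = (1 / s k) *\<^sub>R K k"
      unfolding E_def s_def X[symmetric]
      by (rule tetrad_eq) (use K sym in \<open>simp_all add: X s_def\<close>)
    have sE: "(s k *\<^sub>R K k)$\<mu>$\<nu> = s k * s k * E$\<mu>$\<nu>" for \<mu> \<nu>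
      using v by (simp add: E)
    have "sqrt (- det (metric k h x)) = s k * s k"
      using metric_eq(2)[of k h x] K(3) v by (simp add: X volume_def)
    then have "Lcl_dirac \<gamma> m (metric k h) \<psi> x = of_real (s k * s k) *
      (\<i>/2 * (\<Sum>\<mu>\<in>UNIV. \<Sum>\<alpha>\<in>UNIV. of_real (E$\<mu>$\<alpha>) * kin \<gamma> \<psi> x \<mu> \<alpha>)
      + \<i>/16 * (\<Sum>\<mu>\<in>UNIV. \<Sum>\<rho>\<in>UNIV. \<Sum>\<alpha>\<in>UNIV. \<Sum>\<beta>\<in>UNIV.
        of_real (E$\<mu>$\<rho> * (eta ** Y \<mu> k) $\<alpha>$\<beta>) * A \<rho> \<alpha> \<beta>)
      - of_real m * bilin \<gamma> (\<psi> x) (mat 1))"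
      unfolding Lcl_dirac_eq E_def[symmetric] A_fold
      by (subst spin_contraction[OF A sc[OF elim, folded E_def], OF Z[OF elim]]) (simp add: Y_def)
    then show ?case
      unfolding v(2) sE by (simp add: distrib_left right_diff_distrib sum_distrib_left mult_ac)
  qed
  have jK: "jet (\<lambda>k. K k - mat 1) 0 (H /\<^sub>R 2) (- ((H ** H) /\<^sub>R 8))"
    by (rule jet_root; use ev in eventually_elim; rule Ksmall; assumption)
  \<comment> \<open>Solving \<open>K J + J K = k d\<close> for \<open>J\<close> puts 1/2 in front of
    the left and of the right product, just enough for the joint norm bound in
    \<open>jet_fixed_point\<close>.\<close>
  have half: "bounded_bilinear (\<lambda>(A :: real^4^4) (B :: real^4^4). (A ** B) /\<^sub>R 2)"
    by (rule back_subst[of bounded_bilinear, OF mm.comp1[OF bounded_linear_scaleR_right[of "inverse 2"]]])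
      (simp add: fun_eq_iff mm.scaleR_left)
  have jJ: "jet (\<lambda>k. J k \<mu>) 0 (d \<mu> /\<^sub>R 2) (- ((H ** d \<mu> + d \<mu> ** H) /\<^sub>R 8))" for \<mu>
  proof -
    have "\<forall>\<^sub>F k in at 0. J k \<mu> = k *\<^sub>R (d \<mu> /\<^sub>R 2) - ((K k - mat 1) ** J k \<mu>) /\<^sub>R 2 - (J k \<mu> ** (K k - mat 1)) /\<^sub>R 2"
      using ev
    proof eventually_elim
      case (elim k)
      have "k *\<^sub>R (d \<mu> /\<^sub>R 2) = (K k ** J k \<mu> + J k \<mu> ** K k) /\<^sub>R 2"
        by (simp add: J[OF elim])
      then have "k *\<^sub>R (d \<mu> /\<^sub>R 2) - ((K k - mat 1) ** J k \<mu>) /\<^sub>R 2 - (J k \<mu> ** (K k - mat 1)) /\<^sub>R 2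
        = J k \<mu> /\<^sub>R 2 + J k \<mu> /\<^sub>R 2"
        unfolding mm.diff_left mm.diff_right scaleR_right_diff_distrib scaleR_right_distrib
        by simp
      also have "\<dots> = J k \<mu>"
        by (simp flip: scaleR_left_distrib)
      finally show ?case by (rule HOL.sym)
    qed
    from jet_fixed_point[OF half half _ jet_monom jK this] show ?thesis
    proof (rule jet_eq)
      show "norm ((a ** b) /\<^sub>R 2) + norm ((b ** a) /\<^sub>R 2) \<le> norm a * norm b" for a b :: "real^4^4"
        using norm_matrix_mult_le[of a b] norm_matrix_mult_le[of b a] by (simp add: mult.commute)
    qed (simp_all add: mm.scaleR_left mm.scaleR_right algebra_simps)
  qed
  have jY: "jet (Y \<mu>) 0 (d \<mu> /\<^sub>R 2) (- ((H ** d \<mu> + d \<mu> ** H) /\<^sub>R 8) - (H ** d \<mu>) /\<^sub>R 4)" for \<mu>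
  proof -
    have "\<forall>\<^sub>F k in at 0. Y \<mu> k = J k \<mu> - (K k - mat 1) ** Y \<mu> k - 0"
      using ev by eventually_elim (simp add: mm.diff_left KY)
    from jet_fixed_point[OF bounded_bilinear_matrix_mult bounded_bilinear_zero _ jJ jK this] show ?thesis
      by (rule jet_eq) (simp_all add: mm.scaleR_left mm.scaleR_right norm_matrix_mult_le)
  qed
  have jEY: "jet (\<lambda>k. eta ** Y \<mu> k) 0 (pd \<mu> h x /\<^sub>R 2)
      (- (3/8) *\<^sub>R (h x ** eta ** pd \<mu> h x) - (1/8) *\<^sub>R (pd \<mu> h x ** eta ** h x))" for \<mu>
  proof (rule jet_eq[OF jet_linear[OF mm.bounded_linear_right jY]])
    have e: "eta ** d \<mu> = pd \<mu> h x" "eta ** (H ** d \<mu>) = h x ** eta ** pd \<mu> h x"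
      "eta ** (d \<mu> ** H) = pd \<mu> h x ** eta ** h x"
      by (simp_all add: d_def H_def matrix_mul_assoc eta_eta)
    show "eta ** (d \<mu> /\<^sub>R 2) = pd \<mu> h x /\<^sub>R 2"
      by (simp add: mm.scaleR_right e)
    have "eta ** (- ((H ** d \<mu> + d \<mu> ** H) /\<^sub>R 8) - (H ** d \<mu>) /\<^sub>R 4)
      = - ((h x ** eta ** pd \<mu> h x + pd \<mu> h x ** eta ** h x) /\<^sub>R 8) - (h x ** eta ** pd \<mu> h x) /\<^sub>R 4"
      by (simp only: mm.diff_right mm.minus_right mm.scaleR_right mm.add_right e)
    also have "\<dots> = - (3/8) *\<^sub>R (h x ** eta ** pd \<mu> h x) - (1/8) *\<^sub>R (pd \<mu> h x ** eta ** h x)"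
      by (simp add: vec_eq_iff field_simps)
    finally show "eta ** (- ((H ** d \<mu> + d \<mu> ** H) /\<^sub>R 8) - (H ** d \<mu>) /\<^sub>R 4)
      = - (3/8) *\<^sub>R (h x ** eta ** pd \<mu> h x) - (1/8) *\<^sub>R (pd \<mu> h x ** eta ** h x)" .
  qed simp
  have js: "jet s 1 (trace H / 4) ((trace H)\<^sup>2 / 32 - trace (H ** H) / 8)"
    unfolding s_def
    by (rule jet_eq[OF jet_sqrt[OF jet_volume]]) (simp_all add: field_simps power2_eq_square)
  define B2 where "B2 = - ((H ** H) /\<^sub>R 8) + (trace H / 8) *\<^sub>R H + ((trace H)\<^sup>2 / 32 - trace (H ** H) / 8) *\<^sub>R mat 1"
  define B1 where "B1 = H /\<^sub>R 2 + (trace H / 4) *\<^sub>R mat 1"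
  have jsK: "jet (\<lambda>k. s k *\<^sub>R K k) (mat 1) B1 B2"
    using jet_add[OF jK jet_const[of "mat 1"]] unfolding B1_def B2_def
    by (intro jet_eq[OF jet_scaleR[OF js, of K "mat 1" "H /\<^sub>R 2" "- ((H ** H) /\<^sub>R 8)"]]) simp_all
  have pdsym: "pd \<mu> h x $ \<alpha> $ \<beta> = pd \<mu> h x $ \<beta> $ \<alpha>" for \<mu> \<alpha> \<beta>
  proof -
    have sm: "smooth h" using h by (simp add: deviation_def)
    have "(\<lambda>y. h y $ \<alpha> $ \<beta>) = (\<lambda>y. h y $ \<beta> $ \<alpha>)"
      by (rule ext, rule symmetric_nth[OF sym])
    then show ?thesis
      using pd_linear[OF bounded_linear_compose[OF bounded_linear_vec_nth bounded_linear_vec_nth] sm, of _ \<beta> \<alpha>]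
        pd_linear[OF bounded_linear_compose[OF bounded_linear_vec_nth bounded_linear_vec_nth] sm, of _ \<alpha> \<beta>]
      by simp
  qed
  define T where "T = (\<lambda>c :: 4 \<Rightarrow> 4 \<Rightarrow> 4 \<Rightarrow> 4 \<Rightarrow> real. \<Sum>\<mu>\<in>UNIV. \<Sum>\<rho>\<in>UNIV. \<Sum>\<alpha>\<in>UNIV. \<Sum>\<beta>\<in>UNIV.
    of_real (c \<mu> \<rho> \<alpha> \<beta>) * A \<rho> \<alpha> \<beta>)"
  have "jet (\<lambda>k. T (\<lambda>\<mu> \<rho> \<alpha> \<beta>. (s k *\<^sub>R K k)$\<mu>$\<rho> * (eta ** Y \<mu> k)$\<alpha>$\<beta>)) 0 0 (- (1/4) * spin_bilinear h \<gamma> \<psi> x)"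
  proof -
    define N where "N = (\<lambda>\<mu>. h x ** eta ** pd \<mu> h x)"
    have N_fold: "h x ** eta ** pd \<mu> h x = N \<mu>" for \<mu>
      by (simp add: N_def)
    have tr: "(pd \<mu> h x ** eta ** h x)$\<alpha>$\<beta> = N \<mu> $\<beta>$\<alpha>" for \<mu> \<alpha> \<beta>
    proof -
      have hs: "h x $ i $ j = h x $ j $ i" for i j
        by (rule symmetric_nth[OF sym])
      show ?thesis
        unfolding N_def eta_sandwich_nth
        by (rule sum.cong[OF refl]) (simp only: hs[of _ \<beta>] pdsym[of \<mu> _ \<alpha>] mult_ac)
    qed
    \<comment> \<open>A symmetric matrix against an antisymmetric bilinear. With a general
      \<open>c\<close> this covers the whole first order as well as the second-order cross term with
      \<open>B1\<close>.\<close>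
    have T1: "T (\<lambda>\<mu> \<rho> \<alpha> \<beta>. c \<mu> \<rho> * pd \<mu> h x $\<alpha>$\<beta>) = 0" for c
    proof -
      have "(\<Sum>\<alpha>\<in>UNIV. \<Sum>\<beta>\<in>UNIV. of_real (c \<mu> \<rho> * pd \<mu> h x $\<alpha>$\<beta>) * A \<rho> \<alpha> \<beta>) = 0" for \<mu> \<rho>
      proof (rule sum_antisym)
        fix \<alpha> \<beta>
        show "of_real (c \<mu> \<rho> * pd \<mu> h x $\<alpha>$\<beta>) * A \<rho> \<alpha> \<beta> = - (of_real (c \<mu> \<rho> * pd \<mu> h x $\<beta>$\<alpha>) * A \<rho> \<beta> \<alpha>)"
          using A(1)[where \<rho> = \<rho> and \<alpha> = \<beta> and \<beta> = \<alpha>] pdsym[of \<mu> \<alpha> \<beta>] by simp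
      qed
      then show ?thesis by (simp add: T_def)
    qed
    have "jet (\<lambda>k. T (\<lambda>\<mu> \<rho> \<alpha> \<beta>. (s k *\<^sub>R K k)$\<mu>$\<rho> * (eta ** Y \<mu> k)$\<alpha>$\<beta>))
      (T (\<lambda>\<mu> \<rho> \<alpha> \<beta>. 0)) (T (\<lambda>\<mu> \<rho> \<alpha> \<beta>. (mat 1 $\<mu>$\<rho> / 2) * pd \<mu> h x $\<alpha>$\<beta>))
      (T (\<lambda>\<mu> \<rho> \<alpha> \<beta>. mat 1 $\<mu>$\<rho> * (- (3/8) * N \<mu> $\<alpha>$\<beta> - (1/8) * N \<mu> $\<beta>$\<alpha>))
       + T (\<lambda>\<mu> \<rho> \<alpha> \<beta>. (B1 $\<mu>$\<rho> / 2) * pd \<mu> h x $\<alpha>$\<beta>))"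
      unfolding T_def sum.distrib[symmetric] distrib_right[symmetric] of_real_add[symmetric]
      by (intro jet_sum jet_mult_const_right jet_of_real,
          rule jet_eq[OF jet_mult[OF jet_nth[OF jsK] jet_nth[OF jEY]]])
        (simp_all add: tr, simp add: N_def)
    then have "jet (\<lambda>k. T (\<lambda>\<mu> \<rho> \<alpha> \<beta>. (s k *\<^sub>R K k)$\<mu>$\<rho> * (eta ** Y \<mu> k)$\<alpha>$\<beta>))
      0 0 (T (\<lambda>\<mu> \<rho> \<alpha> \<beta>. mat 1 $\<mu>$\<rho> * (- (3/8) * N \<mu> $\<alpha>$\<beta> - (1/8) * N \<mu> $\<beta>$\<alpha>)))"
      unfolding T1 by (simp add: T_def)
    moreover have "T (\<lambda>\<mu> \<rho> \<alpha> \<beta>. mat 1 $\<mu>$\<rho> * (- (3/8) * N \<mu> $\<alpha>$\<beta> - (1/8) * N \<mu> $\<beta>$\<alpha>)) = - (1/4) * spin_bilinear h \<gamma> \<psi> x"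
    proof -
      have "T (\<lambda>\<mu> \<rho> \<alpha> \<beta>. mat 1 $\<mu>$\<rho> * c \<mu> \<alpha> \<beta>) = (\<Sum>\<mu>\<in>UNIV. \<Sum>\<alpha>\<in>UNIV. \<Sum>\<beta>\<in>UNIV. of_real (c \<mu> \<alpha> \<beta>) * A \<mu> \<alpha> \<beta>)" for c
      proof -
        have "(\<Sum>\<alpha>\<in>UNIV. \<Sum>\<beta>\<in>UNIV. of_real (mat 1 $\<mu>$\<rho> * c \<mu> \<alpha> \<beta>) * A \<rho> \<alpha> \<beta>)
          = (if \<mu> = \<rho> then \<Sum>\<alpha>\<in>UNIV. \<Sum>\<beta>\<in>UNIV. of_real (c \<mu> \<alpha> \<beta>) * A \<mu> \<alpha> \<beta> else 0)" for \<mu> \<rho>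
          by (simp add: mat_nth)
        then show ?thesis by (simp add: T_def)
      qed
      \<comment> \<open>Since -3/8 + 1/4 = -1/8, adding a quarter of \<open>N\<close> leaves -1/8
        times the sum of \<open>N\<close> and its transpose, which is symmetric and drops
        out.\<close>
      then have "T (\<lambda>\<mu> \<rho> \<alpha> \<beta>. mat 1 $\<mu>$\<rho> * (- (3/8) * N \<mu> $\<alpha>$\<beta> - (1/8) * N \<mu> $\<beta>$\<alpha>)) - - (1/4) * spin_bilinear h \<gamma> \<psi> x
        = (\<Sum>\<mu>\<in>UNIV. \<Sum>\<alpha>\<in>UNIV. \<Sum>\<beta>\<in>UNIV. of_real (- (1/8) * (N \<mu> $\<alpha>$\<beta> + N \<mu> $\<beta>$\<alpha>)) * A \<mu> \<alpha> \<beta>)"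
        unfolding spin_bilinear_def N_fold A_fold
        by (simp only: sum_distrib_left sum_subtractf[symmetric]) (simp add: algebra_simps)
      also have "\<dots> = 0"
      proof (rule sum.neutral, rule ballI, rule sum_antisym)
        fix \<mu> \<alpha> \<beta>
        show "of_real (- (1/8) * (N \<mu> $\<alpha>$\<beta> + N \<mu> $\<beta>$\<alpha>)) * A \<mu> \<alpha> \<beta>
          = - (of_real (- (1/8) * (N \<mu> $\<beta>$\<alpha> + N \<mu> $\<alpha>$\<beta>)) * A \<mu> \<beta> \<alpha>)"
          using A(1)[where \<rho> = \<mu> and \<alpha> = \<beta> and \<beta> = \<alpha>] by (simp add: add.commute)
      qed
      finally show ?thesis by (simp only: right_minus_eq)
    qed
    ultimately show ?thesis by simp
  qed
  from jet_cong[OF eq jet_diff[OF jet_add[OF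
      jet_mult_const_left[OF jet_sum[OF jet_sum[OF jet_mult_const_right[OF jet_of_real[OF jet_nth[OF jsK]]]]]]
      jet_mult_const_left[OF this[unfolded T_def]]] jet_mult_const_right[OF jet_of_real[OF jet_volume]]]]
  have j: "jet (\<lambda>\<kappa>. Lcl_dirac \<gamma> m (metric \<kappa> h) \<psi> x)
    (\<i>/2 * (\<Sum>\<mu>\<in>UNIV. \<Sum>\<alpha>\<in>UNIV. of_real (mat 1 $\<mu>$\<alpha>) * kin \<gamma> \<psi> x \<mu> \<alpha>) + \<i>/16 * 0
      - of_real 1 * (of_real m * bilin \<gamma> (\<psi> x) (mat 1)))
    (\<i>/2 * (\<Sum>\<mu>\<in>UNIV. \<Sum>\<alpha>\<in>UNIV. of_real (B1 $\<mu>$\<alpha>) * kin \<gamma> \<psi> x \<mu> \<alpha>) + \<i>/16 * 0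
      - of_real (trace H / 2) * (of_real m * bilin \<gamma> (\<psi> x) (mat 1)))
    (\<i>/2 * (\<Sum>\<mu>\<in>UNIV. \<Sum>\<alpha>\<in>UNIV. of_real (B2 $\<mu>$\<alpha>) * kin \<gamma> \<psi> x \<mu> \<alpha>) + \<i>/16 * (- (1/4) * spin_bilinear h \<gamma> \<psi> x)
      - of_real ((trace H)\<^sup>2 / 8 - trace (H ** H) / 4) * (of_real m * bilin \<gamma> (\<psi> x) (mat 1)))" .
  have j0: "\<i>/2 * (\<Sum>\<mu>\<in>UNIV. \<Sum>\<alpha>\<in>UNIV. of_real (mat 1 $\<mu>$\<alpha>) * kin \<gamma> \<psi> x \<mu> \<alpha>) + \<i>/16 * 0
      - of_real 1 * (of_real m * bilin \<gamma> (\<psi> x) (mat 1)) = Lcl0_dirac \<gamma> m \<psi> x"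
    by (simp add: Lcl0_dirac_def kin_def bilin_def mat_nth if_distrib[of "\<lambda>z. of_real z * _"] cong: if_cong)
  show ?thesis
    unfolding B2_def[symmetric]
    by (rule jet_second_order_expansion[OF jet_eq[OF j j0 refl]])
      (simp add: scaleR_conv_of_real[where 'a = complex] algebra_simps)
qed

section \<open>Differential polynomials\<close>

definition pconst :: "complex \<Rightarrow> 'm diff_poly" where
  "pconst z = [(z, [])]"

definition pvar :: "4 list \<Rightarrow> 'm component \<Rightarrow> 'm diff_poly" where
  "pvar is X = [(1, [(is, X)])]"

text \<open>Factors are appended without reordering, because the spinor components do not commute
  under the Wick product.\<close>

definition pmult :: "'m diff_poly \<Rightarrow> 'm diff_poly \<Rightarrow> 'm diff_poly" (infixl "\<odot>" 70) where
  "P \<odot> Q = concat (map (\<lambda>(z, js). map (\<lambda>(w, ks). (z * w, js @ ks)) Q) P)"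

definition psum :: "(4 \<Rightarrow> 'm diff_poly) \<Rightarrow> 'm diff_poly" (binder "\<Squnion>" 10) where
  "psum f = f 1 @ f 2 @ f 3 @ f 4"

definition pdiff :: "'m diff_poly \<Rightarrow> 'm diff_poly \<Rightarrow> 'm diff_poly" (infixl "\<ominus>" 65) where
  "P \<ominus> Q = P @ (pconst (-1) \<odot> Q)"

text \<open>The ring may be noncommutative; only embedded constants are ever moved past other
  factors. This serves the Wick evaluation with \<open>wconst\<close> and the classical one with
  \<open>id\<close>.\<close>

lemma poly_eval_simps:
  assumes "\<And>z w. emb (z * w) = emb z * emb w" "\<And>z a. a * emb z = emb z * a" "emb 1 = 1" "emb (-1) = -1"
  shows "poly_eval emb val (pconst z) = emb z"
    "poly_eval emb val (pvar is X) = val (is, X)"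
    "poly_eval emb val (P @ Q) = poly_eval emb val P + poly_eval emb val Q"
    "poly_eval emb val (P \<odot> Q) = poly_eval emb val P * poly_eval emb val Q"
    "poly_eval emb val (psum f) = (\<Sum>\<mu>\<in>UNIV. poly_eval emb val (f \<mu>))"
    "poly_eval emb val (P \<ominus> Q) = poly_eval emb val P - poly_eval emb val Q"
proof -
  show c: "poly_eval emb val (pconst z) = emb z" for z
    by (simp add: poly_eval_def pconst_def)
  show "poly_eval emb val (pvar is X) = val (is, X)"
    by (simp add: poly_eval_def pvar_def assms)
  show a: "poly_eval emb val (P @ Q) = poly_eval emb val P + poly_eval emb val Q" for P Q
    by (simp add: poly_eval_def)
  have m1: "poly_eval emb val (map (\<lambda>(w, ks). (z * w, js @ ks)) Q) = emb z * prod_list (map val js) * poly_eval emb val Q" for z js Q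
  proof (induction Q)
    case (Cons q Q)
    have "emb z * emb w * (prod_list (map val js) * prod_list (map val ks))
      = emb z * prod_list (map val js) * (emb w * prod_list (map val ks))" for w ks
    proof -
      have "emb z * emb w * (prod_list (map val js) * prod_list (map val ks))
        = emb z * (emb w * prod_list (map val js)) * prod_list (map val ks)"
        by (simp only: mult.assoc)
      also have "emb w * prod_list (map val js) = prod_list (map val js) * emb w"
        by (rule assms(2)[symmetric])
      finally show ?thesis by (simp only: mult.assoc)
    qed
    with Cons show ?case
      by (cases q) (simp add: poly_eval_def assms(1) distrib_left)
  qed (simp add: poly_eval_def)
  show m: "poly_eval emb val (P \<odot> Q) = poly_eval emb val P * poly_eval emb val Q" for P Q
  proof (induction P)
    case (Cons p P)
    have "poly_eval emb val ((p # P) \<odot> Q) = poly_eval emb val (case p of (z, js) \<Rightarrow> map (\<lambda>(w, ks). (z * w, js @ ks)) Q) + poly_eval emb val (P \<odot> Q)"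
      by (simp add: pmult_def a)
    then show ?case
      by (cases p) (simp add: m1 Cons, simp add: poly_eval_def distrib_right)
  qed (simp add: pmult_def poly_eval_def)
  show "poly_eval emb val (psum f) = (\<Sum>\<mu>\<in>UNIV. poly_eval emb val (f \<mu>))"
    by (simp add: psum_def a sum_4 add_ac)
  show "poly_eval emb val (P \<ominus> Q) = poly_eval emb val P - poly_eval emb val Q"
    by (simp add: pdiff_def a m c assms(4))
qed

lemma wick_eval_simps:
  "wick_eval h M (pconst z) = wconst z"
  "wick_eval h M (pvar is (Grav \<mu> \<nu>)) = foldr wpd is (h \<mu> \<nu>)"
  "wick_eval h M (pvar is (Mat a)) = foldr wpd is (M a)"
  "wick_eval h M (P @ Q) = wick_eval h M P + wick_eval h M Q"
  "wick_eval h M (P \<odot> Q) = wick_eval h M P * wick_eval h M Q"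
  "wick_eval h M (psum f) = (\<Sum>\<mu>\<in>UNIV. wick_eval h M (f \<mu>))"
  "wick_eval h M (P \<ominus> Q) = wick_eval h M P - wick_eval h M Q"
proof -
  have "wconst (-1) = -1" by (simp add: wconst_minus)
  note * = poly_eval_simps[of wconst, OF wconst_mult wconst_mult_commute wconst_1 this]
  show "wick_eval h M (pconst z) = wconst z"
    "wick_eval h M (pvar is (Grav \<mu> \<nu>)) = foldr wpd is (h \<mu> \<nu>)"
    "wick_eval h M (pvar is (Mat a)) = foldr wpd is (M a)"
    "wick_eval h M (P @ Q) = wick_eval h M P + wick_eval h M Q"
    "wick_eval h M (P \<odot> Q) = wick_eval h M P * wick_eval h M Q"
    "wick_eval h M (psum f) = (\<Sum>\<mu>\<in>UNIV. wick_eval h M (f \<mu>))"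
    "wick_eval h M (P \<ominus> Q) = wick_eval h M P - wick_eval h M Q"
    by (simp_all add: wick_eval_def *)
qed

lemma classical_eval_simps:
  "classical_eval h M (pconst z) x = z"
  "classical_eval h M (pvar is (Grav \<mu> \<nu>)) x = foldr pd is (\<lambda>y. of_real (h y $\<mu>$\<nu>)) x"
  "classical_eval h M (pvar is (Mat a)) x = foldr pd is (M a) x"
  "classical_eval h M (P @ Q) x = classical_eval h M P x + classical_eval h M Q x"
  "classical_eval h M (P \<odot> Q) x = classical_eval h M P x * classical_eval h M Q x"
  "classical_eval h M (psum f) x = (\<Sum>\<mu>\<in>UNIV. classical_eval h M (f \<mu>) x)"
  "classical_eval h M (P \<ominus> Q) x = classical_eval h M P x - classical_eval h M Q x"
  by (simp_all add: classical_eval_def poly_eval_simps[of id] mult.commute)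

section \<open>Index contractions written as differential polynomials\<close>

abbreviation peta :: "4 \<Rightarrow> 4 \<Rightarrow> 'm diff_poly" where
  "peta \<mu> \<nu> \<equiv> pconst (of_real (eta$\<mu>$\<nu>))"

definition ph :: "4 \<Rightarrow> 4 \<Rightarrow> 'm diff_poly" where
  "ph \<mu> \<nu> = pvar [] (Grav \<mu> \<nu>)"

definition pup :: "4 \<Rightarrow> 'm component \<Rightarrow> 'm diff_poly" where
  "pup \<mu> X = (\<Squnion>\<nu>. peta \<mu> \<nu> \<odot> pvar [\<nu>] X)"

definition praise :: "(4 \<Rightarrow> 4 \<Rightarrow> 'm diff_poly) \<Rightarrow> 4 \<Rightarrow> 4 \<Rightarrow> 'm diff_poly" where
  "praise A \<mu> \<nu> = (\<Squnion>\<rho>. \<Squnion>\<sigma>. peta \<mu> \<rho> \<odot> peta \<nu> \<sigma> \<odot> A \<rho> \<sigma>)"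

definition ptr2 :: "(4 \<Rightarrow> 4 \<Rightarrow> 'm diff_poly) \<Rightarrow> (4 \<Rightarrow> 4 \<Rightarrow> 'm diff_poly) \<Rightarrow> 'm diff_poly" where
  "ptr2 A B = (\<Squnion>\<kappa>. \<Squnion>\<tau>. A \<kappa> \<tau> \<odot> praise B \<kappa> \<tau>)"

definition ptr1 :: "(4 \<Rightarrow> 4 \<Rightarrow> 'm diff_poly) \<Rightarrow> 'm diff_poly" where
  "ptr1 \<Theta> = (\<Squnion>\<mu>. \<Squnion>\<nu>. peta \<mu> \<nu> \<odot> \<Theta> \<mu> \<nu>)"

definition ptr3 :: "(4 \<Rightarrow> 4 \<Rightarrow> 'm diff_poly) \<Rightarrow> (4 \<Rightarrow> 4 \<Rightarrow> 'm diff_poly) \<Rightarrow> 'm diff_poly" where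
  "ptr3 A \<Theta> = (\<Squnion>\<mu>. \<Squnion>\<nu>. (\<Squnion>\<kappa>. \<Squnion>\<tau>. A \<mu> \<kappa> \<odot> peta \<kappa> \<tau> \<odot> A \<tau> \<nu>) \<odot> \<Theta> \<mu> \<nu>)"

definition pL2 :: "(4 \<Rightarrow> 4 \<Rightarrow> 'm diff_poly) \<Rightarrow> 'm diff_poly \<Rightarrow> 'm diff_poly" where
  "pL2 \<Theta> L20 = (pconst (1/4) \<odot> ptr2 ph ph \<odot> ptr1 \<Theta> \<ominus> ptr3 ph \<Theta>) @ L20"

text \<open>Classically this is the trace of \<open>eta ** h x\<close>, on the quantum graviton it
  is 0. As a factor it therefore marks corrections that are visible off shell only.\<close>

definition ptrace :: "'m diff_poly" where
  "ptrace = (\<Squnion>\<mu>. pconst (of_real (sg \<mu>)) \<odot> ph \<mu> \<mu>)"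

lemma wick_eval_traces:
  "wick_eval h M (ph \<mu> \<nu>) = h \<mu> \<nu>"
  "wick_eval h M (pup \<mu> (Mat a)) = wpd_up \<mu> (M a)"
  "wick_eval h M (pup \<mu> (Grav \<rho> \<sigma>)) = wpd_up \<mu> (h \<rho> \<sigma>)"
  "wick_eval h M (praise A \<mu> \<nu>) = raise_both (\<lambda>\<mu> \<nu>. wick_eval h M (A \<mu> \<nu>)) \<mu> \<nu>"
  "wick_eval h M (ptr2 A B) = tr2 (\<lambda>\<mu> \<nu>. wick_eval h M (A \<mu> \<nu>)) (\<lambda>\<mu> \<nu>. wick_eval h M (B \<mu> \<nu>))"
  "wick_eval h M (ptr1 \<Theta>) = tr1 (\<lambda>\<mu> \<nu>. wick_eval h M (\<Theta> \<mu> \<nu>))"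
  "wick_eval h M (ptr3 A \<Theta>) = tr3 (\<lambda>\<mu> \<nu>. wick_eval h M (A \<mu> \<nu>)) (\<lambda>\<mu> \<nu>. wick_eval h M (\<Theta> \<mu> \<nu>))"
  "wick_eval h M (pL2 \<Theta> L20) = L2 h (\<lambda>\<mu> \<nu>. wick_eval h M (\<Theta> \<mu> \<nu>)) (wick_eval h M L20)"
  "wick_eval h M ptrace = (\<Sum>\<mu>\<in>UNIV. wconst (of_real (sg \<mu>)) * h \<mu> \<mu>)"
  by (simp_all add: ph_def pup_def praise_def ptr2_def ptr1_def ptr3_def pL2_def ptrace_def wick_eval_simps
      wpd_up_def raise_both_def tr2_def tr1_def tr3_def L2_def)

lemma sum_eta_of_real: "(\<Sum>\<nu>\<in>UNIV. complex_of_real (eta$\<mu>$\<nu>) * f \<nu>) = of_real (sg \<mu>) * f \<mu>"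
  by (simp add: eta_nth if_distrib[of "\<lambda>z. complex_of_real z * _"] cong: if_cong)

lemma classical_eval_traces:
  "classical_eval h M (ph \<mu> \<nu>) x = of_real (h x $ \<mu> $ \<nu>)"
  "classical_eval h M (pup \<mu> X) x = of_real (sg \<mu>) * classical_eval h M (pvar [\<mu>] X) x"
  "classical_eval h M (praise A \<mu> \<nu>) x = of_real (sg \<mu>) * of_real (sg \<nu>) * classical_eval h M (A \<mu> \<nu>) x"
  "classical_eval h M (ptr2 A B) x = (\<Sum>\<kappa>\<in>UNIV. \<Sum>\<tau>\<in>UNIV. of_real (sg \<kappa>) * of_real (sg \<tau>) *
     classical_eval h M (A \<kappa> \<tau>) x * classical_eval h M (B \<kappa> \<tau>) x)"
  "classical_eval h M (ptr1 \<Theta>) x = (\<Sum>\<mu>\<in>UNIV. of_real (sg \<mu>) * classical_eval h M (\<Theta> \<mu> \<mu>) x)"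
  "classical_eval h M (ptr3 A \<Theta>) x = (\<Sum>\<mu>\<in>UNIV. \<Sum>\<nu>\<in>UNIV.
     (\<Sum>\<kappa>\<in>UNIV. of_real (sg \<kappa>) * classical_eval h M (A \<mu> \<kappa>) x * classical_eval h M (A \<kappa> \<nu>) x) *
     classical_eval h M (\<Theta> \<mu> \<nu>) x)"
  "classical_eval h M ptrace x = of_real (trace (eta ** h x))"
proof -
  show "classical_eval h M (praise A \<mu> \<nu>) x = of_real (sg \<mu>) * of_real (sg \<nu>) * classical_eval h M (A \<mu> \<nu>) x" for A \<mu> \<nu>
    by (simp add: praise_def classical_eval_simps mult.assoc sum_eta_of_real flip: sum_distrib_left)
  then show "classical_eval h M (ptr2 A B) x = (\<Sum>\<kappa>\<in>UNIV. \<Sum>\<tau>\<in>UNIV. of_real (sg \<kappa>) * of_real (sg \<tau>) *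
     classical_eval h M (A \<kappa> \<tau>) x * classical_eval h M (B \<kappa> \<tau>) x)"
    by (simp add: ptr2_def classical_eval_simps mult_ac)
  have "(\<Sum>\<kappa>\<in>UNIV. \<Sum>\<tau>\<in>UNIV. a \<kappa> * complex_of_real (eta$\<kappa>$\<tau>) * b \<tau>) = (\<Sum>\<kappa>\<in>UNIV. of_real (sg \<kappa>) * a \<kappa> * b \<kappa>)" for a b
    by (simp add: mult.assoc sum_eta_of_real mult.left_commute flip: sum_distrib_left)
  then show "classical_eval h M (ptr3 A \<Theta>) x = (\<Sum>\<mu>\<in>UNIV. \<Sum>\<nu>\<in>UNIV.
     (\<Sum>\<kappa>\<in>UNIV. of_real (sg \<kappa>) * classical_eval h M (A \<mu> \<kappa>) x * classical_eval h M (A \<kappa> \<nu>) x) *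
     classical_eval h M (\<Theta> \<mu> \<nu>) x)"
    by (simp add: ptr3_def classical_eval_simps)
qed (simp_all add: ph_def pup_def ptr1_def ptrace_def classical_eval_simps sum_eta_of_real eta_mult_nth)

lemma classical_ptr2_graviton:
  assumes "deviation h"
  shows "classical_eval h M (ptr2 ph ph) x = of_real (trace ((eta ** h x) ** (eta ** h x)))"
proof -
  have "h x $ i $ j = h x $ j $ i" for i j
    using assms by (intro symmetric_nth) (simp add: deviation_def)
  then show ?thesis
    by (simp add: classical_eval_traces matrix_matrix_mult_def[of "eta ** h x"] eta_mult_nth mult_ac)
qed

lemma eq_up_to_div_refl: "eq_up_to_div G W W"
proof -
  \<comment> \<open>The zero divergence is written with \<open>wconst 0\<close>, which is a Wick
    polynomial by the rule for constants.\<close>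
  have "wpd \<mu> (wconst 0) = 0" for \<mu>
    by (rule wick_eqI) (simp add: wpd_def pd_def)
  then show ?thesis
    unfolding eq_up_to_div_def by (intro exI[of _ "\<lambda>_. wconst 0"]) (simp add: wick_polynomials.const del: wconst_0)
qed

section \<open>The scalar field\<close>

definition pkinetic :: "real \<Rightarrow> unit diff_poly" where
  "pkinetic m = (\<Squnion>\<kappa>. pvar [\<kappa>] (Mat ()) \<odot> pup \<kappa> (Mat ())) \<ominus> pconst (of_real (m\<^sup>2)) \<odot> pvar [] (Mat ()) \<odot> pvar [] (Mat ())"

definition p\<Theta>_scalar :: "real \<Rightarrow> 4 \<Rightarrow> 4 \<Rightarrow> unit diff_poly" where
  "p\<Theta>_scalar m \<mu> \<nu> = pup \<mu> (Mat ()) \<odot> pup \<nu> (Mat ()) \<ominus> pconst (1/2) \<odot> peta \<mu> \<nu> \<odot> pkinetic m"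

text \<open>The last summand restores the squared trace that the density contributes to the mass
  term.\<close>

definition scalar_poly :: "real \<Rightarrow> unit diff_poly" where
  "scalar_poly m = pL2 (p\<Theta>_scalar m)
     (ptr3 ph (p\<Theta>_scalar m) @ pconst (1/2) \<odot> ptr2 ph ph \<odot> (pconst (1/2) \<odot> pkinetic m))
   @ ptrace \<odot> (pconst (of_real (- (m\<^sup>2 / 8))) \<odot> ptrace \<odot> pvar [] (Mat ()) \<odot> pvar [] (Mat ()))"

lemma wick_eval_scalar:
  assumes "(\<Sum>\<mu>\<in>UNIV. wconst (of_real (sg \<mu>)) * h \<mu> \<mu>) = 0"
  shows "wick_eval h (\<lambda>_. \<phi>) (scalar_poly m) = L2_scalar h m \<phi>"
proof -
  have "wick_eval h (\<lambda>_. \<phi>) (p\<Theta>_scalar m \<mu> \<nu>) = \<Theta>_scalar m \<phi> \<mu> \<nu>" for \<mu> \<nu>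
    by (simp add: p\<Theta>_scalar_def pkinetic_def wick_eval_simps wick_eval_traces \<Theta>_scalar_def)
  then show ?thesis
    by (simp add: scalar_poly_def wick_eval_simps wick_eval_traces assms pkinetic_def
        L2_scalar_def L20_scalar_def L0_scalar_def)
qed

lemma pd_of_real:
  assumes "smooth f"
  shows "pd \<mu> (\<lambda>y. complex_of_real (f y)) x = of_real (pd \<mu> f x)"
  by (rule pd_linear[OF bounded_linear_of_real assms])

lemma scalar_second_order_poly: "scalar_second_order m (scalar_poly m)"
  unfolding scalar_second_order_def
proof (intro allI impI)
  fix h :: "spacetime \<Rightarrow> real^4^4" and \<phi> :: "spacetime \<Rightarrow> real" and x
  assume "deviation h \<and> smooth \<phi>"
  then have h: "deviation h" and \<phi>: "smooth \<phi>" by auto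
  let ?c = "\<lambda>P. classical_eval h (\<lambda>(_ :: unit) y. of_real (\<phi> y)) P x"
  define t where "t = trace (eta ** h x)"
  define q where "q = trace ((eta ** h x) ** (eta ** h x))"
  define k where "k = (\<Sum>\<mu>\<in>UNIV. of_real (sg \<mu>) * (complex_of_real (pd \<mu> \<phi> x))\<^sup>2)"
  define f where "f = complex_of_real (\<phi> x)"
  have kin: "?c (pkinetic m) = k - of_real (m\<^sup>2) * f\<^sup>2"
    by (simp add: pkinetic_def classical_eval_simps classical_eval_traces pd_of_real[OF \<phi>] k_def f_def
        power2_eq_square mult_ac)
  have 1: "?c (ptr1 (p\<Theta>_scalar m)) = k - 2 * (k - of_real (m\<^sup>2) * f\<^sup>2)"
    unfolding p\<Theta>_scalar_def classical_eval_traces classical_eval_simps kin pd_of_real[OF \<phi>] foldr.simps comp_apply id_apply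
    by (simp add: eta_nth right_diff_distrib sum_subtractf sum_4) (simp add: k_def sum_4 power2_eq_square)
  have 2: "?c (ptr2 ph ph) = of_real q" "?c ptrace = of_real t"
    unfolding t_def q_def by (rule classical_ptr2_graviton[OF h], rule classical_eval_traces(7))
  have 3: "?c (pvar [] (Mat ())) = f"
    by (simp add: classical_eval_simps f_def)
  \<comment> \<open>The two \<open>tr3\<close> terms cancel. Of the rest, \<open>q / 4\<close> times
    the trace \<open>2 m\<^sup>2 f\<^sup>2 - k\<close> and \<open>q / 4\<close> times
    \<open>k - m\<^sup>2 f\<^sup>2\<close> add up to a pure mass term.\<close>
  have "?c (scalar_poly m) = of_real (- (m\<^sup>2) * (\<phi> x)\<^sup>2 * (t\<^sup>2 / 8 - q / 4))"
    unfolding scalar_poly_def pL2_def classical_eval_simps(1,4-7) kin 1 2 3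
    by (simp add: f_def field_simps power2_eq_square)
  note eq = this[unfolded t_def q_def]
  show "second_order_expansion (\<lambda>\<kappa>. of_real (Lcl_scalar m (metric \<kappa> h) \<phi> x)) (of_real (Lcl0_scalar m \<phi> x)) (?c (scalar_poly m))"
    unfolding eq by (rule scalar_expansion)
qed

section \<open>The Maxwell field\<close>

definition pF :: "4 \<Rightarrow> 4 \<Rightarrow> (4 \<times> 4) diff_poly" where
  "pF \<mu> \<nu> = pvar [] (Mat (\<mu>, \<nu>))"

definition p\<Theta>_maxwell :: "4 \<Rightarrow> 4 \<Rightarrow> (4 \<times> 4) diff_poly" where
  "p\<Theta>_maxwell \<mu> \<nu> = (pconst (1/4) \<odot> peta \<mu> \<nu> \<odot> (\<Squnion>\<kappa>. \<Squnion>\<tau>. praise pF \<kappa> \<tau> \<odot> pF \<kappa> \<tau>))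
     \<ominus> (\<Squnion>\<kappa>. \<Squnion>\<tau>. praise pF \<mu> \<kappa> \<odot> peta \<kappa> \<tau> \<odot> praise pF \<nu> \<tau>)"

definition pL0_maxwell :: "(4 \<times> 4) diff_poly" where
  "pL0_maxwell = pconst (- (1/4)) \<odot> (\<Squnion>\<mu>. \<Squnion>\<nu>. pF \<mu> \<nu> \<odot> praise pF \<mu> \<nu>)"

definition phhFF :: "(4 \<times> 4) diff_poly" where
  "phhFF = (\<Squnion>\<mu>. \<Squnion>\<nu>. \<Squnion>\<rho>. \<Squnion>\<sigma>. ph \<mu> \<nu> \<odot> ph \<rho> \<sigma> \<odot> praise pF \<mu> \<rho> \<odot> praise pF \<nu> \<sigma>)"

definition phFF :: "(4 \<times> 4) diff_poly" where
  "phFF = (\<Squnion>\<mu>. \<Squnion>\<nu>. \<Squnion>\<rho>. ph \<mu> \<nu> \<odot> praise pF \<mu> \<rho> \<odot> pconst (of_real (sg \<rho>)) \<odot> praise pF \<nu> \<rho>)"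

text \<open>The correction collects the trace terms of \<open>1 / volume\<close>: its first order
  multiplies \<open>phFF\<close>, its squared trace at second order multiplies the free
  Lagrangian.\<close>

definition maxwell_poly :: "(4 \<times> 4) diff_poly" where
  "maxwell_poly = pL2 p\<Theta>_maxwell
     ((ptr3 ph p\<Theta>_maxwell @ pconst (1/2) \<odot> ptr2 ph ph \<odot> pL0_maxwell) \<ominus> pconst (1/2) \<odot> phhFF)
   @ ptrace \<odot> ((pconst (1/2) \<odot> phFF) @ (pconst (1/4) \<odot> ptrace \<odot> pL0_maxwell))"

lemma wick_eval_maxwell:
  assumes "(\<Sum>\<mu>\<in>UNIV. wconst (of_real (sg \<mu>)) * h \<mu> \<mu>) = 0"
  shows "wick_eval h (\<lambda>(\<mu>, \<nu>). F \<mu> \<nu>) maxwell_poly = L2_maxwell h F"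
proof -
  have F: "wick_eval h (\<lambda>(\<mu>, \<nu>). F \<mu> \<nu>) (pF \<mu> \<nu>) = F \<mu> \<nu>" for \<mu> \<nu>
    by (simp add: pF_def wick_eval_simps)
  have "wick_eval h (\<lambda>(\<mu>, \<nu>). F \<mu> \<nu>) (p\<Theta>_maxwell \<mu> \<nu>) = \<Theta>_maxwell F \<mu> \<nu>" for \<mu> \<nu>
    by (simp add: p\<Theta>_maxwell_def wick_eval_simps wick_eval_traces F \<Theta>_maxwell_def)
  then show ?thesis
    by (simp add: maxwell_poly_def wick_eval_simps wick_eval_traces assms phhFF_def pL0_maxwell_def F
        L2_maxwell_def L20_maxwell_def L0_maxwell_def wconst_minus)
qed

lemma sum_eta_real: "(\<Sum>\<nu>\<in>UNIV. eta$\<mu>$\<nu> * f \<nu>) = sg \<mu> * f \<mu>"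
  by (simp add: eta_nth if_distrib[of "\<lambda>z. z * _"] cong: if_cong)

lemma maxwell_second_order_poly: "maxwell_second_order maxwell_poly"
  unfolding maxwell_second_order_def
proof (intro allI impI)
  fix h F :: "spacetime \<Rightarrow> real^4^4" and x
  assume "deviation h \<and> smooth F \<and> (\<forall>y. transpose (F y) = - F y)"
  then have h: "deviation h" and F: "transpose (F x) = - F x" by auto
  let ?c = "\<lambda>P. classical_eval h (\<lambda>(\<mu>, \<nu>) y. of_real (F y $\<mu>$\<nu>)) P x"
  define H where "H = eta ** h x"
  define t where "t = trace H"
  define q where "q = trace (H ** H)"
  define Fs where "Fs = (\<lambda>A B. (\<Sum>\<mu>\<in>UNIV. \<Sum>\<nu>\<in>UNIV. \<Sum>\<kappa>\<in>UNIV. \<Sum>\<tau>\<in>UNIV.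
     (A :: real^4^4)$\<mu>$\<nu> * (B :: real^4^4)$\<kappa>$\<tau> * (F x $\<mu>$\<kappa> * F x $\<nu>$\<tau>)))"
  have pF: "?c (pF \<mu> \<nu>) = of_real (F x $ \<mu> $ \<nu>)" for \<mu> \<nu>
    by (simp add: pF_def classical_eval_simps)
  have 2: "?c (ptr2 ph ph) = of_real q" "?c ptrace = of_real t"
    unfolding t_def q_def H_def by (rule classical_ptr2_graviton[OF h], rule classical_eval_traces(7))
  have FF: "Fs eta eta = (\<Sum>\<mu>\<in>UNIV. \<Sum>\<kappa>\<in>UNIV. sg \<mu> * (sg \<kappa> * (F x $\<mu>$\<kappa> * F x $\<mu>$\<kappa>)))"
    unfolding Fs_def by (simp add: mult.assoc sum_eta_real flip: sum_distrib_left)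
  \<comment> \<open>The Maxwell stress-energy tensor is traceless in four dimensions, where the 1/4
    is compensated by the trace of the identity.\<close>
  have 1: "?c (ptr1 p\<Theta>_maxwell) = 0"
    unfolding p\<Theta>_maxwell_def classical_eval_traces classical_eval_simps pF
    by (simp add: eta_nth right_diff_distrib sum_subtractf sum_4)
  have 3: "?c pL0_maxwell = of_real (- (1/4) * Fs eta eta)"
    unfolding pL0_maxwell_def classical_eval_traces classical_eval_simps pF FF by (simp add: mult_ac)
  have 4: "?c phhFF = of_real (Fs (H ** eta) (H ** eta))"
    unfolding phhFF_def classical_eval_traces classical_eval_simps pF Fs_def H_def eta_mult_nth
    by (simp add: mult_ac)
  have 5: "?c phFF = of_real (Fs (H ** eta) eta)"
    unfolding phFF_def classical_eval_traces classical_eval_simps pF Fs_def H_def eta_mult_nth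
    by (simp add: mult.assoc sum_eta_real mult.left_commute flip: sum_distrib_left)
  \<comment> \<open>Transposing both factors \<open>F\<close> changes no sign and exchanges the
    roles of the two arguments of \<open>Fs\<close>.\<close>
  have 6: "Fs eta (H ** eta) = Fs (H ** eta) eta"
  proof -
    have "F x $ i $ j = - F x $ j $ i" for i j
    proof -
      have "F x $ i $ j = transpose (F x) $ j $ i" by (simp add: transpose_def)
      then show ?thesis by (simp only: F vector_uminus_component)
    qed
    then have F2: "F x $ i $ j * F x $ k $ l = F x $ j $ i * F x $ l $ k" for i j k l
      by (metis minus_mult_minus)
    have "Fs eta (H ** eta) = (\<Sum>\<mu>\<in>UNIV. \<Sum>\<kappa>\<in>UNIV. \<Sum>\<nu>\<in>UNIV. \<Sum>\<tau>\<in>UNIV. eta$\<mu>$\<nu> * (H ** eta)$\<kappa>$\<tau> * (F x $\<mu>$\<kappa> * F x $\<nu>$\<tau>))"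
      unfolding Fs_def by (rule sum.cong[OF refl], rule sum.swap)
    also have "\<dots> = (\<Sum>\<kappa>\<in>UNIV. \<Sum>\<mu>\<in>UNIV. \<Sum>\<tau>\<in>UNIV. \<Sum>\<nu>\<in>UNIV. eta$\<mu>$\<nu> * (H ** eta)$\<kappa>$\<tau> * (F x $\<mu>$\<kappa> * F x $\<nu>$\<tau>))"
      by (subst sum.swap, rule sum.cong[OF refl], rule sum.cong[OF refl], rule sum.swap)
    also have "\<dots> = (\<Sum>\<kappa>\<in>UNIV. \<Sum>\<tau>\<in>UNIV. \<Sum>\<mu>\<in>UNIV. \<Sum>\<nu>\<in>UNIV. eta$\<mu>$\<nu> * (H ** eta)$\<kappa>$\<tau> * (F x $\<mu>$\<kappa> * F x $\<nu>$\<tau>))"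
      by (rule sum.cong[OF refl], rule sum.swap)
    also have "\<dots> = Fs (H ** eta) eta"
      unfolding Fs_def by (intro sum.cong refl) (subst F2, simp)
    finally show ?thesis .
  qed
  have "?c maxwell_poly = of_real (- 1/2 * (Fs (H ** eta) (H ** eta) - t / 2 * (Fs eta (H ** eta) + Fs (H ** eta) eta)
        + (t\<^sup>2 / 8 + q / 4) * Fs eta eta))"
    unfolding maxwell_poly_def pL2_def classical_eval_simps(1,4-7) 1 2 3 4 5 6
    by (simp add: field_simps power2_eq_square)
  note eq = this[unfolded t_def q_def Fs_def H_def]
  show "second_order_expansion (\<lambda>\<kappa>. of_real (Lcl_maxwell (metric \<kappa> h) F x)) (of_real (Lcl0_maxwell F x)) (?c maxwell_poly)"
    unfolding eq by (rule maxwell_expansion)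
qed

section \<open>The Dirac field\<close>

definition psand :: "(4 \<Rightarrow> dirac_component diff_poly) \<Rightarrow> complex^4^4 \<Rightarrow> (4 \<Rightarrow> dirac_component diff_poly) \<Rightarrow> dirac_component diff_poly" where
  "psand A M B = (\<Squnion>a. \<Squnion>b. A a \<odot> pconst (M$a$b) \<odot> B b)"

definition p\<psi> :: "4 \<Rightarrow> dirac_component diff_poly" where
  "p\<psi> a = pvar [] (Mat (Psi a))"

definition p\<psi>b :: "4 \<Rightarrow> dirac_component diff_poly" where
  "p\<psi>b a = pvar [] (Mat (PsiBar a))"

definition p\<Theta>_dirac :: "(4 \<Rightarrow> complex^4^4) \<Rightarrow> 4 \<Rightarrow> 4 \<Rightarrow> dirac_component diff_poly" where
  "p\<Theta>_dirac \<gamma> \<mu> \<nu> = pconst (\<i>/4) \<odot>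
     (((psand p\<psi>b (\<gamma> \<mu>) (\<lambda>a. pup \<nu> (Mat (Psi a))) \<ominus> psand (\<lambda>a. pup \<nu> (Mat (PsiBar a))) (\<gamma> \<mu>) p\<psi>)
      @ psand p\<psi>b (\<gamma> \<nu>) (\<lambda>a. pup \<mu> (Mat (Psi a)))) \<ominus> psand (\<lambda>a. pup \<mu> (Mat (PsiBar a))) (\<gamma> \<nu>) p\<psi>)"

definition ph_dh :: "4 \<Rightarrow> 4 \<Rightarrow> 4 \<Rightarrow> dirac_component diff_poly" where
  "ph_dh \<mu> \<rho> \<sigma> = (\<Squnion>\<tau>. praise ph \<rho> \<tau> \<odot> (pconst (of_real (sg \<sigma>)) \<odot> pup \<mu> (Grav \<tau> \<sigma>)))"

definition pspin :: "(4 \<Rightarrow> complex^4^4) \<Rightarrow> dirac_component diff_poly" where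
  "pspin \<gamma> = (\<Squnion>\<mu>. \<Squnion>\<rho>. \<Squnion>\<sigma>. ph_dh \<mu> \<rho> \<sigma> \<odot> psand p\<psi>b
     (gamma_low \<gamma> \<mu> ** gamma_low \<gamma> \<rho> ** gamma_low \<gamma> \<sigma> - gamma_low \<gamma> \<sigma> ** gamma_low \<gamma> \<rho> ** gamma_low \<gamma> \<mu>) p\<psi>)"

definition pkin :: "(4 \<Rightarrow> complex^4^4) \<Rightarrow> 4 \<Rightarrow> 4 \<Rightarrow> dirac_component diff_poly" where
  "pkin \<gamma> \<mu> \<alpha> = psand p\<psi>b (\<gamma> \<alpha>) (\<lambda>a. pvar [\<mu>] (Mat (Psi a))) \<ominus> psand (\<lambda>a. pvar [\<mu>] (Mat (PsiBar a))) (\<gamma> \<alpha>) p\<psi>"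

definition pmass :: "dirac_component diff_poly" where
  "pmass = psand p\<psi>b (mat 1) p\<psi>"

text \<open>The correction with the factor \<open>1/2\<close> vanishes on the quantum fields by the Dirac equation, the one
  with the factor \<open>ptrace\<close> because \<open>h\<close> is traceless.\<close>

definition dirac_poly :: "(4 \<Rightarrow> complex^4^4) \<Rightarrow> real \<Rightarrow> dirac_component diff_poly" where
  "dirac_poly \<gamma> m = (pL2 (p\<Theta>_dirac \<gamma>)
       (pconst (3/4) \<odot> ptr3 ph (p\<Theta>_dirac \<gamma>) \<ominus> pconst (1/8 * (\<i>/2)) \<odot> pspin \<gamma>)
     \<ominus> pconst (1/2) \<odot> ptr2 ph ph \<odot> (ptr1 (p\<Theta>_dirac \<gamma>) \<ominus> pconst (of_real m) \<odot> pmass))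
   @ ptrace \<odot> (((\<Squnion>\<mu>. \<Squnion>\<alpha>. pconst (\<i>/8 * of_real (sg \<mu>)) \<odot> ph \<mu> \<alpha> \<odot> pkin \<gamma> \<mu> \<alpha>)
       @ (\<Squnion>\<mu>. pconst (\<i>/32) \<odot> ptrace \<odot> pkin \<gamma> \<mu> \<mu>))
       \<ominus> pconst (of_real (m/4)) \<odot> ptrace \<odot> pmass)"

text \<open>Tracks the matter factors of each monomial in their order, ignoring gravitons and
  derivatives. Being compositional, it checks \<open>dirac_ordered\<close> along the structure of
  \<open>dirac_poly\<close>.\<close>

definition words :: "dirac_component diff_poly \<Rightarrow> dirac_component list set \<Rightarrow> bool" where
  "words P W \<longleftrightarrow> (\<forall>(z, js) \<in> set P. [X. (is, Mat X) \<leftarrow> js] \<in> W)"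

lemma words_append: "words P W \<Longrightarrow> words Q W \<Longrightarrow> words (P @ Q) W"
  by (auto simp: words_def)

lemma words_pmult:
  assumes "words P U" "words Q V" "\<And>u v. u \<in> U \<Longrightarrow> v \<in> V \<Longrightarrow> u @ v \<in> W"
  shows "words (P \<odot> Q) W"
  using assms unfolding words_def pmult_def by fastforce

lemma words_pconst: "words (pconst z) {[]}"
  by (simp add: words_def pconst_def)

lemma words_psum: "(\<And>\<mu>. words (f \<mu>) W) \<Longrightarrow> words (psum f) W"
  unfolding psum_def by (intro words_append)

lemma words_scale: "words P {[]} \<Longrightarrow> words Q W \<Longrightarrow> words (P \<odot> Q) W"
  by (erule words_pmult) auto

lemma words_pdiff: "words P W \<Longrightarrow> words Q W \<Longrightarrow> words (P \<ominus> Q) W"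
  unfolding pdiff_def by (intro words_append words_scale words_pconst)

lemma words_grav: "words (pvar is (Grav \<mu> \<nu>)) {[]}"
  by (simp add: words_def pvar_def)

lemma words_mat: "words (pvar is (Mat X)) {[X]}"
  by (simp add: words_def pvar_def)

lemma words_pup: "words (pup \<mu> (Mat X)) {[X]}" "words (pup \<mu> (Grav \<rho> \<sigma>)) {[]}"
  unfolding pup_def by (intro words_psum words_scale words_pconst words_mat words_grav)+

lemma words_ph: "words (ph \<mu> \<nu>) {[]}"
  unfolding ph_def by (rule words_grav)

lemma words_praise: "(\<And>\<mu> \<nu>. words (A \<mu> \<nu>) W) \<Longrightarrow> words (praise A \<mu> \<nu>) W"
  unfolding praise_def by (intro words_psum words_scale words_pconst)

lemma words_traces:
  "words ptrace {[]}" "words (ptr2 ph ph) {[]}"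
  "(\<And>\<mu> \<nu>. words (\<Theta> \<mu> \<nu>) W) \<Longrightarrow> words (ptr1 \<Theta>) W" "(\<And>\<mu> \<nu>. words (\<Theta> \<mu> \<nu>) W) \<Longrightarrow> words (ptr3 ph \<Theta>) W"
  "(\<And>\<mu> \<nu>. words (\<Theta> \<mu> \<nu>) W) \<Longrightarrow> words L20 W \<Longrightarrow> words (pL2 \<Theta> L20) W"
  unfolding ptrace_def ptr2_def ptr1_def ptr3_def pL2_def
  by (intro words_psum words_scale words_pconst words_ph words_praise words_pdiff words_append; assumption)+

lemma words_psand:
  assumes "\<And>a. words (A a) {[PsiBar a]}" "\<And>b. words (B b) {[Psi b]}"
  shows "words (psand A M B) {[PsiBar a, Psi b] |a b. True}"
proof -
  have "words (A a \<odot> pconst (M$a$b)) {[PsiBar a]}" for a b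
    by (rule words_pmult[OF assms(1) words_pconst]) simp
  from words_pmult[OF this assms(2)]
  have "words (A a \<odot> pconst (M$a$b) \<odot> B b) {[PsiBar a, Psi b] |a b. True}" for a b
    by auto
  then show ?thesis
    unfolding psand_def by (intro words_psum)
qed

lemma dirac_ordered_poly: "dirac_ordered (dirac_poly \<gamma> m)"
proof -
  have p: "words (p\<psi> a) {[Psi a]}" "words (p\<psi>b a) {[PsiBar a]}" for a
    unfolding p\<psi>_def p\<psi>b_def by (rule words_mat)+
  have "words (dirac_poly \<gamma> m) {[PsiBar a, Psi b] |a b. True}"
    unfolding dirac_poly_def p\<Theta>_dirac_def pspin_def ph_dh_def pkin_def pmass_def
    by (intro words_psum words_pdiff words_append words_traces words_scale words_psand words_praise words_pconst
        words_ph words_pup words_mat p)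
  then show ?thesis
    unfolding words_def dirac_ordered_def by fast
qed

section \<open>Evaluation on the quantum Dirac field\<close>

lemma wpd_up_graviton:
  "wpd_up \<mu> (\<Sum>\<nu>\<in>UNIV. weta \<sigma> \<nu> * graviton_field c eps \<tau> \<nu>)
    = wconst (of_real (sg \<sigma>)) * wpd_up \<mu> (graviton_field c eps \<tau> \<sigma>)"
proof -
  have "wconst z * (wconst w * W) = wconst w * (wconst z * W)" for z w W
    by (simp only: mult.assoc[symmetric] wconst_mult[symmetric] mult.commute[of z w])
  then show ?thesis
    unfolding wpd_up_def sum_weta wpd_wconst_mult_graviton .
qed

text \<open>On the diagonal the symmetrized halves of the tensor coincide. The Dirac equation for
  the field and the one for its conjugate then contribute half of the mass term each, with the
  conjugate field staying on the left.\<close>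

lemma tr1_dirac:
  assumes "dirac_spinors \<gamma> m u v" "dirac_matrices \<gamma>"
  defines "\<psi> \<equiv> dirac_field m u v"
  shows "tr1 (\<Theta>_dirac \<gamma> \<psi>) = wconst (of_real m) * sandwich (dirac_conjugate \<gamma> \<psi>) (mat 1) \<psi>"
proof -
  define \<psi>b where "\<psi>b = dirac_conjugate \<gamma> \<psi>"
  define D where "D = (\<Sum>\<mu>\<in>UNIV. sandwich \<psi>b (\<gamma> \<mu>) (\<lambda>a. wpd \<mu> (\<psi> a)))"
  define Db where "Db = (\<Sum>\<mu>\<in>UNIV. sandwich (\<lambda>a. wpd \<mu> (\<psi>b a)) (\<gamma> \<mu>) \<psi>)"
  have c: "W * (wconst z * V) = wconst z * (W * V)" for W V z
    by (metis mult.assoc wconst_mult_commute)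
  have d1: "wconst z * (W * wconst w * V) = W * (wconst (z * w) * V)"
    and d2: "wconst z * (W * wconst w * V) = wconst (z * w) * W * V" for W V z w
    unfolding c[of W "z * w" V] by (simp_all only: wconst_mult_commute[of W] wconst_mult mult.assoc)
  have s1: "sandwich A M (\<lambda>a. wconst z * B a) = wconst z * sandwich A M B" for A M B z
    unfolding sandwich_def sum_distrib_left
    by (intro sum.cong refl) (simp only: c)
  have s2: "sandwich (\<lambda>a. wconst z * A a) M B = wconst z * sandwich A M B" for A M B z
    unfolding sandwich_def sum_distrib_left
    by (intro sum.cong refl) (simp only: mult.assoc)
  have up: "wpd_up \<mu> W = wconst (of_real (sg \<mu>)) * wpd \<mu> W" for \<mu> W
    by (simp add: wpd_up_def sum_weta)
  have "tr1 (\<Theta>_dirac \<gamma> \<psi>) = (\<Sum>\<mu>\<in>UNIV. wconst (of_real (sg \<mu>)) * \<Theta>_dirac \<gamma> \<psi> \<mu> \<mu>)"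
    by (simp add: tr1_def sum_weta)
  also have "\<dots> = (\<Sum>\<mu>\<in>UNIV. wconst (\<i>/2) * (sandwich \<psi>b (\<gamma> \<mu>) (\<lambda>a. wpd \<mu> (\<psi> a)) - sandwich (\<lambda>a. wpd \<mu> (\<psi>b a)) (\<gamma> \<mu>) \<psi>))"
  proof (rule sum.cong[OF refl])
    fix \<mu>
    define X where "X = sandwich \<psi>b (\<gamma> \<mu>) (\<lambda>a. wpd \<mu> (\<psi> a)) - sandwich (\<lambda>a. wpd \<mu> (\<psi>b a)) (\<gamma> \<mu>) \<psi>"
    have "\<Theta>_dirac \<gamma> \<psi> \<mu> \<mu> = wconst (\<i>/4) * (wconst (of_real (sg \<mu>)) * X + wconst (of_real (sg \<mu>)) * X)"
      unfolding \<Theta>_dirac_def Let_def \<psi>b_def[symmetric] up s1 s2 X_def by (simp add: algebra_simps)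
    also have "\<dots> = wconst (\<i>/4 * of_real (sg \<mu>) + \<i>/4 * of_real (sg \<mu>)) * X"
      by (simp only: wconst_add wconst_mult distrib_left distrib_right mult.assoc)
    finally have "wconst (of_real (sg \<mu>)) * \<Theta>_dirac \<gamma> \<psi> \<mu> \<mu> = wconst (of_real (sg \<mu>) * (\<i>/4 * of_real (sg \<mu>) + \<i>/4 * of_real (sg \<mu>))) * X"
      by (simp only: wconst_mult mult.assoc)
    also have "of_real (sg \<mu>) * (\<i>/4 * of_real (sg \<mu>) + \<i>/4 * of_real (sg \<mu>)) = \<i>/2"
      by (simp add: sg_def)
    finally show "wconst (of_real (sg \<mu>)) * \<Theta>_dirac \<gamma> \<psi> \<mu> \<mu> = wconst (\<i>/2) * X" .
  qed
  also have "\<dots> = wconst (1/2) * (wconst \<i> * D - wconst \<i> * Db)"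
  proof -
    have "wconst (\<i>/2) * W = wconst (1/2) * (wconst \<i> * W)" for W
      by (simp flip: mult.assoc wconst_mult)
    then show ?thesis
      unfolding D_def Db_def by (simp only: right_diff_distrib sum_subtractf sum_distrib_left)
  qed
  also have "wconst \<i> * D = wconst (of_real m) * sandwich \<psi>b (mat 1) \<psi>"
  proof -
    have "wconst \<i> * D = (\<Sum>\<mu>\<in>UNIV. \<Sum>a\<in>UNIV. \<psi>b a * (\<Sum>b\<in>UNIV. wconst (\<i> * \<gamma> \<mu> $ a $ b) * wpd \<mu> (\<psi> b)))"
      unfolding D_def sandwich_def sum_distrib_left by (simp only: d1)
    also have "\<dots> = (\<Sum>a\<in>UNIV. \<psi>b a * (\<Sum>\<mu>\<in>UNIV. \<Sum>b\<in>UNIV. wconst (\<i> * \<gamma> \<mu> $ a $ b) * wpd \<mu> (\<psi> b)))"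
      by (subst sum.swap) (simp add: sum_distrib_left)
    also have "\<dots> = (\<Sum>a\<in>UNIV. wconst (of_real m) * (\<psi>b a * \<psi> a))"
      unfolding \<psi>_def dirac_equation[OF assms(1)] by (simp only: c)
    also have "\<dots> = wconst (of_real m) * sandwich \<psi>b (mat 1) \<psi>"
      by (simp add: sandwich_def sum_distrib_left mat_nth if_distrib[of wconst] if_distrib[of "\<lambda>z. _ * z"]
          if_distrib[of "\<lambda>z. z * _"] cong: if_cong)
    finally show ?thesis .
  qed
  also have "wconst \<i> * Db = - (wconst (of_real m) * sandwich \<psi>b (mat 1) \<psi>)"
  proof -
    have "wconst \<i> * Db = (\<Sum>\<mu>\<in>UNIV. \<Sum>b\<in>UNIV. (\<Sum>a\<in>UNIV. wconst (\<i> * \<gamma> \<mu> $ a $ b) * wpd \<mu> (\<psi>b a)) * \<psi> b)"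
      unfolding Db_def sandwich_def sum_distrib_left sum_distrib_right
      by (rule sum.cong[OF refl], subst sum.swap) (simp only: d2)
    also have "\<dots> = (\<Sum>b\<in>UNIV. (\<Sum>\<mu>\<in>UNIV. \<Sum>a\<in>UNIV. wconst (\<i> * \<gamma> \<mu> $ a $ b) * wpd \<mu> (\<psi>b a)) * \<psi> b)"
      by (subst sum.swap) (simp add: sum_distrib_right)
    also have "\<dots> = (\<Sum>b\<in>UNIV. - (wconst (of_real m) * (\<psi>b b * \<psi> b)))"
      unfolding \<psi>b_def \<psi>_def dirac_equation_conjugate[OF assms(1,2)] by (simp add: mult.assoc)
    also have "\<dots> = - (wconst (of_real m) * sandwich \<psi>b (mat 1) \<psi>)"
      by (simp add: sandwich_def sum_distrib_left sum_negf mat_nth if_distrib[of wconst] if_distrib[of "\<lambda>z. _ * z"]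
          if_distrib[of "\<lambda>z. z * _"] cong: if_cong)
    finally show ?thesis .
  qed
  also have "wconst (1/2) * (X - - X) = X" for X
  proof -
    have "wconst (1/2) * (X - - X) = wconst (1/2 + 1/2) * X"
      unfolding wconst_add by (simp add: distrib_left distrib_right)
    then show ?thesis by simp
  qed
  finally show ?thesis
    by (simp add: \<psi>b_def)
qed

lemma wick_eval_dirac:
  fixes c eps u v
  assumes "helicity_vectors eps" "dirac_matrices \<gamma>" "dirac_spinors \<gamma> m u v"
  defines "h \<equiv> graviton_field c eps" and "\<psi> \<equiv> dirac_field m u v" and "\<psi>b \<equiv> dirac_conjugate \<gamma> (dirac_field m u v)"
  shows "wick_eval h (\<lambda>X. case X of Psi a \<Rightarrow> \<psi> a | PsiBar a \<Rightarrow> \<psi>b a) (dirac_poly \<gamma> m) = L2_dirac h \<gamma> \<psi>"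
proof -
  let ?w = "wick_eval h (\<lambda>X. case X of Psi a \<Rightarrow> \<psi> a | PsiBar a \<Rightarrow> \<psi>b a)"
  have \<psi>b: "\<psi>b = dirac_conjugate \<gamma> \<psi>" by (simp add: \<psi>b_def \<psi>_def)
  have s: "?w (psand A M B) = sandwich (\<lambda>a. ?w (A a)) M (\<lambda>a. ?w (B a))" for A M B
    by (simp add: psand_def sandwich_def wick_eval_simps)
  have p: "?w (p\<psi> a) = \<psi> a" "?w (p\<psi>b a) = \<psi>b a" for a
    by (simp_all add: p\<psi>_def p\<psi>b_def wick_eval_simps)
  have \<Theta>: "?w (p\<Theta>_dirac \<gamma> \<mu> \<nu>) = \<Theta>_dirac \<gamma> \<psi> \<mu> \<nu>" for \<mu> \<nu>
    by (simp add: p\<Theta>_dirac_def \<Theta>_dirac_def wick_eval_simps s p wick_eval_traces Let_def flip: \<psi>b)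
  have "?w (ph_dh \<mu> \<rho> \<sigma>) = h_dh h \<mu> \<rho> \<sigma>" for \<mu> \<rho> \<sigma>
    by (simp add: ph_dh_def h_dh_def wick_eval_simps wick_eval_traces h_def wpd_up_graviton)
  then have sp: "?w (pspin \<gamma>) = (\<Sum>\<mu>\<in>UNIV. \<Sum>\<rho>\<in>UNIV. \<Sum>\<sigma>\<in>UNIV. h_dh h \<mu> \<rho> \<sigma> * sandwich \<psi>b
     (gamma_low \<gamma> \<mu> ** gamma_low \<gamma> \<rho> ** gamma_low \<gamma> \<sigma> - gamma_low \<gamma> \<sigma> ** gamma_low \<gamma> \<rho> ** gamma_low \<gamma> \<mu>) \<psi>)"
    by (simp add: pspin_def wick_eval_simps s p)
  have mass: "?w pmass = sandwich \<psi>b (mat 1) \<psi>"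
    by (simp add: pmass_def s p)
  have tr: "?w (ptr1 (p\<Theta>_dirac \<gamma>)) = wconst (of_real m) * sandwich \<psi>b (mat 1) \<psi>"
    using tr1_dirac[OF assms(3,2)] by (simp add: wick_eval_traces \<Theta> \<psi>b \<psi>_def)
  have t0: "?w ptrace = 0"
    using graviton_traceless[OF assms(1)] by (simp add: wick_eval_traces h_def)
  show ?thesis
    by (simp add: dirac_poly_def wick_eval_simps tr mass t0)
      (simp add: wick_eval_traces wick_eval_simps \<Theta> sp L2_dirac_def L20_dirac_def flip: \<psi>b)
qed

lemma dirac_second_order_poly:
  assumes \<gamma>: "dirac_matrices \<gamma>"
  shows "dirac_second_order \<gamma> m (dirac_poly \<gamma> m)"
  unfolding dirac_second_order_def
proof (intro conjI allI impI dirac_ordered_poly)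
  fix h :: "spacetime \<Rightarrow> real^4^4" and \<psi> :: "spacetime \<Rightarrow> complex^4" and x
  assume "deviation h \<and> smooth \<psi>"
  then have h: "deviation h" and \<psi>: "smooth \<psi>" by auto
  let ?c = "\<lambda>P. classical_eval h (\<lambda>X y. case X of Psi a \<Rightarrow> \<psi> y $ a | PsiBar a \<Rightarrow> bar \<gamma> (\<psi> y) $ a) P x"
  define H where "H = eta ** h x"
  define t where "t = trace H"
  define q where "q = trace (H ** H)"
  have sm: "smooth h" using h by (simp add: deviation_def)
  have bl: "bounded_linear (bar \<gamma>)"
    by (intro linear_conv_bounded_linear[THEN iffD1] linearI)
      (simp_all add: bar_def vec_eq_iff vector_matrix_mult_def algebra_simps sum.distrib scaleR_sum_right)
  have p: "?c (p\<psi> a) = \<psi> x $ a" "?c (p\<psi>b a) = bar \<gamma> (\<psi> x) $ a"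
    "?c (pvar [\<mu>] (Mat (Psi a))) = pd \<mu> \<psi> x $ a"
    "?c (pvar [\<mu>] (Mat (PsiBar a))) = pd \<mu> (\<lambda>y. bar \<gamma> (\<psi> y)) x $ a" for a \<mu>
    using pd_linear[OF bounded_linear_vec_nth \<psi>, of \<mu> a x]
      pd_linear[OF bounded_linear_compose[OF bounded_linear_vec_nth bl] \<psi>, of \<mu> a x] pd_linear[OF bl \<psi>, of \<mu> x]
    by (simp_all add: p\<psi>_def p\<psi>b_def classical_eval_simps)
  have ph': "?c (pvar [\<mu>] (Grav \<alpha> \<beta>)) = of_real (pd \<mu> h x $ \<alpha> $ \<beta>)" for \<mu> \<alpha> \<beta>
    using pd_linear[OF bounded_linear_compose[OF bounded_linear_of_real[where 'a = complex]
          bounded_linear_compose[OF bounded_linear_vec_nth bounded_linear_vec_nth]] sm, of \<mu> \<alpha> \<beta> x]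
    by (simp add: classical_eval_simps)
  have s: "?c (psand A M B) = pair (\<chi> a. ?c (A a)) (M *v (\<chi> a. ?c (B a)))" for A M B
    by (simp add: psand_def classical_eval_simps pair_def matrix_vector_mult_def sum_distrib_left mult_ac)
  have kin: "?c (pkin \<gamma> \<mu> \<alpha>) = kin \<gamma> \<psi> x \<mu> \<alpha>" for \<mu> \<alpha>
    by (simp add: pkin_def kin_def classical_eval_simps(7) s p)
  have mass: "?c pmass = bilin \<gamma> (\<psi> x) (mat 1)"
    by (simp add: pmass_def s p bilin_def)
  have \<Theta>: "?c (p\<Theta>_dirac \<gamma> \<mu> \<nu>) = \<i>/4 * (of_real (sg \<nu>) * kin \<gamma> \<psi> x \<nu> \<mu> + of_real (sg \<mu>) * kin \<gamma> \<psi> x \<mu> \<nu>)" for \<mu> \<nu>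
  proof -
    have 1: "pair b (M *v (\<chi> a. z * w $ a)) = z * pair b (M *v w)" for b w :: "complex^4" and M z
      by (simp add: pair_def matrix_vector_mult_def sum_distrib_left mult_ac)
    have 2: "pair (\<chi> a. z * b $ a) w = z * pair b w" for b w z
      by (simp add: pair_def sum_distrib_left mult_ac)
    show ?thesis
      by (simp add: p\<Theta>_dirac_def classical_eval_simps(1,4,5,7) s p classical_eval_traces(2) 1 2 kin_def algebra_simps)
  qed
  have hs: "h x $ i $ j = h x $ j $ i" for i j
    using h by (intro symmetric_nth) (simp add: deviation_def)
  define \<theta> where "\<theta> = (\<Sum>\<mu>\<in>UNIV. kin \<gamma> \<psi> x \<mu> \<mu>)"
  define HK where "HK = (\<Sum>\<mu>\<in>UNIV. \<Sum>\<alpha>\<in>UNIV. of_real (H$\<mu>$\<alpha>) * kin \<gamma> \<psi> x \<mu> \<alpha>)"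
  define HHK where "HHK = (\<Sum>\<mu>\<in>UNIV. \<Sum>\<alpha>\<in>UNIV. of_real ((H ** H)$\<mu>$\<alpha>) * kin \<gamma> \<psi> x \<mu> \<alpha>)"
  define M where "M = bilin \<gamma> (\<psi> x) (mat 1)"
  have c1: "?c (ptr1 (p\<Theta>_dirac \<gamma>)) = \<i>/2 * \<theta>"
    unfolding classical_eval_traces(5) \<Theta> \<theta>_def sum_distrib_left by (intro sum.cong refl) (simp add: sg_def)
  have c2: "?c (ptr2 ph ph) = of_real q" "?c ptrace = of_real t"
    unfolding t_def q_def H_def by (rule classical_ptr2_graviton[OF h], rule classical_eval_traces(7))
  have c3: "?c (ptr3 ph (p\<Theta>_dirac \<gamma>)) = \<i>/2 * HHK"
  \<comment> \<open>The tensor is symmetrized while \<open>kin\<close> is not; symmetry of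
    \<open>N\<close>, the square of \<open>h\<close> contracted with \<open>eta\<close>, makes the
    two halves equal.\<close>
  proof -
    define N where "N = (\<lambda>\<mu> \<nu>. \<Sum>\<kappa>\<in>UNIV. complex_of_real (sg \<kappa>) * of_real (h x $\<mu>$\<kappa>) * of_real (h x $\<kappa>$\<nu>))"
    have N: "N \<mu> \<nu> = N \<nu> \<mu>" for \<mu> \<nu>
      unfolding N_def by (rule sum.cong[OF refl]) (simp add: hs[of \<mu>] hs[of _ \<nu>])
    define k where "k = (\<lambda>\<mu> \<nu>. of_real (sg \<mu>) * kin \<gamma> \<psi> x \<mu> \<nu>)"
    have "?c (ptr3 ph (p\<Theta>_dirac \<gamma>)) = (\<Sum>\<mu>\<in>UNIV. \<Sum>\<nu>\<in>UNIV. N \<mu> \<nu> * (\<i>/4 * (k \<nu> \<mu> + k \<mu> \<nu>)))"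
      unfolding classical_eval_traces(6) classical_eval_traces(1) \<Theta> N_def k_def ..
    also have "\<dots> = (\<Sum>\<mu>\<in>UNIV. \<Sum>\<nu>\<in>UNIV. \<i>/4 * (N \<nu> \<mu> * k \<nu> \<mu>)) + (\<Sum>\<mu>\<in>UNIV. \<Sum>\<nu>\<in>UNIV. \<i>/4 * (N \<mu> \<nu> * k \<mu> \<nu>))"
      unfolding sum.distrib[symmetric]
      by (intro sum.cong refl) (subst N, simp add: algebra_simps)
    also have "(\<Sum>\<mu>\<in>UNIV. \<Sum>\<nu>\<in>UNIV. \<i>/4 * (N \<nu> \<mu> * k \<nu> \<mu>)) = (\<Sum>\<mu>\<in>UNIV. \<Sum>\<nu>\<in>UNIV. \<i>/4 * (N \<mu> \<nu> * k \<mu> \<nu>))"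
      by (rule sum.swap)
    also have "(\<Sum>\<mu>\<in>UNIV. \<Sum>\<nu>\<in>UNIV. \<i>/4 * (N \<mu> \<nu> * k \<mu> \<nu>)) = \<i>/4 * HHK"
      unfolding HHK_def H_def N_def k_def matrix_matrix_mult_def[of "eta ** h x"] eta_mult_nth sum_distrib_left sum_distrib_right
      by (simp add: sum_distrib_left sum_distrib_right mult_ac)
    finally show ?thesis by simp
  qed
  \<comment> \<open>The signs from lowering the three Dirac matrices cancel those from raising the
    indices in \<open>ph_dh\<close>. The remaining 1/2 inverts the factor 2 in the third part of
    \<open>gamma3_antisym\<close>.\<close>
  have c4: "?c (pspin \<gamma>) = spin_bilinear h \<gamma> \<psi> x / 2"
  proof -
    have low: "gamma_low \<gamma> \<mu> = sg \<mu> *\<^sub>R \<gamma> \<mu>" for \<mu>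
      by (simp add: gamma_low_def eta_nth if_distrib[of "\<lambda>z. z *\<^sub>R _"] cong: if_cong)
    have sc: "(a *\<^sub>R A) ** B = a *\<^sub>R (A ** B)" "A ** (a *\<^sub>R B) = a *\<^sub>R (A ** B)" for a and A B :: "complex^4^4"
      by (simp_all add: vec_eq_iff matrix_matrix_mult_def scaleR_sum_right)
    have g: "gamma_low \<gamma> \<mu> ** gamma_low \<gamma> \<rho> ** gamma_low \<gamma> \<sigma> - gamma_low \<gamma> \<sigma> ** gamma_low \<gamma> \<rho> ** gamma_low \<gamma> \<mu>
      = (sg \<mu> * sg \<rho> * sg \<sigma> / 2) *\<^sub>R gamma3 \<gamma> \<mu> \<rho> \<sigma>" for \<mu> \<rho> \<sigma>
      unfolding gamma3_antisym(3)[OF \<gamma>] low sc by (simp add: scaleR_right_diff_distrib mult_ac)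
    have hd: "?c (ph_dh \<mu> \<rho> \<sigma>) = of_real (sg \<mu> * sg \<rho> * sg \<sigma>) * of_real ((h x ** eta ** pd \<mu> h x)$\<rho>$\<sigma>)" for \<mu> \<rho> \<sigma>
      unfolding ph_dh_def classical_eval_simps(1,5,6) classical_eval_traces(1-3) ph' eta_sandwich_nth
      by (simp add: sum_distrib_left mult_ac)
    have "?c (psand p\<psi>b (r *\<^sub>R gamma3 \<gamma> \<mu> \<rho> \<sigma>) p\<psi>) = of_real r * bilin \<gamma> (\<psi> x) (gamma3 \<gamma> \<mu> \<rho> \<sigma>)" for \<mu> \<rho> \<sigma> r
      using linear_cmul[OF linear_bilin, of \<gamma> "\<psi> x" r "gamma3 \<gamma> \<mu> \<rho> \<sigma>"]
      by (simp add: s p scaleR_conv_of_real[where 'a = complex]) (simp add: bilin_def)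
    then show ?thesis
      unfolding pspin_def classical_eval_simps(5,6) hd g spin_bilinear_def sum_divide_distrib
      by (intro sum.cong refl) (simp add: mult_ac)
  qed
  have c5: "(\<Sum>\<mu>\<in>UNIV. \<Sum>\<alpha>\<in>UNIV. \<i>/8 * of_real (sg \<mu>) * of_real (h x$\<mu>$\<alpha>) * kin \<gamma> \<psi> x \<mu> \<alpha>) = \<i>/8 * HK"
    unfolding HK_def H_def eta_mult_nth by (simp add: sum_distrib_left mult_ac)
  have c6: "(\<Sum>\<mu>\<in>UNIV. \<i>/32 * of_real t * kin \<gamma> \<psi> x \<mu> \<mu>) = \<i>/32 * of_real t * \<theta>"
    unfolding \<theta>_def by (simp add: sum_distrib_left)
  have B2: "(\<Sum>\<mu>\<in>UNIV. \<Sum>\<alpha>\<in>UNIV. of_real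
        ((- ((H ** H) /\<^sub>R 8) + (t / 8) *\<^sub>R H + (t\<^sup>2 / 32 - q / 8) *\<^sub>R mat 1)$\<mu>$\<alpha>) * kin \<gamma> \<psi> x \<mu> \<alpha>)
     = - HHK / 8 + of_real t / 8 * HK + of_real (t\<^sup>2 / 32 - q / 8) * \<theta>"
  proof -
    have "(\<Sum>\<alpha>\<in>UNIV. of_real ((mat 1 :: real^4^4)$\<mu>$\<alpha>) * kin \<gamma> \<psi> x \<mu> \<alpha>) = kin \<gamma> \<psi> x \<mu> \<mu>" for \<mu>
      by (simp add: mat_nth if_distrib[of "\<lambda>z. of_real z * _"] cong: if_cong)
    then have "\<theta> = (\<Sum>\<mu>\<in>UNIV. \<Sum>\<alpha>\<in>UNIV. of_real ((mat 1 :: real^4^4)$\<mu>$\<alpha>) * kin \<gamma> \<psi> x \<mu> \<alpha>)"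
      by (simp add: \<theta>_def)
    then show ?thesis
      unfolding HK_def HHK_def
      by (simp add: sum_distrib_left sum_divide_distrib sum_negf[symmetric] sum.distrib[symmetric])
        (simp add: algebra_simps)
  qed
  \<comment> \<open>The correction with 1/2 changes the coefficient of \<open>q\<close> times the
    trace of \<open>\<Theta>\<close> from 1/4 to -1/4, which is the \<open>- q / 8\<close> in front
    of \<open>\<theta>\<close>, and supplies the mass term \<open>m q / 2\<close>.\<close>
  have "?c (dirac_poly \<gamma> m) = \<i> * (\<Sum>\<mu>\<in>UNIV. \<Sum>\<alpha>\<in>UNIV. of_real
        ((- ((H ** H) /\<^sub>R 8) + (t / 8) *\<^sub>R H + (t\<^sup>2 / 32 - q / 8) *\<^sub>R mat 1)$\<mu>$\<alpha>) * kin \<gamma> \<psi> x \<mu> \<alpha>)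
     - \<i>/32 * spin_bilinear h \<gamma> \<psi> x - of_real (m * (t\<^sup>2 / 4 - q / 2)) * M"
    unfolding B2 dirac_poly_def pL2_def classical_eval_simps(1,4-7) c1 c2 c3 c4 kin mass classical_eval_traces(1) c5 c6 M_def[symmetric]
    by (simp add: field_simps power2_eq_square)
  note eq = this[unfolded t_def q_def H_def M_def]
  show "second_order_expansion (\<lambda>\<kappa>. Lcl_dirac \<gamma> m (metric \<kappa> h) \<psi> x) (Lcl0_dirac \<gamma> m \<psi> x) (?c (dirac_poly \<gamma> m))"
    unfolding eq by (rule dirac_expansion[OF h \<gamma>])
qed

theorem theorem3p9:
  fixes c :: "spacetime \<Rightarrow> real" and eps :: "real^3 \<Rightarrow> bool \<Rightarrow> complex^3"
    and \<gamma> :: "4 \<Rightarrow> complex^4^4" and m :: real and u v :: "real^3 \<Rightarrow> bool \<Rightarrow> complex^4"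
    and h :: "4 \<Rightarrow> 4 \<Rightarrow> wick" and \<phi> :: wick and F :: "4 \<Rightarrow> 4 \<Rightarrow> wick" and \<psi> \<psi>b :: "4 \<Rightarrow> wick"
  assumes "string_smearing c" and "helicity_vectors eps" and "0 \<le> m"
    and "dirac_matrices \<gamma>" and "dirac_spinors \<gamma> m u v"
  defines "h \<equiv> graviton_field c eps" and "\<phi> \<equiv> scalar_field m" and "F \<equiv> maxwell_field eps"
    and "\<psi> \<equiv> dirac_field m u v" and "\<psi>b \<equiv> dirac_conjugate \<gamma> (dirac_field m u v)"
  shows
    "(\<exists>P. scalar_second_order m P \<and>
       eq_up_to_div ({h \<mu> \<nu> |\<mu> \<nu>. True} \<union> {\<phi>})
         (L2_scalar h m \<phi>) (wick_eval h (\<lambda>_. \<phi>) P)) \<and>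
     (\<exists>P. maxwell_second_order P \<and>
       eq_up_to_div ({h \<mu> \<nu> |\<mu> \<nu>. True} \<union> {F \<mu> \<nu> |\<mu> \<nu>. True})
         (L2_maxwell h F) (wick_eval h (\<lambda>(\<mu>, \<nu>). F \<mu> \<nu>) P)) \<and>
     (\<exists>P. dirac_second_order \<gamma> m P \<and>
       eq_up_to_div ({h \<mu> \<nu> |\<mu> \<nu>. True} \<union> range \<psi> \<union> range \<psi>b)
         (L2_dirac h \<gamma> \<psi>) (wick_eval h (\<lambda>X. case X of Psi a \<Rightarrow> \<psi> a | PsiBar a \<Rightarrow> \<psi>b a) P))"
proof -
  have h: "(\<Sum>\<mu>\<in>UNIV. wconst (of_real (sg \<mu>)) * h \<mu> \<mu>) = 0"
    unfolding h_def by (rule graviton_traceless) fact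
  have "eq_up_to_div ({h \<mu> \<nu> |\<mu> \<nu>. True} \<union> {\<phi>}) (L2_scalar h m \<phi>) (wick_eval h (\<lambda>_. \<phi>) (scalar_poly m))"
    unfolding wick_eval_scalar[of h, OF h] by (rule eq_up_to_div_refl)
  moreover have "eq_up_to_div ({h \<mu> \<nu> |\<mu> \<nu>. True} \<union> {F \<mu> \<nu> |\<mu> \<nu>. True})
      (L2_maxwell h F) (wick_eval h (\<lambda>(\<mu>, \<nu>). F \<mu> \<nu>) maxwell_poly)"
    unfolding wick_eval_maxwell[of h, OF h] by (rule eq_up_to_div_refl)
  moreover have "eq_up_to_div ({h \<mu> \<nu> |\<mu> \<nu>. True} \<union> range \<psi> \<union> range \<psi>b)
      (L2_dirac h \<gamma> \<psi>) (wick_eval h (\<lambda>X. case X of Psi a \<Rightarrow> \<psi> a | PsiBar a \<Rightarrow> \<psi>b a) (dirac_poly \<gamma> m))"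
    unfolding h_def \<psi>_def \<psi>b_def wick_eval_dirac[OF assms(2,4,5)] by (rule eq_up_to_div_refl)
  ultimately show ?thesis
    using scalar_second_order_poly maxwell_second_order_poly dirac_second_order_poly[OF assms(4)] by blast
qed

end
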